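(* Let $[a,b]$ be a closed bounded subinterval of $\mathbb{R}$, and let $E \subseteq [a,b]$ be closed and Lebesgue null. Let $\omega \in C^{\infty}(\mathbb{R})$ be strictly convex, with $\omega(p) \geq \omega(0) = 0$ for all $p \in \mathbb{R}$ and $\omega(p)/|p| \to \infty$ as $|p| \to \infty$. Then there exist $L \in C^{\infty}(\mathbb{R}^3)$, $L = L(x,y,p)$, strictly convex in $p$ and such that $L(x,y,p) \geq \omega(p)$ for all $(x,y,p) \in \mathbb{R}^3$, and a function $u \in \mathrm{AC}(a,b)$ such that: (i) $u$ is the unique minimizer of the functional $\mathscr{L}(v) = \int_a^b L(x,v(x),v'(x))\,dx$ over all $v \in \mathrm{AC}(a,b)$ with $v(a) = u(a)$ and $v(b) = u(b)$; (ii) the singular set of $u$, i.e. the set of points where $u$ has infinite derivative, is precisely $E$; (iii) there exist functions $u_k \in C^{\infty}([a,b])$ with $u_k(a) = u(a)$, $u_k(b) = u(b)$, such that $u_k \to u$ uniformly on $[a,b]$ and $\mathscr{L}(u_k) \to \mathscr{L}(u)$.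
   Context: $\mathrm{AC}(a,b)$ denotes the class of real-valued absolutely continuous functions on $[a,b]$. *)

theory Defs
  imports "HOL-Analysis.Analysis"
begin

definition strict_convex_on :: "'a::real_vector set \<Rightarrow> ('a \<Rightarrow> real) \<Rightarrow> bool" where
  "strict_convex_on S f \<longleftrightarrow> convex S \<and>
     (\<forall>x\<in>S. \<forall>y\<in>S. \<forall>t::real. x \<noteq> y \<and> 0 < t \<and> t < 1 \<longrightarrow>
        f ((1 - t) *\<^sub>R x + t *\<^sub>R y) < (1 - t) * f x + t * f y)"

coinductive smooth :: "('a::euclidean_space \<Rightarrow> real) \<Rightarrow> bool" where
  "continuous_on UNIV f \<Longrightarrow>
   (\<forall>i\<in>Basis. \<exists>g. (\<forall>x. ((\<lambda>t. f (x + t *\<^sub>R i)) has_real_derivative g x) (at 0)) \<and> smooth g)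
   \<Longrightarrow> smooth f"

definition absolutely_continuous_on :: "real \<Rightarrow> real \<Rightarrow> (real \<Rightarrow> real) \<Rightarrow> bool" where
  "absolutely_continuous_on a b f \<longleftrightarrow>
     (\<forall>\<epsilon>>0. \<exists>\<delta>>0. \<forall>(n::nat) (s::nat \<Rightarrow> real) (t::nat \<Rightarrow> real).
        (\<forall>i<n. a \<le> s i \<and> s i \<le> t i \<and> t i \<le> b) \<and>
        (\<forall>i<n. \<forall>j<n. i \<noteq> j \<longrightarrow> t i \<le> s j \<or> t j \<le> s i) \<and>
        (\<Sum>i<n. t i - s i) < \<delta> \<longrightarrow>
        (\<Sum>i<n. \<bar>f (t i) - f (s i)\<bar>) < \<epsilon>)"

text \<open>The integral functional \<open>\<int>_a^b L(x, v(x), v'(x)) dx\<close> for a nonnegative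
  Lagrangian, as an extended nonnegative real (Lebesgue integral; \<open>v'\<close> is the
  classical derivative, which exists a.e. for absolutely continuous \<open>v\<close>).\<close>
definition functional :: "(real \<Rightarrow> real \<Rightarrow> real \<Rightarrow> real) \<Rightarrow> real \<Rightarrow> real \<Rightarrow> (real \<Rightarrow> real) \<Rightarrow> ennreal" where
  "functional L a b v = (\<integral>\<^sup>+ x \<in> {a..b}. ennreal (L x (v x) (deriv v x)) \<partial>lebesgue)"

definition infinite_deriv_at :: "(real \<Rightarrow> real) \<Rightarrow> real \<Rightarrow> real \<Rightarrow> real \<Rightarrow> bool" where
  "infinite_deriv_at u a b x \<longleftrightarrow>
     filterlim (\<lambda>y. (u y - u x) / (y - x)) at_top (at x within {a..b}) \<or>
     filterlim (\<lambda>y. (u y - u x) / (y - x)) at_bot (at x within {a..b})"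

definition singular_set :: "(real \<Rightarrow> real) \<Rightarrow> real \<Rightarrow> real \<Rightarrow> real set" where
  "singular_set u a b = {x \<in> {a..b}. infinite_deriv_at u a b x}"

end

(*
  The minimizer is u = sum_n Q_n with Q_0(x) = x and Q_n' = beta_n a cutoff that is 1 near E and
  lives on a tiny neighbourhood of E. The supports are nested, so off E only finitely many terms
  count and u' = psi = sum_n beta_n, while on E every partial sum u_n has slope n + 1 and the
  remainder u - u_n is monotone, which forces an infinite derivative exactly on E.

  L is calibrated by the potentials
      Phi_N(x, y) = C x + sum_{n <= N} B_n beta_n(x) Theta_n(y - u_n(x)),
  where Theta_n is the identity near 0 and has tiny values, a tiny support and almost no negative
  slope. Let P_N(x, y, p) be the derivative of Phi_N along a curve through (x, y) with slope p,
  let r_N(x, y) be a cut-off version of psi equal to psi on the graph of u, and subtract from P_N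
  the tangent of omega at r_N to get s_N. With T a smooth convex version of max(0, -), set
      L(x, y, p) = omega(p) + lim_N T(s_N(x, y, p)).
  T >= 0 gives L >= omega, affinity of s_N in p gives strict convexity, and T(s) >= s gives
  L >= P_N up to errors living where beta_{N+1} is nonzero, with equality along u because there s_N >= 1.
  Smoothness is only in question on the graph of u over E. For |p| bounded, the large constants
  B_n make s_N <= 0 near such a point for all large N, so that T(s_N) is locally constant.

  Integrating P_N along a competitor v gives Phi_N at the end points, whence the functional at u
  is at most that at v in the limit; the strict convexity of omega moreover gives v' <= u' almost
  everywhere in case of equality, so v = u. The measures of the supports of beta_n are chosen
  against a bound of L and P_N on {beta_n nonzero}; this gives an integrable majorant, so that the
  functional also converges along the u_n, corrected by affine functions at the end points.
*)

theory Submission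
  imports Defs
begin

section \<open>Smooth functions\<close>

text \<open>Two demands pull against each other. Calibration needs \<open>s\<^sub>N\<close> to be at
  least 1 on the graph of \<open>u\<close>, where \<open>T\<close> is the identity; smoothness over
  \<open>E\<close> needs \<open>s\<^sub>N \<le> 0\<close> for bounded slopes near the same graph.
  One kind of term serves both, because it compares the slope \<open>p\<close> with
  \<open>\<psi>\<^sub>N n x\<close>, which is about \<open>n\<close>: where \<open>m\<close> is the
  last active cutoff, the slope of \<open>u\<close> exceeds it by at least 1 for
  \<open>n \<le> m - 2\<close>, while a bounded \<open>p\<close> stays below it for all large
  \<open>n\<close>. A huge factor \<open>B n\<close> then produces either sign. Compact support
  forces each \<open>\<Theta> n\<close> to descend somewhere, and there the comparison has the wrong
  sign. The descent is therefore so gentle, of slope at least \<open>- \<delta> n\<close>, that the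
  errors stay within a summable budget \<open>\<kappa> n\<close> times a factor linear in
  \<open>\<bar>p\<bar>\<close>, which the growth of \<open>\<omega>\<close> absorbs. The supports
  around the moving centres \<open>u\<^sub>N n\<close> are nested, so that an active term sees all
  earlier ones undistorted. This dictates the order of choice: the cutoff of a stage, then its
  \<open>\<Theta>\<close>, whose radius limits the next stage.\<close>

lemma smooth_imp_continuous_on: "smooth f \<Longrightarrow> continuous_on S f"
  by (auto elim!: smooth.cases intro: continuous_on_subset)

text \<open>Closing \<open>smooth\<close> under the ring operations and composition makes all closure properties
  one instance of coinduction.\<close>
inductive smooth_gen :: "('a::euclidean_space \<Rightarrow> real) \<Rightarrow> bool" where
  base: "smooth f \<Longrightarrow> smooth_gen f"
| const: "smooth_gen (\<lambda>x. c)"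
| add: "smooth_gen f \<Longrightarrow> smooth_gen g \<Longrightarrow> smooth_gen (\<lambda>x. f x + g x)"
| mult: "smooth_gen f \<Longrightarrow> smooth_gen g \<Longrightarrow> smooth_gen (\<lambda>x. f x * g x)"
| comp: "smooth (h::real\<Rightarrow>real) \<Longrightarrow> smooth_gen f \<Longrightarrow> smooth_gen (\<lambda>x. h (f x))"

lemma smooth_real_derivE:
  fixes h :: "real \<Rightarrow> real"
  assumes "smooth h"
  obtains h' where "smooth h'" "\<And>x. (h has_real_derivative h' x) (at x)"
proof -
  have "\<exists>g. (\<forall>x. ((\<lambda>t. h (x + t *\<^sub>R 1)) has_real_derivative g x) (at 0)) \<and> smooth g"
    using assms by (cases rule: smooth.cases) simp
  then obtain g where g: "smooth g" "\<And>x. ((\<lambda>t. h (x + t *\<^sub>R 1)) has_real_derivative g x) (at 0)"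
    by blast
  have "(h has_real_derivative g x) (at x)" for x
  proof -
    have "((\<lambda>t. h (t + x)) has_real_derivative g x) (at 0)"
      using g(2)[of x] by (simp add: add.commute)
    then show ?thesis using DERIV_shift[of h "g x" 0 x] by simp
  qed
  then show ?thesis using g(1) that by blast
qed

text \<open>The class has to be closed under directional derivatives. The product and chain rules
  turn the derivative of a generated function into sums and products of generated ones; in the case
  \<open>comp\<close> the outer factor is \<open>h'\<close>, which is again smooth.\<close>

lemma smooth_gen_cont_deriv:
  assumes "smooth_gen (f::'a::euclidean_space \<Rightarrow> real)"
  shows "continuous_on UNIV f \<and>
    (\<forall>i\<in>Basis. \<exists>g. (\<forall>x. ((\<lambda>t. f (x + t *\<^sub>R i)) has_real_derivative g x) (at 0)) \<and> smooth_gen g)"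
  using assms
proof induction
  case (base f)
  from base show ?case
    by (cases rule: smooth.cases) (meson smooth_gen.base)
next
  case (const c)
  then show ?case by (auto intro!: exI[of _ "\<lambda>x. 0"] smooth_gen.const)
next
  case (add f g)
  show ?case
  proof (intro conjI ballI)
    show "continuous_on UNIV (\<lambda>x. f x + g x)" using add by (intro continuous_intros) auto
    fix i :: 'a assume i: "i \<in> Basis"
    from add.IH i obtain f' g' where fg:
      "\<And>x. ((\<lambda>t. f (x + t *\<^sub>R i)) has_real_derivative f' x) (at 0)" "smooth_gen f'"
      "\<And>x. ((\<lambda>t. g (x + t *\<^sub>R i)) has_real_derivative g' x) (at 0)" "smooth_gen g'" by metis
    show "\<exists>h. (\<forall>x. ((\<lambda>t. f (x + t *\<^sub>R i) + g (x + t *\<^sub>R i)) has_real_derivative h x) (at 0)) \<and> smooth_gen h"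
      by (rule exI[of _ "\<lambda>x. f' x + g' x"]) (auto intro!: DERIV_add fg smooth_gen.add)
  qed
next
  case (mult f g)
  show ?case
  proof (intro conjI ballI)
    show "continuous_on UNIV (\<lambda>x. f x * g x)" using mult by (intro continuous_intros) auto
    fix i :: 'a assume i: "i \<in> Basis"
    from mult.IH i obtain f' g' where fg:
      "\<And>x. ((\<lambda>t. f (x + t *\<^sub>R i)) has_real_derivative f' x) (at 0)" "smooth_gen f'"
      "\<And>x. ((\<lambda>t. g (x + t *\<^sub>R i)) has_real_derivative g' x) (at 0)" "smooth_gen g'" by metis
    have "((\<lambda>t. f (x + t *\<^sub>R i) * g (x + t *\<^sub>R i)) has_real_derivative f' x * g x + g' x * f x) (at 0)" for x
      using DERIV_mult[OF fg(1)[of x] fg(3)[of x]] by simp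
    then show "\<exists>h. (\<forall>x. ((\<lambda>t. f (x + t *\<^sub>R i) * g (x + t *\<^sub>R i)) has_real_derivative h x) (at 0)) \<and> smooth_gen h"
      by (intro exI[of _ "\<lambda>x. f' x * g x + g' x * f x"])
         (auto intro!: fg smooth_gen.add smooth_gen.mult mult.hyps)
  qed
next
  case (comp h f)
  obtain h' where h': "smooth h'" "\<And>x. (h has_real_derivative h' x) (at x)"
    using smooth_real_derivE[OF comp.hyps(1)] by blast
  show ?case
  proof (intro conjI ballI)
    show "continuous_on UNIV (\<lambda>x. h (f x))"
      using comp smooth_imp_continuous_on[of h UNIV]
      by (intro continuous_on_compose2[of UNIV h UNIV f]) auto
    fix i :: 'a assume i: "i \<in> Basis"
    from comp.IH i obtain f' where f':
      "\<And>x. ((\<lambda>t. f (x + t *\<^sub>R i)) has_real_derivative f' x) (at 0)" "smooth_gen f'" by metis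
    have "((\<lambda>t. h (f (x + t *\<^sub>R i))) has_real_derivative h' (f x) * f' x) (at 0)" for x
      by (rule DERIV_chain2[of h _ "\<lambda>t. f (x + t *\<^sub>R i)"]) (use h'(2) f'(1) in auto)
    moreover have "smooth_gen (\<lambda>x. h' (f x) * f' x)"
      by (rule smooth_gen.mult[OF smooth_gen.comp[OF h'(1) comp.hyps(2)] f'(2)])
    ultimately show "\<exists>g. (\<forall>x. ((\<lambda>t. h (f (x + t *\<^sub>R i))) has_real_derivative g x) (at 0)) \<and> smooth_gen g"
      by (intro exI[of _ "\<lambda>x. h' (f x) * f' x"]) simp
  qed
qed

lemma smooth_gen_imp_smooth: "smooth_gen f \<Longrightarrow> smooth f"
proof (coinduction arbitrary: f rule: smooth.coinduct)
  case (smooth f)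
  then show ?case using smooth_gen_cont_deriv[of f] by blast
qed

lemma smooth_const [simp]: "smooth (\<lambda>x::'a::euclidean_space. c)"
  by (rule smooth_gen_imp_smooth[OF smooth_gen.const])

lemma smooth_add: "smooth f \<Longrightarrow> smooth g \<Longrightarrow> smooth (\<lambda>x. f x + g x)"
  by (rule smooth_gen_imp_smooth[OF smooth_gen.add[OF smooth_gen.base smooth_gen.base]])

lemma smooth_mult: "smooth f \<Longrightarrow> smooth g \<Longrightarrow> smooth (\<lambda>x. f x * g x)"
  by (rule smooth_gen_imp_smooth[OF smooth_gen.mult[OF smooth_gen.base smooth_gen.base]])

lemma smooth_compose: "smooth (h::real\<Rightarrow>real) \<Longrightarrow> smooth f \<Longrightarrow> smooth (\<lambda>x. h (f x))"
  by (rule smooth_gen_imp_smooth[OF smooth_gen.comp[OF _ smooth_gen.base]])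

lemma smooth_diff: "smooth f \<Longrightarrow> smooth g \<Longrightarrow> smooth (\<lambda>x. f x - g x)"
  using smooth_add[of f "\<lambda>x. (-1) * g x"] smooth_mult[of "\<lambda>_. -1" g] by simp

lemma smooth_sum: "(\<And>i. i \<in> I \<Longrightarrow> smooth (f i)) \<Longrightarrow> smooth (\<lambda>x. \<Sum>i\<in>I. f i x)"
  by (induction I rule: infinite_finite_induct) (simp_all add: smooth_add)

lemma smooth_deriv_rule:
  fixes f :: "real \<Rightarrow> real"
  assumes "\<And>x. (f has_real_derivative f' x) (at x)" "smooth f'"
  shows "smooth f"
proof (rule smooth.intros)
  show "continuous_on UNIV f"
    using assms(1) by (meson DERIV_isCont continuous_at_imp_continuous_on)
  have "((\<lambda>t. f (x + t * 1)) has_real_derivative f' x) (at 0)" for x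
    using assms(1)[of x] DERIV_shift[of f "f' x" 0 x] by (simp add: add.commute)
  then show "\<forall>i\<in>Basis. \<exists>g. (\<forall>x. ((\<lambda>t. f (x + t *\<^sub>R i)) has_real_derivative g x) (at 0)) \<and> smooth g"
    using assms(2) by auto
qed

lemma smooth_inner_left: "smooth (\<lambda>x. x \<bullet> c)" for c :: "'a::euclidean_space"
proof (rule smooth.intros)
  show "continuous_on UNIV (\<lambda>x. x \<bullet> c)" by (intro continuous_intros)
  have "((\<lambda>t. (x + t *\<^sub>R i) \<bullet> c) has_real_derivative i \<bullet> c) (at 0)" for x i
    by (auto intro!: derivative_eq_intros simp: inner_add_left)
  then have "(\<forall>x. ((\<lambda>t. (x + t *\<^sub>R i) \<bullet> c) has_real_derivative i \<bullet> c) (at 0)) \<and>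
      smooth (\<lambda>x::'a. i \<bullet> c)" for i
    by (simp add: smooth_const)
  then show "\<forall>i\<in>Basis. \<exists>g. (\<forall>x. ((\<lambda>t. (x + t *\<^sub>R i) \<bullet> c) has_real_derivative g x) (at 0)) \<and> smooth g"
    by (intro ballI exI)
qed

lemma smooth_ident [simp]: "smooth (\<lambda>x::real. x)"
  using smooth_inner_left[of "1::real"] by simp

text \<open>Coinduction on the functions that agree near every point with a smooth one. Their
  directional derivatives are again of this kind: the local derivatives fit together to one global
  function because a derivative is unique.\<close>

lemma smooth_locally:
  assumes "\<And>x. \<exists>V h. open V \<and> x \<in> V \<and> smooth h \<and> (\<forall>z\<in>V. f z = h z)"
  shows "smooth (f::'a::euclidean_space \<Rightarrow> real)"
  using assms
proof (coinduction arbitrary: f rule: smooth.coinduct)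
  case (smooth f)
  have "isCont f x" for x
  proof -
    obtain V h where V: "open V" "x \<in> V" "smooth h" "\<forall>z\<in>V. f z = h z" using smooth by blast
    have "isCont h x" using smooth_imp_continuous_on[OF V(3), of UNIV]
      by (simp add: continuous_on_eq_continuous_at)
    moreover have "eventually (\<lambda>z. h z = f z) (nhds x)"
      by (rule eventually_mono[OF eventually_nhds_in_open[OF V(1,2)]]) (simp add: V(4))
    ultimately show ?thesis by (simp add: isCont_cong[of h f])
  qed
  then have c: "continuous_on UNIV f" by (simp add: continuous_on_eq_continuous_at)
  have "\<exists>g. (\<forall>x. ((\<lambda>t. f (x + t *\<^sub>R i)) has_real_derivative g x) (at 0)) \<and>
      (\<forall>x. \<exists>V h. open V \<and> x \<in> V \<and> smooth h \<and> (\<forall>z\<in>V. g z = h z))" if i: "i \<in> Basis" for i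
  proof -
    have loc: "\<exists>V g. open V \<and> x \<in> V \<and> smooth g \<and>
        (\<forall>z\<in>V. ((\<lambda>t. f (z + t *\<^sub>R i)) has_real_derivative g z) (at 0))" for x
    proof -
      obtain V h where V: "open V" "x \<in> V" "smooth h" "\<forall>z\<in>V. f z = h z" using smooth by blast
      obtain g where g: "smooth g" "\<And>z. ((\<lambda>t. h (z + t *\<^sub>R i)) has_real_derivative g z) (at 0)"
        using V(3) i by (cases rule: smooth.cases) meson
      have "((\<lambda>t. f (z + t *\<^sub>R i)) has_real_derivative g z) (at 0)" if z: "z \<in> V" for z
      proof -
        have "open ((\<lambda>t::real. z + t *\<^sub>R i) -` V)"
          by (rule open_vimage[OF V(1)]) (intro continuous_intros)
        then have "eventually (\<lambda>t. t \<in> (\<lambda>t::real. z + t *\<^sub>R i) -` V) (nhds (0::real))"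
          using z by (intro eventually_nhds_in_open) auto
        then have "eventually (\<lambda>t. h (z + t *\<^sub>R i) = f (z + t *\<^sub>R i)) (nhds 0)"
          by (rule eventually_mono) (use V(4) in auto)
        then show ?thesis using g(2)[of z] by (subst DERIV_cong_ev[OF refl _ refl, symmetric]) auto
      qed
      then show ?thesis using V g by blast
    qed
    define g where "g x = (SOME D. ((\<lambda>t. f (x + t *\<^sub>R i)) has_real_derivative D) (at 0))" for x
    have g: "((\<lambda>t. f (x + t *\<^sub>R i)) has_real_derivative g x) (at 0)" for x
    proof -
      have "\<exists>D. ((\<lambda>t. f (x + t *\<^sub>R i)) has_real_derivative D) (at 0)" using loc[of x] by blast
      then show ?thesis unfolding g_def by (rule someI_ex)
    qed
    moreover have "\<exists>V h. open V \<and> x \<in> V \<and> smooth h \<and> (\<forall>z\<in>V. g z = h z)" for x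
    proof -
      obtain V h where V: "open V" "x \<in> V" "smooth h"
        "\<forall>z\<in>V. ((\<lambda>t. f (z + t *\<^sub>R i)) has_real_derivative h z) (at 0)" using loc[of x] by blast
      have "\<forall>z\<in>V. g z = h z" using V(4) g by (blast intro: DERIV_unique)
      with V show ?thesis by blast
    qed
    ultimately show ?thesis by (intro exI[of _ g]) blast
  qed
  then have "\<forall>i\<in>Basis. \<exists>g. (\<forall>x. ((\<lambda>t. f (x + t *\<^sub>R i)) has_real_derivative g x) (at 0)) \<and>
      ((\<exists>f. g = f \<and> (\<forall>x. \<exists>V h. open V \<and> x \<in> V \<and> smooth h \<and> (\<forall>z\<in>V. f z = h z))) \<or> smooth g)"
    by (intro ballI) (drule meta_spec, drule meta_mp, assumption, erule ex_forward, simp)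
  with c show ?case by blast
qed

section \<open>Absolutely continuous functions\<close>

lemma absolutely_continuous_onD:
  assumes "absolutely_continuous_on a b f" "\<epsilon> > 0"
  shows "\<exists>\<delta>>0. \<forall>(n::nat) s t.
        (\<forall>i<n. a \<le> s i \<and> s i \<le> t i \<and> t i \<le> b) \<and>
        (\<forall>i<n. \<forall>j<n. i \<noteq> j \<longrightarrow> t i \<le> s j \<or> t j \<le> s i) \<and>
        (\<Sum>i<n. t i - s i) < \<delta> \<longrightarrow>
        (\<Sum>i<n. \<bar>f (t i) - f (s i)\<bar>) < \<epsilon>"
  using assms(1)[unfolded absolutely_continuous_on_def, THEN spec, THEN mp, OF assms(2)] .

text \<open>Coverings and divisions deliver sets of intervals, tagged or paired, rather than
  numbered sequences; hence an arbitrary finite index set, and disjoint interiors in place of an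
  order condition.\<close>

lemma absolutely_continuous_on_finite_family:
  fixes f :: "real \<Rightarrow> real"
  assumes "absolutely_continuous_on a b f" "\<epsilon> > 0"
  shows "\<exists>\<delta>>0. \<forall>(I::'i set) s t. finite I \<and> (\<forall>i\<in>I. a \<le> s i \<and> s i \<le> t i \<and> t i \<le> b) \<and>
       (\<forall>i\<in>I. \<forall>j\<in>I. i \<noteq> j \<longrightarrow> {s i<..<t i} \<inter> {s j<..<t j} = {}) \<and>
       (\<Sum>i\<in>I. t i - s i) < \<delta> \<longrightarrow> (\<Sum>i\<in>I. \<bar>f (t i) - f (s i)\<bar>) < \<epsilon>"
proof -
  obtain \<delta> where \<delta>: "\<delta> > 0" and D: "\<forall>(n::nat) s t. (\<forall>i<n. a \<le> s i \<and> s i \<le> t i \<and> t i \<le> b) \<and>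
        (\<forall>i<n. \<forall>j<n. i \<noteq> j \<longrightarrow> t i \<le> s j \<or> t j \<le> s i) \<and> (\<Sum>i<n. t i - s i) < \<delta> \<longrightarrow>
        (\<Sum>i<n. \<bar>f (t i) - f (s i)\<bar>) < \<epsilon>"
    using absolutely_continuous_onD[OF assms] by (elim exE conjE)
  show ?thesis
  proof (intro exI[of _ \<delta>] conjI \<delta> allI impI, elim conjE)
    fix I :: "'i set" and s t :: "'i \<Rightarrow> real"
    assume I: "finite I" and st: "\<forall>i\<in>I. a \<le> s i \<and> s i \<le> t i \<and> t i \<le> b"
      and dj: "\<forall>i\<in>I. \<forall>j\<in>I. i \<noteq> j \<longrightarrow> {s i<..<t i} \<inter> {s j<..<t j} = {}"
      and sm: "(\<Sum>i\<in>I. t i - s i) < \<delta>"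
    \<comment> \<open>Degenerate intervals are dropped: an empty open interval is disjoint from
      every other one, yet its point may lie inside another interval, where the order condition
      fails. They contribute nothing to either sum.\<close>
    define I' where "I' = {i\<in>I. s i < t i}"
    have fin: "finite I'" using I by (simp add: I'_def)
    obtain h where h: "bij_betw h {..<card I'} I'"
      using ex_bij_betw_nat_finite[OF fin] by (auto simp: lessThan_atLeast0)
    have hI: "h i \<in> I'" if "i < card I'" for i using h that by (auto simp: bij_betw_def)
    have ord: "t (h i) \<le> s (h j) \<or> t (h j) \<le> s (h i)" if "i < card I'" "j < card I'" "i \<noteq> j" for i j
    proof (rule ccontr)
      assume n: "\<not> ?thesis"
      have "h i \<noteq> h j" using that h by (auto simp: bij_betw_def inj_on_def)
      then have "{s (h i)<..<t (h i)} \<inter> {s (h j)<..<t (h j)} = {}"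
        using dj hI that by (simp add: I'_def)
      moreover have "(max (s (h i)) (s (h j)) + min (t (h i)) (t (h j))) / 2 \<in> {s (h i)<..<t (h i)} \<inter> {s (h j)<..<t (h j)}"
        using n hI[OF that(1)] hI[OF that(2)] by (auto simp: I'_def max_def min_def)
      ultimately show False by blast
    qed
    have eq: "(\<Sum>i<card I'. g (h i)) = (\<Sum>i\<in>I. g i)" if "\<And>i. i \<in> I \<Longrightarrow> s i = t i \<Longrightarrow> g i = 0" for g :: "'i \<Rightarrow> real"
    proof -
      have "(\<Sum>i<card I'. g (h i)) = (\<Sum>i\<in>I'. g i)" using h by (rule sum.reindex_bij_betw)
      also have "\<dots> = (\<Sum>i\<in>I. g i)"
        using that st by (intro sum.mono_neutral_left I) (force simp: I'_def)+
      finally show ?thesis .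
    qed
    have "(\<Sum>i<card I'. \<bar>f (t (h i)) - f (s (h i))\<bar>) < \<epsilon>"
      using hI st ord sm eq[of "\<lambda>i. t i - s i"]
      by (intro D[THEN spec[where x="card I'"], THEN spec[where x="\<lambda>i. s (h i)"],
            THEN spec[where x="\<lambda>i. t (h i)"], THEN mp]) (auto simp: I'_def)
    then show "(\<Sum>i\<in>I. \<bar>f (t i) - f (s i)\<bar>) < \<epsilon>"
      using eq[of "\<lambda>i. \<bar>f (t i) - f (s i)\<bar>"] by simp
  qed
qed

lemma absolutely_continuous_on_imp_continuous_on:
  assumes "absolutely_continuous_on a b f"
  shows "continuous_on {a..b} f"
proof (rule continuous_onI)
  fix x e :: real assume x: "x \<in> {a..b}" and e: "e > 0"
  obtain d where d: "d > 0" and D: "\<forall>(I::unit set) s t. finite I \<and> (\<forall>i\<in>I. a \<le> s i \<and> s i \<le> t i \<and> t i \<le> b) \<and>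
       (\<forall>i\<in>I. \<forall>j\<in>I. i \<noteq> j \<longrightarrow> {s i<..<t i} \<inter> {s j<..<t j} = {}) \<and>
       (\<Sum>i\<in>I. t i - s i) < d \<longrightarrow> (\<Sum>i\<in>I. \<bar>f (t i) - f (s i)\<bar>) < e"
    using absolutely_continuous_on_finite_family[OF assms e, where 'i=unit] by (elim exE conjE)
  show "\<exists>d>0. \<forall>x'\<in>{a..b}. dist x' x < d \<longrightarrow> dist (f x') (f x) \<le> e"
  proof (intro exI[of _ d] conjI d ballI impI)
    fix y assume y: "y \<in> {a..b}" "dist y x < d"
    show "dist (f y) (f x) \<le> e"
      using D[rule_format, of "{()}" "\<lambda>_. min x y" "\<lambda>_. max x y"] x y
      by (cases "x \<le> y") (auto simp: dist_real_def abs_minus_commute)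
  qed
qed

text \<open>Meant for the potential along a competitor \<open>v\<close>, which is a Lipschitz
  function of \<open>x\<close> and \<open>v x\<close>.\<close>

lemma absolutely_continuous_on_Lipschitz_comparison:
  fixes K :: real
  assumes v: "absolutely_continuous_on a b v" and K: "K \<ge> 0"
    and G: "\<And>s t. a \<le> s \<Longrightarrow> s \<le> t \<Longrightarrow> t \<le> b \<Longrightarrow> \<bar>G t - G s\<bar> \<le> K * (\<bar>t - s\<bar> + \<bar>v t - v s\<bar>)"
  shows "absolutely_continuous_on a b G"
  unfolding absolutely_continuous_on_def
proof (intro allI impI)
  fix \<epsilon> :: real assume \<epsilon>: "\<epsilon> > 0"
  define \<epsilon>' where "\<epsilon>' = \<epsilon> / (2 * (K + 1))"
  have \<epsilon>': "\<epsilon>' > 0" using K \<epsilon> by (simp add: \<epsilon>'_def)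
  obtain \<delta> where \<delta>: "\<delta> > 0" and D: "\<forall>(n::nat) s t. (\<forall>i<n. a \<le> s i \<and> s i \<le> t i \<and> t i \<le> b) \<and>
        (\<forall>i<n. \<forall>j<n. i \<noteq> j \<longrightarrow> t i \<le> s j \<or> t j \<le> s i) \<and> (\<Sum>i<n. t i - s i) < \<delta> \<longrightarrow>
        (\<Sum>i<n. \<bar>v (t i) - v (s i)\<bar>) < \<epsilon>'"
    using absolutely_continuous_onD[OF v \<epsilon>'] by (elim exE conjE)
  have "(\<Sum>i<n. \<bar>G (t i) - G (s i)\<bar>) < \<epsilon>"
    if h: "(\<forall>i<n. a \<le> s i \<and> s i \<le> t i \<and> t i \<le> b) \<and>
      (\<forall>i<n. \<forall>j<n. i \<noteq> j \<longrightarrow> t i \<le> s j \<or> t j \<le> s i) \<and> (\<Sum>i<n. t i - s i) < min \<delta> \<epsilon>'" for n and s t :: "nat \<Rightarrow> real"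
  proof -
    have "(\<Sum>i<n. \<bar>G (t i) - G (s i)\<bar>) \<le> (\<Sum>i<n. K * ((t i - s i) + \<bar>v (t i) - v (s i)\<bar>))"
      using G h by (intro sum_mono) (smt (verit) lessThan_iff)
    also have "\<dots> = K * ((\<Sum>i<n. t i - s i) + (\<Sum>i<n. \<bar>v (t i) - v (s i)\<bar>))"
      by (simp only: sum_distrib_left[symmetric] sum.distrib)
    also have "\<dots> \<le> K * (\<epsilon>' + \<epsilon>')"
      using D[rule_format, of n s t] h K by (intro mult_left_mono add_mono) auto
    also have "\<dots> < (K + 1) * (\<epsilon>' + \<epsilon>')" using \<epsilon>' by (simp add: algebra_simps)
    also have "\<dots> = \<epsilon>"
    proof -
      have "2 * (K + 1) > 0" using K by simp
      then have "\<epsilon>' * (2 * (K + 1)) = \<epsilon>" unfolding \<epsilon>'_def by simp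
      then show ?thesis by (simp only: algebra_simps)
    qed
    finally show ?thesis .
  qed
  then show "\<exists>\<delta>>0. \<forall>(n::nat) s t. (\<forall>i<n. a \<le> s i \<and> s i \<le> t i \<and> t i \<le> b) \<and>
        (\<forall>i<n. \<forall>j<n. i \<noteq> j \<longrightarrow> t i \<le> s j \<or> t j \<le> s i) \<and> (\<Sum>i<n. t i - s i) < \<delta> \<longrightarrow>
        (\<Sum>i<n. \<bar>G (t i) - G (s i)\<bar>) < \<epsilon>"
    using \<delta> \<epsilon>' by (intro exI[of _ "min \<delta> \<epsilon>'"] conjI allI impI) simp_all
qed

section \<open>Vitali coverings by intervals\<close>

lemma interval_family_measure:
  fixes F :: "real set set"
  assumes "finite F" "\<And>K. K \<in> F \<Longrightarrow> \<exists>s t. K = {s..t} \<and> s < t" "pairwise disjnt F"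
  shows "(\<Sum>K\<in>F. Sup K - Inf K) = measure lebesgue (\<Union>F)"
proof -
  have "measure lebesgue (\<Union>F) = (\<Sum>K\<in>F. measure lebesgue K)"
  proof (rule measure_negligible_finite_Union)
    show "pairwise (\<lambda>S T. negligible (S \<inter> T)) F"
      using assms(3) by (rule pairwise_mono) (auto simp: disjnt_def)
  qed (use assms in fastforce)+
  also have "\<dots> = (\<Sum>K\<in>F. Sup K - Inf K)"
    using assms(2) by (intro sum.cong) fastforce+
  finally show ?thesis by simp
qed

text \<open>A closed interval is a ball around its midpoint, so the Vitali covering theorem applies
  to the intervals with property \<open>P\<close> inside \<open>U\<close>. Finitely many members of
  the countable disjoint family exhaust its measure up to \<open>\<eta>\<close>.\<close>

lemma Vitali_intervals:
  fixes P :: "real \<Rightarrow> real \<Rightarrow> bool"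
  assumes A: "A \<in> lmeasurable" and U: "open U" "U \<in> lmeasurable" "A \<subseteq> U" and \<eta>: "\<eta> > 0"
    and P: "\<And>x d. x \<in> A \<Longrightarrow> d > 0 \<Longrightarrow> \<exists>s t. P s t \<and> s < t \<and> x \<in> {s..t} \<and> t - s < d"
  obtains F where "finite F" "\<And>K. K \<in> F \<Longrightarrow> \<exists>s t. K = {s..t} \<and> s < t \<and> P s t \<and> K \<subseteq> U"
    "pairwise disjnt F" "measure lebesgue A - \<eta> < measure lebesgue (\<Union>F)"
proof -
  define K where "K = {(s,t). P s t \<and> s < t \<and> {s..t} \<subseteq> U}"
  define c where "c = (\<lambda>(s::real,t). (s + t) / 2)"
  define r where "r = (\<lambda>(s::real,t). (t - s) / 2)"
  have cb: "cball (c p) (r p) = {fst p..snd p}" for p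
    by (cases p) (simp add: c_def r_def cball_eq_atLeastAtMost field_simps)
  have rpos: "0 < r p" if "p \<in> K" for p using that by (auto simp: K_def r_def)
  have cov: "\<exists>p. p \<in> K \<and> x \<in> cball (c p) (r p) \<and> r p < d" if x: "x \<in> A" and d: "0 < d" for x d
  proof -
    obtain e where e: "e > 0" "ball x e \<subseteq> U" using U x by (meson open_contains_ball subsetD)
    obtain s t where st: "P s t" "s < t" "x \<in> {s..t}" "t - s < min d e"
      using P[OF x, of "min d e"] d e by auto
    have "{s..t} \<subseteq> ball x e" using st by (auto simp: dist_real_def)
    then have "(s,t) \<in> K" using st e by (auto simp: K_def)
    moreover have "r (s,t) < d" using st by (simp add: r_def)
    ultimately show ?thesis using st cb[of "(s,t)"] by (intro exI[of _ "(s,t)"]) auto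
  qed
  obtain C where C: "countable C" "C \<subseteq> K"
     "pairwise (\<lambda>i j. disjnt (cball (c i) (r i)) (cball (c j) (r j))) C"
     "negligible (A - (\<Union>i\<in>C. cball (c i) (r i)))"
    by (rule Vitali_covering_theorem_cballs[of K r A c, OF rpos cov])
  define D where "D = (\<lambda>p. {fst p..snd p}) ` C"
  have DO: "\<Union>D \<subseteq> U" using C(2) by (fastforce simp: D_def K_def)
  have Dm: "\<Union>D \<in> lmeasurable"
  proof (rule fmeasurableI2[OF U(2) DO])
    show "\<Union>D \<in> sets lebesgue" using C(1) by (auto simp: D_def)
  qed
  obtain F where F: "F \<subseteq> D" "finite F" "measure lebesgue (\<Union>D) - \<eta> < measure lebesgue (\<Union>F)"
  proof (rule measure_countable_Union_approachable[of D \<eta> "measure lebesgue (\<Union>D)"])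
    show "countable D" using C(1) by (simp add: D_def)
    show "d \<in> lmeasurable" if "d \<in> D" for d using that by (auto simp: D_def)
    show "measure lebesgue (\<Union>D') \<le> measure lebesgue (\<Union>D)" if "D' \<subseteq> D" "finite D'" for D'
      using that Dm by (intro measure_mono_fmeasurable) (auto simp: D_def intro!: sets.finite_Union)
  qed (use \<eta> that in auto)
  have "measure lebesgue A \<le> measure lebesgue (\<Union>D)"
  proof -
    have "measure lebesgue A = measure lebesgue (A \<inter> \<Union>D)"
      by (rule measure_negligible_symdiff[symmetric])
         (use A Dm C(4) in \<open>auto simp: D_def cb Diff_Un sup.absorb2 intro: negligible_subset\<close>)
    also have "\<dots> \<le> measure lebesgue (\<Union>D)"
      using A Dm by (intro measure_mono_fmeasurable) auto
    finally show ?thesis .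
  qed
  show thesis
  proof (rule that[OF F(2)])
    show "\<exists>s t. k = {s..t} \<and> s < t \<and> P s t \<and> k \<subseteq> U" if kF: "k \<in> F" for k
    proof -
      obtain p where p: "p \<in> C" "k = {fst p..snd p}" using kF F(1) unfolding D_def by blast
      then have "p \<in> K" using C(2) by blast
      then show ?thesis using p(2) by (intro exI[of _ "fst p"] exI[of _ "snd p"]) (auto simp: K_def)
    qed
    have "pairwise disjnt D"
      using C(3) by (auto simp: D_def pairwise_def cb)
    then show "pairwise disjnt F" using F(1) by (rule pairwise_subset)
    show "measure lebesgue A - \<eta> < measure lebesgue (\<Union>F)"
      using F(3) \<open>measure lebesgue A \<le> _\<close> by linarith
  qed
qed

section \<open>Differentiability almost everywhere\<close>

lemma additive_division_1:
  fixes f :: "real \<Rightarrow> real"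
  assumes "a \<le> b" "D division_of {a..b}"
  shows "(\<Sum>K\<in>D. f (Sup K) - f (Inf K)) = f b - f a"
proof -
  have ne: "K \<in> D \<Longrightarrow> Inf K \<in> K" for K
    using division_ofD(3,4)[OF assms(2)] by fastforce
  have fin: "finite D" using assms(2) by blast
  \<comment> \<open>Any tag would do for a telescoping sum; the left end point lies in every
    piece.\<close>
  have "(\<lambda>K. (Inf K, K)) ` D tagged_division_of {a..b}"
  proof (intro tagged_division_ofI)
    fix x1 K1 x2 K2
    assume "(x1, K1) \<in> (\<lambda>K. (Inf K, K)) ` D" "(x2, K2) \<in> (\<lambda>K. (Inf K, K)) ` D" "(x1, K1) \<noteq> (x2, K2)"
    then show "interior K1 \<inter> interior K2 = {}"
      using division_ofD(5)[OF assms(2), of K1 K2] by auto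
  next
    show "\<Union>{K. \<exists>x. (x, K) \<in> (\<lambda>K. (Inf K, K)) ` D} = {a..b}"
      using division_ofD(6)[OF assms(2)] by (auto simp: image_iff)
  qed (use division_ofD(2,4)[OF assms(2)] ne fin in auto)
  from additive_tagged_division_1[OF assms(1) this, of f]
  show ?thesis by (subst (asm) sum.reindex) (auto simp: inj_on_def)
qed

text \<open>If \<open>A\<close> had positive measure, nearly all of it could be covered by disjoint intervals on which
  \<open>f\<close> rises at rate at most \<open>r\<close>, and again inside these by disjoint intervals on which \<open>f\<close> rises at rate
  at least \<open>R\<close>. The complementary pieces have small total length but carry a decrease of about
  \<open>(R - r) |A|\<close>, against absolute continuity.\<close>
lemma two_slopes_negligible:
  fixes f :: "real \<Rightarrow> real" and r R :: real
  assumes ac: "absolutely_continuous_on a b f" and A: "A \<in> lmeasurable" "A \<subseteq> {a<..<b}" and rR: "r < R"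
    and low: "\<And>x d. x \<in> A \<Longrightarrow> d > 0 \<Longrightarrow> \<exists>s t. f t - f s \<le> r * (t - s) \<and> s < t \<and> x \<in> {s..t} \<and> t - s < d"
    and up: "\<And>x d. x \<in> A \<Longrightarrow> d > 0 \<Longrightarrow> \<exists>s t. R * (t - s) \<le> f t - f s \<and> s < t \<and> x \<in> {s..t} \<and> t - s < d"
  shows "negligible A"
proof (rule ccontr)
  assume nA: "\<not> negligible A"
  define \<mu> where "\<mu> = measure lebesgue A"
  have \<mu>: "\<mu> > 0" using nA A(1) by (simp add: \<mu>_def negligible_iff_measure0 zero_less_measure_iff)
  define e where "e = (R - r) * \<mu> / 4"
  have e: "e > 0" using rR \<mu> by (simp add: e_def)
  obtain \<delta> where \<delta>: "\<delta> > 0" and D: "\<forall>(I::(real set \<times> real set) set) s t. finite I \<and>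
       (\<forall>i\<in>I. a \<le> s i \<and> s i \<le> t i \<and> t i \<le> b) \<and>
       (\<forall>i\<in>I. \<forall>j\<in>I. i \<noteq> j \<longrightarrow> {s i<..<t i} \<inter> {s j<..<t j} = {}) \<and>
       (\<Sum>i\<in>I. t i - s i) < \<delta> \<longrightarrow> (\<Sum>i\<in>I. \<bar>f (t i) - f (s i)\<bar>) < e"
    using absolutely_continuous_on_finite_family[OF ac e, where 'i="real set \<times> real set"]
    by (elim exE conjE)
  \<comment> \<open>The leftover pieces will have total length below \<open>4 * \<eta>\<close>, and
    replacing the measures of the two families by \<open>\<mu>\<close> costs at most
    \<open>3 * \<eta>\<close> times \<open>\<bar>R\<bar>\<close> and \<open>\<bar>r\<bar>\<close>.
    The two bounds in the minimum keep both errors small.\<close>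
  define \<eta> where "\<eta> = min (\<delta> / 8) ((R - r) * \<mu> / (16 * (\<bar>r\<bar> + \<bar>R\<bar> + 1)))"
  have pos: "16 * (\<bar>r\<bar> + \<bar>R\<bar> + 1) > 0" by simp
  have \<eta>: "\<eta> > 0" using \<delta> rR \<mu> pos by (simp add: \<eta>_def)
  have \<eta>2: "\<eta> \<le> \<delta> / 8" unfolding \<eta>_def by (rule min.cobounded1)
  have \<eta>3: "\<eta> * (16 * (\<bar>r\<bar> + \<bar>R\<bar> + 1)) \<le> (R - r) * \<mu>"
    using pos by (simp add: \<eta>_def min_def pos_le_divide_eq)
  obtain U0 where U0: "open U0" "A \<subseteq> U0" "U0 - A \<in> lmeasurable" "emeasure lebesgue (U0 - A) < ennreal \<eta>"
    using sets_lebesgue_outer_open[of A \<eta>] A(1) \<eta> by (metis fmeasurableD)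
  define U where "U = U0 \<inter> {a<..<b}"
  have U: "open U" "U \<in> lmeasurable" "A \<subseteq> U" "U \<subseteq> {a<..<b}"
    using U0 A(2) by (auto simp: U_def intro!: lmeasurable_open bounded_Int)
  have mU: "measure lebesgue U < \<mu> + \<eta>"
  proof -
    have "measure lebesgue (U0 - A) < \<eta>"
      using U0(3,4) \<eta> by (simp add: emeasure_eq_measure2 ennreal_less_iff)
    moreover have "measure lebesgue (U - A) \<le> measure lebesgue (U0 - A)"
      using U0(3) U(2) A(1) by (intro measure_mono_fmeasurable) (auto simp: U_def)
    moreover have "measure lebesgue (U - A) = measure lebesgue U - measure lebesgue A"
      using U A by (intro measurable_measure_Diff) auto
    ultimately show ?thesis by (simp add: \<mu>_def)
  qed
  obtain F1 where F1: "finite F1"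
    "\<And>K. K \<in> F1 \<Longrightarrow> \<exists>s t. K = {s..t} \<and> s < t \<and> f t - f s \<le> r * (t - s) \<and> K \<subseteq> U"
    "pairwise disjnt F1" "measure lebesgue A - \<eta> < measure lebesgue (\<Union>F1)"
    using Vitali_intervals[OF A(1) U(1,2,3) \<eta> low] by blast
  have F1m: "\<Union>F1 \<in> lmeasurable" using F1(1,2) by (intro fmeasurable.finite_Union) fastforce+
  have F1U: "\<Union>F1 \<subseteq> U" using F1(2) by blast
  \<comment> \<open>Only an interior point of a member of \<open>F1\<close> has short intervals
    around it that stay inside that member. The end points lost here are finitely many.\<close>
  define A2 where "A2 = A \<inter> (\<Union>K\<in>F1. interior K)"
  have A2m: "A2 \<in> lmeasurable"
  proof -
    have "open (\<Union>K\<in>F1. interior K)" by auto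
    then have "(\<Union>K\<in>F1. interior K) \<in> sets lebesgue" by (simp add: sets_completionI_sets)
    then show ?thesis using A(1) unfolding A2_def by (intro fmeasurable_Int_fmeasurable)
  qed
  have mA2: "\<mu> - 2 * \<eta> < measure lebesgue A2"
  proof -
    have "measure lebesgue (U - \<Union>F1) = measure lebesgue U - measure lebesgue (\<Union>F1)"
      using U F1m F1U by (intro measurable_measure_Diff) auto
    moreover have "measure lebesgue (A - \<Union>F1) \<le> measure lebesgue (U - \<Union>F1)"
      using U A F1m by (intro measure_mono_fmeasurable) auto
    moreover have "measure lebesgue (A - \<Union>F1) = measure lebesgue (A - A2)"
    proof (rule measure_negligible_symdiff[symmetric])
      show "A - \<Union>F1 \<in> lmeasurable" using A(1) F1m by (intro fmeasurable.Diff)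
      have "(A - \<Union>F1 - (A - A2)) \<union> (A - A2 - (A - \<Union>F1)) \<subseteq> (\<Union>K\<in>F1. {Inf K, Sup K})"
        using F1(2) by (force simp: A2_def interior_atLeastAtMost_real)
      moreover have "negligible (\<Union>K\<in>F1. {Inf K, Sup K})"
        using F1(1) by (auto intro!: negligible_Union)
      ultimately show "negligible ((A - \<Union>F1 - (A - A2)) \<union> (A - A2 - (A - \<Union>F1)))"
        by (rule negligible_subset[rotated])
    qed
    moreover have "measure lebesgue (A - A2) = measure lebesgue A - measure lebesgue A2"
      using A A2m by (intro measurable_measure_Diff) (auto simp: A2_def)
    ultimately show ?thesis using F1(4) mU unfolding \<mu>_def by linarith
  qed
  obtain F2 where F2: "finite F2"
    "\<And>K. K \<in> F2 \<Longrightarrow> \<exists>s t. K = {s..t} \<and> s < t \<and> (R * (t - s) \<le> f t - f s \<and> (\<exists>J\<in>F1. {s..t} \<subseteq> J)) \<and> K \<subseteq> U"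
    "pairwise disjnt F2" "measure lebesgue A2 - \<eta> < measure lebesgue (\<Union>F2)"
  proof (rule Vitali_intervals[OF A2m U(1,2) _ \<eta>, where P = "\<lambda>s t. R * (t - s) \<le> f t - f s \<and> (\<exists>J\<in>F1. {s..t} \<subseteq> J)"])
    show "A2 \<subseteq> U" using U by (auto simp: A2_def)
    fix x d :: real assume x: "x \<in> A2" and d: "d > 0"
    obtain J where J: "J \<in> F1" "x \<in> interior J" using x by (auto simp: A2_def)
    obtain c where c: "c > 0" "ball x c \<subseteq> J" using J(2) by (auto simp: mem_interior)
    have "x \<in> A" using x by (simp add: A2_def)
    from up[OF this, of "min c d"] c d obtain s t where st: "R * (t - s) \<le> f t - f s" "s < t" "x \<in> {s..t}" "t - s < min c d"
      by auto
    have "{s..t} \<subseteq> ball x c" using st by (auto simp: dist_real_def)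
    then show "\<exists>s t. (R * (t - s) \<le> f t - f s \<and> (\<exists>J\<in>F1. {s..t} \<subseteq> J)) \<and> s < t \<and> x \<in> {s..t} \<and> t - s < d"
      using st c J by (intro exI[of _ s] exI[of _ t]) auto
  qed blast
  have F2m: "\<Union>F2 \<in> lmeasurable" using F2(1,2) by (intro fmeasurable.finite_Union) fastforce+
  have F2U: "\<Union>F2 \<subseteq> U" using F2(2) by blast
  \<comment> \<open>Inside each \<open>J\<close> the steep intervals are completed to a division
    \<open>q J\<close>. The added pieces, collected in \<open>I\<close>, carry the increments over
    \<open>F1\<close> minus those over \<open>F2\<close>.\<close>
  define p where "p J = {K\<in>F2. K \<subseteq> J}" for J
  have "\<exists>q. p J \<subseteq> q \<and> q division_of J" if J: "J \<in> F1" for J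
  proof -
    obtain s t where st: "J = cbox s t" using F1(2)[OF J] by auto
    have "p J division_of \<Union>(p J)"
    proof (rule division_ofI)
      show "finite (p J)" using F2(1) by (simp add: p_def)
      fix K assume K: "K \<in> p J"
      then obtain s t where "K = {s..t}" "s < t" using F2(2)[of K] by (auto simp: p_def)
      then show "K \<noteq> {}" "\<exists>a b. K = cbox a b" by auto
      show "K \<subseteq> \<Union>(p J)" using K by blast
      fix K' assume "K' \<in> p J" "K \<noteq> K'"
      then have "disjnt K K'" using K F2(3) by (auto simp: pairwise_def p_def)
      then show "interior K \<inter> interior K' = {}"
        using interior_subset unfolding disjnt_def by blast
    qed simp
    moreover have "\<Union>(p J) \<subseteq> cbox s t" by (auto simp: p_def st)
    ultimately show ?thesis using partial_division_extend_interval st by metis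
  qed
  then obtain q where q: "\<And>J. J \<in> F1 \<Longrightarrow> p J \<subseteq> q J \<and> q J division_of J" by metis
  define I where "I = Sigma F1 (\<lambda>J. q J - p J)"
  have finq: "finite (q J)" if "J \<in> F1" for J using q[OF that] by blast
  have finI: "finite I" using F1(1) finq by (auto simp: I_def)
  have Jab: "\<exists>s t. J = {s..t} \<and> s < t \<and> a < s \<and> t < b" if "J \<in> F1" for J
    using F1(2)[OF that] U(4) by fastforce
  have Kint: "\<exists>u v. K = {u..v} \<and> u \<le> v \<and> {u..v} \<subseteq> J" if "J \<in> F1" "K \<in> q J" for J K
    using division_ofD(2,3,4)[OF conjunct2[OF q[OF that(1)]] that(2)] by fastforce
  have sumdiv: "(\<Sum>K\<in>q J. g (Sup K) - g (Inf K)) = g (Sup J) - g (Inf J)" if J: "J \<in> F1" for J and g :: "real \<Rightarrow> real"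
  proof -
    obtain s t where "J = {s..t}" "s < t" using Jab[OF J] by blast
    then show ?thesis using additive_division_1[of s t "q J" g] q[OF J] by simp
  qed
  have sumI: "(\<Sum>i\<in>I. g (Sup (snd i)) - g (Inf (snd i))) =
      (\<Sum>J\<in>F1. g (Sup J) - g (Inf J)) - (\<Sum>K\<in>F2. g (Sup K) - g (Inf K))" for g :: "real \<Rightarrow> real"
  proof -
    have "(\<Sum>i\<in>I. g (Sup (snd i)) - g (Inf (snd i))) = (\<Sum>J\<in>F1. \<Sum>K\<in>q J - p J. g (Sup K) - g (Inf K))"
      unfolding I_def using F1(1) finq by (subst sum.Sigma) (auto simp: case_prod_unfold)
    also have "\<dots> = (\<Sum>J\<in>F1. (g (Sup J) - g (Inf J)) - (\<Sum>K\<in>p J. g (Sup K) - g (Inf K)))"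
      using q finq sumdiv by (intro sum.cong refl) (simp add: sum_diff)
    also have "\<dots> = (\<Sum>J\<in>F1. g (Sup J) - g (Inf J)) - (\<Sum>J\<in>F1. \<Sum>K\<in>p J. g (Sup K) - g (Inf K))"
      by (rule sum_subtractf)
    also have "(\<Sum>J\<in>F1. \<Sum>K\<in>p J. g (Sup K) - g (Inf K)) = (\<Sum>K\<in>(\<Union>J\<in>F1. p J). g (Sup K) - g (Inf K))"
    proof (rule sum.UNION_disjoint[symmetric, OF F1(1)])
      show "\<forall>i\<in>F1. finite (p i)" using F2(1) by (simp add: p_def)
      show "\<forall>i\<in>F1. \<forall>j\<in>F1. i \<noteq> j \<longrightarrow> p i \<inter> p j = {}"
      proof (intro ballI impI)
        fix i j assume ij: "i \<in> F1" "j \<in> F1" "i \<noteq> j"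
        have "i \<inter> j = {}" using F1(3) ij by (auto simp: pairwise_def disjnt_def)
        moreover have "K \<noteq> {}" if "K \<in> p i" for K using that F2(2)[of K] by (auto simp: p_def)
        moreover have "K \<subseteq> i \<inter> j" if "K \<in> p i \<inter> p j" for K using that by (auto simp: p_def)
        ultimately show "p i \<inter> p j = {}" by blast
      qed
    qed
    also have "(\<Union>J\<in>F1. p J) = F2"
    proof (intro equalityI subsetI)
      fix K assume K: "K \<in> F2"
      then obtain J where "J \<in> F1" "K \<subseteq> J" using F2(2)[OF K] by auto
      with K show "K \<in> (\<Union>J\<in>F1. p J)" by (auto simp: p_def)
    qed (auto simp: p_def)
    finally show ?thesis .
  qed
  have m1: "(\<Sum>J\<in>F1. Sup J - Inf J) = measure lebesgue (\<Union>F1)"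
    using F1 by (intro interval_family_measure) blast+
  have m2: "(\<Sum>J\<in>F2. Sup J - Inf J) = measure lebesgue (\<Union>F2)"
    using F2 by (intro interval_family_measure) blast+
  have m1': "measure lebesgue (\<Union>F1) < \<mu> + \<eta>"
    using measure_mono_fmeasurable[OF F1U _ U(2)] F1m mU by auto
  have m2': "measure lebesgue (\<Union>F2) < \<mu> + \<eta>"
    using measure_mono_fmeasurable[OF F2U _ U(2)] F2m mU by auto
  have len: "(\<Sum>i\<in>I. Sup (snd i) - Inf (snd i)) < \<delta>"
    using sumI[of "\<lambda>x. x"] m1 m2 m1' F2(4) mA2 \<eta> \<eta>2 \<delta> by linarith
  have "(\<Sum>i\<in>I. \<bar>f (Sup (snd i)) - f (Inf (snd i))\<bar>) < e"
  proof (rule D[rule_format], intro conjI ballI impI finI len)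
    fix i assume i: "i \<in> I"
    then obtain J K where JK: "i = (J,K)" "J \<in> F1" "K \<in> q J" by (auto simp: I_def)
    obtain u v where uv: "K = {u..v}" "u \<le> v" "{u..v} \<subseteq> J" using Kint[OF JK(2,3)] by blast
    obtain s t where st: "J = {s..t}" "s < t" "a < s" "t < b" using Jab[OF JK(2)] by blast
    show "a \<le> Inf (snd i)" "Inf (snd i) \<le> Sup (snd i)" "Sup (snd i) \<le> b"
      using uv st JK by auto
    fix j assume j: "j \<in> I" "i \<noteq> j"
    then obtain J' K' where JK': "j = (J',K')" "J' \<in> F1" "K' \<in> q J'" by (auto simp: I_def)
    obtain u' v' where uv': "K' = {u'..v'}" "u' \<le> v'" "{u'..v'} \<subseteq> J'" using Kint[OF JK'(2,3)] by blast
    have "interior K \<inter> interior K' = {}"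
    proof (cases "J = J'")
      case True
      then have "K \<noteq> K'" using j(2) JK(1) JK'(1) by simp
      then show ?thesis
        using division_ofD(5)[OF conjunct2[OF q[OF JK(2)]] JK(3), of K'] JK'(3) True by simp
    next
      case False
      then have "disjnt J J'" using F1(3) JK(2) JK'(2) by (auto simp: pairwise_def)
      moreover have "K \<subseteq> J" "K' \<subseteq> J'" using uv uv' by auto
      ultimately show ?thesis using interior_subset unfolding disjnt_def by blast
    qed
    then show "{Inf (snd i)<..<Sup (snd i)} \<inter> {Inf (snd j)<..<Sup (snd j)} = {}"
      using uv uv' JK(1) JK'(1) by (simp add: interior_atLeastAtMost_real)
  qed
  \<comment> \<open>The leftover pieces have to undo the surplus of the steep family over the flat
    one, so their negative increments amount at least to the difference of the next two
    bounds.\<close>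
  moreover have "- (\<Sum>i\<in>I. f (Sup (snd i)) - f (Inf (snd i))) \<le> (\<Sum>i\<in>I. \<bar>f (Sup (snd i)) - f (Inf (snd i))\<bar>)"
    using abs_ge_minus_self sum_abs order_trans by blast
  moreover have "(\<Sum>J\<in>F1. f (Sup J) - f (Inf J)) \<le> r * measure lebesgue (\<Union>F1)"
  proof -
    have "(\<Sum>J\<in>F1. f (Sup J) - f (Inf J)) \<le> (\<Sum>J\<in>F1. r * (Sup J - Inf J))"
    proof (rule sum_mono)
      fix J assume "J \<in> F1"
      from F1(2)[OF this] show "f (Sup J) - f (Inf J) \<le> r * (Sup J - Inf J)" by auto
    qed
    then show ?thesis by (simp add: m1[symmetric] sum_distrib_left)
  qed
  moreover have "R * measure lebesgue (\<Union>F2) \<le> (\<Sum>J\<in>F2. f (Sup J) - f (Inf J))"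
  proof -
    have "(\<Sum>J\<in>F2. R * (Sup J - Inf J)) \<le> (\<Sum>J\<in>F2. f (Sup J) - f (Inf J))"
    proof (rule sum_mono)
      fix J assume "J \<in> F2"
      from F2(2)[OF this] show "R * (Sup J - Inf J) \<le> f (Sup J) - f (Inf J)" by auto
    qed
    then show ?thesis by (simp add: m2[symmetric] sum_distrib_left)
  qed
  ultimately have "R * measure lebesgue (\<Union>F2) - r * measure lebesgue (\<Union>F1) < e"
    using sumI[of f] by linarith
  moreover have "R * \<mu> - R * measure lebesgue (\<Union>F2) \<le> 3 * (\<eta> * \<bar>R\<bar>)"
  proof -
    have "\<bar>\<mu> - measure lebesgue (\<Union>F2)\<bar> \<le> 3 * \<eta>" using m2' mA2 F2(4) \<eta> by (auto simp: abs_if)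
    then have "\<bar>R * (\<mu> - measure lebesgue (\<Union>F2))\<bar> \<le> \<bar>R\<bar> * (3 * \<eta>)"
      unfolding abs_mult by (rule mult_left_mono) simp
    then show ?thesis by (simp add: algebra_simps)
  qed
  moreover have "r * measure lebesgue (\<Union>F1) - r * \<mu> \<le> 3 * (\<eta> * \<bar>r\<bar>)"
  proof -
    have "\<bar>measure lebesgue (\<Union>F1) - \<mu>\<bar> \<le> 3 * \<eta>" using m1' F1(4) \<eta> \<mu>_def by (auto simp: abs_if)
    then have "\<bar>r * (measure lebesgue (\<Union>F1) - \<mu>)\<bar> \<le> \<bar>r\<bar> * (3 * \<eta>)"
      unfolding abs_mult by (rule mult_left_mono) simp
    then show ?thesis by (simp add: algebra_simps)
  qed
  moreover have "\<eta> * \<bar>r\<bar> + \<eta> * \<bar>R\<bar> + \<eta> \<le> (R - r) * \<mu> / 16" using \<eta>3 by (simp add: algebra_simps)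
  moreover have "(R - r) * \<mu> = R * \<mu> - r * \<mu>" by (simp add: algebra_simps)
  moreover have "0 < (R - r) * \<mu>" using rR \<mu> by simp
  ultimately show False using \<eta> unfolding e_def by linarith
qed

text \<open>Within a window shorter than \<open>\<delta>\<close> the variation is below 1. If the
  part of \<open>A\<close> in it had measure \<open>\<mu> > 0\<close>, disjoint intervals of slope
  \<open>4 / \<mu>\<close> covering more than half of that measure would give variation at least
  2.\<close>

lemma steep_negligible:
  fixes f :: "real \<Rightarrow> real"
  assumes ac: "absolutely_continuous_on a b f" and A: "A \<in> lmeasurable" "A \<subseteq> {a<..<b}"
    and steep: "\<And>x d R. x \<in> A \<Longrightarrow> d > 0 \<Longrightarrow> \<exists>s t. R * (t - s) \<le> \<bar>f t - f s\<bar> \<and> s < t \<and> x \<in> {s..t} \<and> t - s < d"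
  shows "negligible A"
proof -
  obtain \<delta> where \<delta>: "\<delta> > 0" and D: "\<forall>(I::real set set) s t. finite I \<and>
       (\<forall>i\<in>I. a \<le> s i \<and> s i \<le> t i \<and> t i \<le> b) \<and>
       (\<forall>i\<in>I. \<forall>j\<in>I. i \<noteq> j \<longrightarrow> {s i<..<t i} \<inter> {s j<..<t j} = {}) \<and>
       (\<Sum>i\<in>I. t i - s i) < \<delta> \<longrightarrow> (\<Sum>i\<in>I. \<bar>f (t i) - f (s i)\<bar>) < 1"
    using absolutely_continuous_on_finite_family[OF ac zero_less_one, where 'i="real set"]
    by (elim exE conjE)
  have loc: "negligible (A \<inter> {c<..<c + \<delta> / 2})" for c
  proof (rule ccontr)
    define B where "B = A \<inter> {c<..<c + \<delta> / 2}"
    define \<mu> where "\<mu> = measure lebesgue B"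
    assume "\<not> negligible (A \<inter> {c<..<c + \<delta> / 2})"
    moreover have Bm: "B \<in> lmeasurable" using A(1) by (auto simp: B_def intro!: fmeasurable_Int_fmeasurable)
    ultimately have \<mu>: "\<mu> > 0" by (simp add: \<mu>_def B_def negligible_iff_measure0 zero_less_measure_iff)
    define U where "U = {c<..<c + \<delta> / 2} \<inter> {a<..<b}"
    have U: "open U" "U \<in> lmeasurable" "B \<subseteq> U"
      using A(2) by (auto simp: U_def B_def intro!: lmeasurable_open bounded_Int)
    have st: "\<exists>s t. 4 / \<mu> * (t - s) \<le> \<bar>f t - f s\<bar> \<and> s < t \<and> x \<in> {s..t} \<and> t - s < d" if "x \<in> B" "d > 0" for x d
      using steep[of x d "4 / \<mu>"] that unfolding B_def by blast
    obtain F where F: "finite F"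
      "\<And>K. K \<in> F \<Longrightarrow> \<exists>s t. K = {s..t} \<and> s < t \<and> 4 / \<mu> * (t - s) \<le> \<bar>f t - f s\<bar> \<and> K \<subseteq> U"
      "pairwise disjnt F" "measure lebesgue B - \<mu> / 2 < measure lebesgue (\<Union>F)"
      using Vitali_intervals[OF Bm U half_gt_zero[OF \<mu>] st] by blast
    have Fm: "\<Union>F \<in> lmeasurable" using F(1,2) by (intro fmeasurable.finite_Union) fastforce+
    have FU: "\<Union>F \<subseteq> {c..c + \<delta> / 2}" using F(2) by (fastforce simp: U_def)
    have len: "(\<Sum>K\<in>F. Sup K - Inf K) = measure lebesgue (\<Union>F)"
      using F by (intro interval_family_measure) blast+
    also have "\<dots> \<le> measure lebesgue {c..c + \<delta> / 2}"
      using FU Fm by (intro measure_mono_fmeasurable) auto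
    also have "\<dots> < \<delta>" using \<delta> by simp
    finally have len\<delta>: "(\<Sum>K\<in>F. Sup K - Inf K) < \<delta>" .
    have "(\<Sum>K\<in>F. \<bar>f (Sup K) - f (Inf K)\<bar>) < 1"
    proof (rule D[rule_format], intro conjI ballI impI F(1) len\<delta>)
      fix K assume K: "K \<in> F"
      obtain s t where K': "K = {s..t}" "s < t" "K \<subseteq> U" using F(2)[OF K] by blast
      then have "s \<in> U" "t \<in> U" by auto
      then show "a \<le> Inf K" "Inf K \<le> Sup K" "Sup K \<le> b" using K' by (auto simp: U_def)
      fix L assume L: "L \<in> F" "K \<noteq> L"
      obtain u v where L': "L = {u..v}" "u < v" using F(2)[OF L(1)] by blast
      have "K \<inter> L = {}" using F(3) K L by (auto simp: pairwise_def disjnt_def)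
      moreover have "{Inf K<..<Sup K} \<subseteq> K" "{Inf L<..<Sup L} \<subseteq> L" using K' L' by auto
      ultimately show "{Inf K<..<Sup K} \<inter> {Inf L<..<Sup L} = {}" by blast
    qed
    moreover have "(\<Sum>K\<in>F. 4 / \<mu> * (Sup K - Inf K)) \<le> (\<Sum>K\<in>F. \<bar>f (Sup K) - f (Inf K)\<bar>)"
    proof (rule sum_mono)
      fix J assume "J \<in> F"
      from F(2)[OF this] show "4 / \<mu> * (Sup J - Inf J) \<le> \<bar>f (Sup J) - f (Inf J)\<bar>" by auto
    qed
    then have "4 / \<mu> * measure lebesgue (\<Union>F) \<le> (\<Sum>K\<in>F. \<bar>f (Sup K) - f (Inf K)\<bar>)"
      by (simp only: sum_distrib_left[symmetric] len)
    moreover have "4 / \<mu> * (\<mu> / 2) \<le> 4 / \<mu> * measure lebesgue (\<Union>F)"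
      using F(4) \<mu> by (intro mult_left_mono) (auto simp: \<mu>_def)
    ultimately show False using \<mu> by simp
  qed
  have "A \<subseteq> (\<Union>k::int. A \<inter> {k * (\<delta> / 4)<..<k * (\<delta> / 4) + \<delta> / 2})"
  proof
    fix x assume "x \<in> A"
    \<comment> \<open>Windows of length \<open>\<delta> / 2\<close> placed at distance
      \<open>\<delta> / 4\<close> overlap, so the open windows already cover the line.\<close>
    define k where "k = \<lceil>x / (\<delta> / 4)\<rceil> - 1"
    have "real_of_int k < x / (\<delta> / 4)" "x / (\<delta> / 4) \<le> real_of_int k + 1"
      unfolding k_def by linarith+
    moreover have "0 < \<delta> / 4" using \<delta> by simp
    ultimately have "k * (\<delta> / 4) < x" "x \<le> (real_of_int k + 1) * (\<delta> / 4)"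
      using pos_less_divide_eq pos_divide_le_eq by blast+
    then have "x \<in> {k * (\<delta> / 4)<..<k * (\<delta> / 4) + \<delta> / 2}" using \<delta> by (simp add: algebra_simps)
    then show "x \<in> (\<Union>k::int. A \<inter> {k * (\<delta> / 4)<..<k * (\<delta> / 4) + \<delta> / 2})" using \<open>x \<in> A\<close> by blast
  qed
  then show ?thesis
  proof (rule negligible_subset[rotated], intro negligible_countable_Union)
    fix S assume "S \<in> range (\<lambda>k::int. A \<inter> {k * (\<delta> / 4)<..<k * (\<delta> / 4) + \<delta> / 2})"
    then show "negligible S" using loc by blast
  qed simp
qed

text \<open>With \<open>\<sigma> = 1\<close> or \<open>\<sigma> = - 1\<close>, the points lying inside arbitrarily short intervals on which \<open>\<sigma> f\<close> has
  mean slope above \<open>\<rho>\<close>. Two-sided intervals make this set a countable intersection of open sets, for any \<open>f\<close>.\<close>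
definition slope_set :: "(real \<Rightarrow> real) \<Rightarrow> real \<Rightarrow> real \<Rightarrow> real \<Rightarrow> real \<Rightarrow> real set" where
  "slope_set f a b \<sigma> \<rho> =
    (\<Inter>n::nat. \<Union>{{s<..<t} |s t. a < s \<and> s < t \<and> t < b \<and> t - s < 1 / Suc n \<and> \<rho> * (t - s) < \<sigma> * (f t - f s)})"

lemma slope_set_iff:
  "x \<in> slope_set f a b \<sigma> \<rho> \<longleftrightarrow> (\<forall>n. \<exists>s t. x \<in> {s<..<t} \<and>
     a < s \<and> s < t \<and> t < b \<and> t - s < 1 / Suc n \<and> \<rho> * (t - s) < \<sigma> * (f t - f s))"
proof -
  have Q: "x \<in> \<Union>{{s<..<t} |s t. Q s t} \<longleftrightarrow> (\<exists>s t. x \<in> {s<..<t} \<and> Q s t)" for Q :: "real \<Rightarrow> real \<Rightarrow> bool"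
    by blast
  show ?thesis unfolding slope_set_def INT_iff Q by simp
qed

lemma slope_set_subset: "slope_set f a b \<sigma> \<rho> \<subseteq> {a<..<b}"
proof
  fix x assume "x \<in> slope_set f a b \<sigma> \<rho>"
  then obtain s t where "x \<in> {s<..<t}" "a < s" "t < b" unfolding slope_set_iff by blast
  then show "x \<in> {a<..<b}" by auto
qed

lemma slope_set_lmeasurable: "slope_set f a b \<sigma> \<rho> \<in> lmeasurable"
proof (rule bounded_set_imp_lmeasurable)
  show "bounded (slope_set f a b \<sigma> \<rho>)" by (rule bounded_subset[OF _ slope_set_subset]) simp
  have "open (\<Union>{{s<..<t} |s t. a < s \<and> s < t \<and> t < b \<and> t - s < 1 / Suc n \<and> \<rho> * (t - s) < \<sigma> * (f t - f s)})" for n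
    by (rule open_Union) auto
  then show "slope_set f a b \<sigma> \<rho> \<in> sets lebesgue"
    unfolding slope_set_def by (intro sets.countable_INT'') (auto intro!: sets_completionI_sets)
qed

lemma slope_setD:
  assumes "x \<in> slope_set f a b \<sigma> \<rho>" "d > 0"
  shows "\<exists>s t. \<rho> * (t - s) < \<sigma> * (f t - f s) \<and> s < t \<and> x \<in> {s..t} \<and> t - s < d"
proof -
  obtain n where n: "inverse (real (Suc n)) < d" using reals_Archimedean[OF assms(2)] by blast
  obtain s t where "x \<in> {s<..<t}" "s < t" "t - s < 1 / Suc n" "\<rho> * (t - s) < \<sigma> * (f t - f s)"
    using assms(1) unfolding slope_set_iff by blast
  then show ?thesis using n by (intro exI[of _ s] exI[of _ t]) (auto simp: inverse_eq_divide)
qed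

text \<open>A steep chord between \<open>x\<close> and \<open>y\<close> stays steep, by continuity,
  when its end at \<open>x\<close> is moved slightly past \<open>x\<close>; then \<open>x\<close> is
  an interior point of the interval.\<close>

lemma slope_setI:
  assumes f: "continuous_on {a..b} f" and x: "x \<in> {a<..<b}"
    and fr: "\<exists>\<^sub>F y in at x. \<rho> < \<sigma> * ((f y - f x) / (y - x))"
  shows "x \<in> slope_set f a b \<sigma> \<rho>"
proof -
  have fx: "isCont f x" using f x by (simp add: continuous_on_interior interior_atLeastAtMost_real)
  have each: "\<exists>s t. x \<in> {s<..<t} \<and> a < s \<and> s < t \<and> t < b \<and> t - s < 1 / Suc n \<and> \<rho> * (t - s) < \<sigma> * (f t - f s)" for n
  proof -
    define d where "d = min (min (x - a) (b - x)) (1 / Suc n)"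
    have d: "d > 0" using x by (auto simp: d_def)
    have "\<forall>\<^sub>F y in at x. y \<noteq> x \<and> \<bar>y - x\<bar> < d"
      using d by (auto simp: eventually_at dist_real_def intro!: exI[of _ d])
    from frequently_ex[OF frequently_eventually_conj[OF fr this]]
    obtain y where y: "\<rho> < \<sigma> * ((f y - f x) / (y - x))" "y \<noteq> x" "\<bar>y - x\<bar> < d"
      by blast
    show ?thesis
    proof (cases "y > x")
      case True
      have "\<rho> * (y - x) < \<sigma> * (f y - f x)" using y True by (simp add: field_simps)
      moreover have "((\<lambda>s. \<sigma> * (f y - f s) - \<rho> * (y - s)) \<longlongrightarrow> \<sigma> * (f y - f x) - \<rho> * (y - x)) (at x)"
        using fx by (intro tendsto_intros) (simp add: isCont_def)
      ultimately have "\<forall>\<^sub>F s in at x. 0 < \<sigma> * (f y - f s) - \<rho> * (y - s)"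
        by (intro order_tendstoD(1)) auto
      moreover have "\<forall>\<^sub>F s in at x. \<bar>s - x\<bar> < d - (y - x)"
        using y True by (auto simp: eventually_at dist_real_def intro!: exI[of _ "d - (y - x)"])
      ultimately have "\<forall>\<^sub>F s in at_left x. (0 < \<sigma> * (f y - f s) - \<rho> * (y - s) \<and> \<bar>s - x\<bar> < d - (y - x)) \<and> s < x"
        by (intro eventually_conj eventually_at_left_1) (auto simp: eventually_at_filter elim: eventually_mono)
      then obtain s where s: "0 < \<sigma> * (f y - f s) - \<rho> * (y - s)" "\<bar>s - x\<bar> < d - (y - x)" "s < x"
        using eventually_happens'[OF trivial_limit_at_left_real] by blast
      then show ?thesis using True y by (intro exI[of _ s] exI[of _ y]) (auto simp: d_def)
    next
      case False
      then have yx: "y < x" using y by simp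
      have "\<rho> * (x - y) < \<sigma> * (f x - f y)" using y yx by (simp add: field_simps)
      moreover have "((\<lambda>s. \<sigma> * (f s - f y) - \<rho> * (s - y)) \<longlongrightarrow> \<sigma> * (f x - f y) - \<rho> * (x - y)) (at x)"
        using fx by (intro tendsto_intros) (simp add: isCont_def)
      ultimately have "\<forall>\<^sub>F s in at x. 0 < \<sigma> * (f s - f y) - \<rho> * (s - y)"
        by (intro order_tendstoD(1)) auto
      moreover have "\<forall>\<^sub>F s in at x. \<bar>s - x\<bar> < d - (x - y)"
        using y yx by (auto simp: eventually_at dist_real_def intro!: exI[of _ "d - (x - y)"])
      ultimately have "\<forall>\<^sub>F s in at_right x. (0 < \<sigma> * (f s - f y) - \<rho> * (s - y) \<and> \<bar>s - x\<bar> < d - (x - y)) \<and> x < s"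
        by (intro eventually_conj eventually_at_right_less) (auto simp: eventually_at_filter elim: eventually_mono)
      then obtain s where s: "0 < \<sigma> * (f s - f y) - \<rho> * (s - y)" "\<bar>s - x\<bar> < d - (x - y)" "x < s"
        using eventually_happens'[OF trivial_limit_at_right_real] by blast
      then show ?thesis using yx y by (intro exI[of _ y] exI[of _ s]) (auto simp: d_def)
    qed
  qed
  then show ?thesis unfolding slope_set_iff by blast
qed

text \<open>Outside \<open>N2\<close> the difference quotients at \<open>x\<close> are eventually
  bounded on either side; outside \<open>N1\<close> no two rationals separate their lower from their
  upper limit. The derivative is the supremum of the eventual lower bounds.\<close>

theorem absolutely_continuous_on_differentiable_ae:
  fixes f :: "real \<Rightarrow> real"
  assumes ac: "absolutely_continuous_on a b f"
  obtains N where "negligible N" "\<And>x. x \<in> {a..b} - N \<Longrightarrow> f differentiable (at x)"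
proof
  define H where "H \<sigma> \<rho> = slope_set f a b \<sigma> \<rho>" for \<sigma> \<rho>
  define N1 where "N1 = (\<Union>(r,R)\<in>{(r,R). r \<in> \<rat> \<and> R \<in> \<rat> \<and> r < R}. H (-1) (-r) \<inter> H 1 R)"
  define N2 where "N2 \<sigma> = (\<Inter>k::nat. H \<sigma> (real k))" for \<sigma>
  define N where "N = {a, b} \<union> N1 \<union> N2 1 \<union> N2 (-1)"
  note Hm = slope_set_lmeasurable[of f a b, folded H_def] and Hs = slope_set_subset[of f a b, folded H_def]
  have "negligible (H (-1) (-r) \<inter> H 1 R)" if "r < R" for r R
  proof (rule two_slopes_negligible[OF ac _ _ that])
    show "H (-1) (-r) \<inter> H 1 R \<in> lmeasurable" using Hm by (intro fmeasurable_Int_fmeasurable) auto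
    show "H (-1) (-r) \<inter> H 1 R \<subseteq> {a<..<b}" using Hs by blast
  next
    fix x d :: real assume x: "x \<in> H (-1) (-r) \<inter> H 1 R" and d: "d > 0"
    show "\<exists>s t. f t - f s \<le> r * (t - s) \<and> s < t \<and> x \<in> {s..t} \<and> t - s < d"
      using slope_setD[of x f a b "-1" "-r" d] x d by (force simp: H_def)
    show "\<exists>s t. R * (t - s) \<le> f t - f s \<and> s < t \<and> x \<in> {s..t} \<and> t - s < d"
      using slope_setD[of x f a b 1 R d] x d by (force simp: H_def)
  qed
  moreover have "countable {(r,R). r \<in> \<rat> \<and> R \<in> \<rat> \<and> r < (R::real)}"
    by (rule countable_subset[of _ "\<rat> \<times> \<rat>"]) (auto simp: countable_rat)
  ultimately have N1: "negligible N1"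
    unfolding N1_def by (intro negligible_countable_Union) auto
  have N2: "negligible (N2 \<sigma>)" if \<sigma>: "\<bar>\<sigma>\<bar> = 1" for \<sigma>
  proof (rule steep_negligible[OF ac])
    show "N2 \<sigma> \<in> lmeasurable"
    proof (rule fmeasurableI2[OF Hm[of \<sigma> 0]])
      show "N2 \<sigma> \<subseteq> H \<sigma> 0" unfolding N2_def by (rule INF_lower2[of 0]) auto
      show "N2 \<sigma> \<in> sets lebesgue" unfolding N2_def using Hm by (intro sets.countable_INT'') auto
    qed
    show "N2 \<sigma> \<subseteq> {a<..<b}" using Hs[of \<sigma> "real 0"] unfolding N2_def by blast
    fix x d R :: real assume x: "x \<in> N2 \<sigma>" and d: "d > 0"
    obtain k where k: "R < real k" using reals_Archimedean2 by blast
    have "x \<in> slope_set f a b \<sigma> (real k)" using x by (auto simp: N2_def H_def)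
    from slope_setD[OF this d] obtain s t where st: "real k * (t - s) < \<sigma> * (f t - f s)" "s < t" "x \<in> {s..t}" "t - s < d"
      by blast
    have "R * (t - s) \<le> real k * (t - s)" using k st by (intro mult_right_mono) auto
    also have "\<dots> \<le> \<bar>\<sigma> * (f t - f s)\<bar>" using st by linarith
    finally show "\<exists>s t. R * (t - s) \<le> \<bar>f t - f s\<bar> \<and> s < t \<and> x \<in> {s..t} \<and> t - s < d"
      using st \<sigma> by (auto simp: abs_mult)
  qed
  show "negligible N" unfolding N_def using N1 N2[of 1] N2[of "-1"] by auto
  fix x assume x: "x \<in> {a..b} - N"
  then have xab: "x \<in> {a<..<b}" by (auto simp: N_def less_le)
  note fc = absolutely_continuous_on_imp_continuous_on[OF ac]
  define q where "q y = (f y - f x) / (y - x)" for y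
  have ev: "\<forall>\<^sub>F y in at x. \<sigma> * q y \<le> \<rho>" if "x \<notin> H \<sigma> \<rho>" for \<sigma> \<rho>
  proof -
    have "\<not> (\<exists>\<^sub>F y in at x. \<rho> < \<sigma> * q y)"
      using slope_setI[OF fc xab, of \<rho> \<sigma>] that unfolding H_def q_def by blast
    then show ?thesis by (simp add: not_frequently not_less)
  qed
  obtain k1 where k1: "\<forall>\<^sub>F y in at x. q y \<le> real k1"
    using x ev[of 1] by (auto simp: N_def N2_def)
  obtain k2 where k2: "\<forall>\<^sub>F y in at x. - real k2 \<le> q y"
    using x ev[of "-1"] by (fastforce simp: N_def N2_def minus_le_iff)
  define X where "X = {r. \<forall>\<^sub>F y in at x. r \<le> q y}"
  have X1: "- real k2 \<in> X" using k2 by (simp add: X_def)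
  have X2: "r \<le> real k1" if "r \<in> X" for r
  proof -
    have "\<forall>\<^sub>F y in at x. r \<le> q y \<and> q y \<le> real k1" using that k1 by (auto simp: X_def intro: eventually_conj)
    then obtain y where "r \<le> q y \<and> q y \<le> real k1" using eventually_happens'[OF at_neq_bot] by blast
    then show ?thesis by linarith
  qed
  have bdd: "bdd_above X" using X2 by (auto simp: bdd_above_def)
  have "(q \<longlongrightarrow> Sup X) (at x)"
  proof (rule order_tendstoI)
    fix c assume "c < Sup X"
    then obtain r where "r \<in> X" "c < r" using less_cSup_iff[OF _ bdd] X1 by blast
    then show "\<forall>\<^sub>F y in at x. c < q y" unfolding X_def by (auto elim!: eventually_mono)
  next
    fix c assume c: "Sup X < c"
    \<comment> \<open>As \<open>r\<close> exceeds the supremum, chords of slope below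
      \<open>r\<close> accumulate at \<open>x\<close>; as \<open>x\<close> avoids \<open>N1\<close>,
      chords of slope above \<open>R\<close> do not.\<close>
    obtain R where R: "R \<in> \<rat>" "Sup X < R" "R < c" using Rats_dense_in_real[OF c] by blast
    obtain r where r: "r \<in> \<rat>" "Sup X < r" "r < R" using Rats_dense_in_real[OF R(2)] by blast
    have "r \<notin> X" using r cSup_upper[OF _ bdd] by fastforce
    then have "x \<in> H (-1) (-r)" using ev[of "-1" "-r"] by (auto simp: X_def)
    then have "x \<notin> H 1 R" using x r R by (auto simp: N_def N1_def)
    from ev[OF this] show "\<forall>\<^sub>F y in at x. q y < c" using R by (auto elim!: eventually_mono)
  qed
  then have "(f has_field_derivative Sup X) (at x)" by (simp add: has_field_derivative_iff q_def[abs_def])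
  then show "f differentiable (at x)" by (auto simp: real_differentiable_def)
qed

text \<open>A gauge argument with the integrand set to 0 on \<open>N\<close>. Tags off
  \<open>N\<close> are handled by differentiability. Pieces tagged in \<open>N\<close> are confined
  to an open set of measure below \<open>\<delta>\<close>, so absolute continuity makes the
  increments over them small in total.\<close>

theorem absolutely_continuous_on_fundamental_theorem:
  fixes f f' :: "real \<Rightarrow> real"
  assumes ac: "absolutely_continuous_on a b f" and ab: "a \<le> b" and N: "negligible N"
    and der: "\<And>x. x \<in> {a..b} - N \<Longrightarrow> (f has_real_derivative f' x) (at x within {a..b})"
  shows "(f' has_integral (f b - f a)) {a..b}"
proof -
  define g where "g x = (if x \<in> N then 0 else f' x)" for x
  have "(g has_integral (f b - f a)) (cbox a b)"
    unfolding has_integral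
  proof (intro allI impI)
    fix e :: real assume e: "e > 0"
    \<comment> \<open>A relative error, spread over the length \<open>b - a\<close>, that costs at
      most \<open>e / 2\<close>; the summand 1 covers the case \<open>a = b\<close>.\<close>
    define e1 where "e1 = e / (2 * (b - a + 1))"
    have e1: "e1 > 0" using e ab by (simp add: e1_def)
    have "\<forall>x. \<exists>d>0. x \<in> {a..b} - N \<longrightarrow>
         (\<forall>y\<in>{a..b}. norm (y-x) < d \<longrightarrow> norm (f y - f x - (y-x) *\<^sub>R f' x) \<le> e1 * norm (y-x))"
      using der[unfolded has_real_derivative_iff_has_vector_derivative has_vector_derivative_def has_derivative_within_alt] e1
      by blast
    then obtain d where d: "\<And>x. 0 < d x"
         "\<And>x y. \<lbrakk>x \<in> {a..b} - N; y \<in> {a..b}; norm (y-x) < d x\<rbrakk>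
                \<Longrightarrow> norm (f y - f x - (y-x) *\<^sub>R f' x) \<le> e1 * norm (y-x)"
      by metis
    obtain \<delta> where \<delta>: "\<delta> > 0" and D: "\<forall>(I::(real \<times> real set) set) s t. finite I \<and>
       (\<forall>i\<in>I. a \<le> s i \<and> s i \<le> t i \<and> t i \<le> b) \<and>
       (\<forall>i\<in>I. \<forall>j\<in>I. i \<noteq> j \<longrightarrow> {s i<..<t i} \<inter> {s j<..<t j} = {}) \<and>
       (\<Sum>i\<in>I. t i - s i) < \<delta> \<longrightarrow> (\<Sum>i\<in>I. \<bar>f (t i) - f (s i)\<bar>) < e / 2"
      using absolutely_continuous_on_finite_family[OF ac half_gt_zero[OF e], where 'i="real \<times> real set"]
      by (elim exE conjE)
    obtain U where U: "open U" "N \<subseteq> U" "U \<in> lmeasurable" "measure lebesgue U < \<delta>"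
    proof -
      obtain U where U: "open U" "N \<subseteq> U" "U - N \<in> lmeasurable" "emeasure lebesgue (U - N) < ennreal \<delta>"
        using sets_lebesgue_outer_open[OF negligible_imp_sets[OF N] \<delta>] by blast
      have Um: "U \<in> lmeasurable"
        using fmeasurable.Un[OF U(3) negligible_imp_measurable[OF N]] U(2) by (simp add: Un_absorb2)
      have "measure lebesgue U = measure lebesgue (U - N)"
        using Um U(3) by (intro measure_negligible_symdiff[symmetric]) (auto intro: negligible_subset[OF N])
      also have "\<dots> < \<delta>" using U(3,4) \<delta> by (simp add: emeasure_eq_measure2 ennreal_less_iff)
      finally show ?thesis using that U Um by blast
    qed
    define \<gamma> where "\<gamma> x = (if x \<in> N then U else ball x (d x))" for x
    have "gauge \<gamma>" using U d(1) by (auto simp: gauge_def \<gamma>_def)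
    moreover have "norm ((\<Sum>(x, k)\<in>p. measure lborel k *\<^sub>R g x) - (f b - f a)) < e"
      if p: "p tagged_division_of cbox a b" and fine: "\<gamma> fine p" for p
    proof -
      note pD = tagged_division_ofD[OF p]
      have finp: "finite p" using p by blast
      have KK: "\<exists>u v. K = {u..v} \<and> u \<le> v \<and> x \<in> {u..v} \<and> a \<le> u \<and> v \<le> b" if "(x,K) \<in> p" for x K
        using pD(2,3,4)[OF that] by fastforce
      have KK': "\<exists>u v. snd i = {u..v} \<and> u \<le> v \<and> fst i \<in> {u..v} \<and> a \<le> u \<and> v \<le> b" if "i \<in> p" for i
        using KK[of "fst i" "snd i"] that by simp
      have sf: "f b - f a = (\<Sum>(x,K)\<in>p. f (Sup K) - f (Inf K))" and sl: "b - a = (\<Sum>(x,K)\<in>p. Sup K - Inf K)"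
        using additive_tagged_division_1[OF ab, of p f] additive_tagged_division_1[OF ab, of p "\<lambda>x. x"] p by auto
      define p1 where "p1 = {i\<in>p. fst i \<in> N}"
      have p1: "p1 \<subseteq> p" "finite p1" using finp by (auto simp: p1_def)
      have disj: "interior (snd i) \<inter> interior (snd j) = {}" if "i \<in> p" "j \<in> p" "i \<noteq> j" for i j
        using pD(5)[of "fst i" "snd i" "fst j" "snd j"] that by (simp add: prod_eq_iff)
      have len: "(\<Sum>i\<in>p1. Sup (snd i) - Inf (snd i)) < \<delta>"
      proof -
        have "(\<Sum>i\<in>p1. Sup (snd i) - Inf (snd i)) = (\<Sum>i\<in>p1. measure lebesgue (interior (snd i)))"
        proof (rule sum.cong[OF refl])
          fix i assume i: "i \<in> p1"
          obtain u v where "snd i = {u..v}" "u \<le> v" using KK'[OF subsetD[OF p1(1) i]] by blast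
          then show "Sup (snd i) - Inf (snd i) = measure lebesgue (interior (snd i))"
            by (simp add: interior_atLeastAtMost_real)
        qed
        also have "\<dots> = measure lebesgue (\<Union>((\<lambda>i. interior (snd i)) ` p1))"
        proof (rule measure_negligible_finite_Union_image[symmetric, OF p1(2)])
          show "interior (snd i) \<in> lmeasurable" if i: "i \<in> p1" for i
          proof -
            obtain u v where "snd i = {u..v}" using KK'[OF subsetD[OF p1(1) i]] by blast
            then show ?thesis by (simp add: interior_atLeastAtMost_real)
          qed
          show "pairwise (\<lambda>i j. negligible (interior (snd i) \<inter> interior (snd j))) p1"
            using disj p1 unfolding pairwise_def by (metis negligible_empty subsetD)
        qed
        also have "\<dots> \<le> measure lebesgue U"
        proof (rule measure_mono_fmeasurable[OF _ _ U(3)])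
          have "snd i \<subseteq> U" if "i \<in> p1" for i
            using fineD[OF fine, of "fst i" "snd i"] that by (simp add: p1_def \<gamma>_def)
          then show "\<Union>((\<lambda>i. interior (snd i)) ` p1) \<subseteq> U" using interior_subset by blast
          have "open (\<Union>((\<lambda>i. interior (snd i)) ` p1))" by auto
          then show "\<Union>((\<lambda>i. interior (snd i)) ` p1) \<in> sets lebesgue" by (simp add: sets_completionI_sets)
        qed
        finally show ?thesis using U(4) by linarith
      qed
      have s1: "(\<Sum>i\<in>p1. \<bar>f (Sup (snd i)) - f (Inf (snd i))\<bar>) < e / 2"
      proof (rule D[rule_format], intro conjI ballI impI p1(2) len)
        fix i assume i: "i \<in> p1"
        obtain u v where uv: "snd i = {u..v}" "u \<le> v" "a \<le> u" "v \<le> b" using KK'[OF subsetD[OF p1(1) i]] by blast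
        show "a \<le> Inf (snd i)" "Inf (snd i) \<le> Sup (snd i)" "Sup (snd i) \<le> b" using uv by auto
        fix j assume j: "j \<in> p1" "i \<noteq> j"
        obtain u' v' where uv': "snd j = {u'..v'}" "u' \<le> v'" using KK'[OF subsetD[OF p1(1) j(1)]] by blast
        have "interior (snd i) \<inter> interior (snd j) = {}"
          using disj i j p1 by blast
        then show "{Inf (snd i)<..<Sup (snd i)} \<inter> {Inf (snd j)<..<Sup (snd j)} = {}"
          using uv uv' by (simp add: interior_atLeastAtMost_real)
      qed
      define h where "h i = measure lborel (snd i) * g (fst i) - (f (Sup (snd i)) - f (Inf (snd i)))" for i
      have h1: "\<bar>h i\<bar> = \<bar>f (Sup (snd i)) - f (Inf (snd i))\<bar>" if "i \<in> p1" for i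
        using that by (simp add: h_def p1_def g_def)
      have h2: "\<bar>h i\<bar> \<le> e1 * (Sup (snd i) - Inf (snd i))" if i: "i \<in> p - p1" for i
      proof -
        obtain x K where xK: "i = (x,K)" "(x,K) \<in> p" "x \<notin> N" using i by (cases i) (auto simp: p1_def)
        obtain u v where uv: "K = {u..v}" "u \<le> v" "x \<in> {u..v}" "a \<le> u" "v \<le> b" using KK[OF xK(2)] by blast
        have "K \<subseteq> ball x (d x)" using fineD[OF fine xK(2)] xK(3) by (simp add: \<gamma>_def)
        moreover have "u \<in> K" "v \<in> K" using uv by auto
        ultimately have "u \<in> ball x (d x)" "v \<in> ball x (d x)" by blast+
        \<comment> \<open>Straddle estimate: the tag lies between \<open>u\<close> and
          \<open>v\<close>, so the errors on its two sides add up to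
          \<open>e1 * (v - u)\<close>.\<close>
        then have "\<bar>f u - f x - (u - x) * f' x\<bar> \<le> e1 * (x - u)" "\<bar>f v - f x - (v - x) * f' x\<bar> \<le> e1 * (v - x)"
          using d(2)[of x u] d(2)[of x v] uv xK(3) by (auto simp: dist_real_def)
        then have "\<bar>(v - u) * f' x - (f v - f u)\<bar> \<le> e1 * (v - u)"
          by (simp add: algebra_simps abs_le_iff)
        then show ?thesis using uv xK by (simp add: h_def g_def)
      qed
      have "(\<Sum>(x, k)\<in>p. measure lborel k *\<^sub>R g x) - (f b - f a) = (\<Sum>i\<in>p. h i)"
        by (simp add: sf h_def sum_subtractf case_prod_unfold)
      then have "norm ((\<Sum>(x, k)\<in>p. measure lborel k *\<^sub>R g x) - (f b - f a)) \<le> (\<Sum>i\<in>p. \<bar>h i\<bar>)"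
        by (simp add: sum_abs)
      also have "\<dots> = (\<Sum>i\<in>p - p1. \<bar>h i\<bar>) + (\<Sum>i\<in>p1. \<bar>h i\<bar>)"
        by (rule sum.subset_diff[OF p1(1) finp])
      also have "(\<Sum>i\<in>p - p1. \<bar>h i\<bar>) \<le> (\<Sum>i\<in>p - p1. e1 * (Sup (snd i) - Inf (snd i)))"
        by (rule sum_mono) (rule h2)
      also have "(\<Sum>i\<in>p - p1. e1 * (Sup (snd i) - Inf (snd i))) \<le> (\<Sum>i\<in>p. e1 * (Sup (snd i) - Inf (snd i)))"
      proof (rule sum_mono2[OF finp])
        fix i assume "i \<in> p - (p - p1)"
        then have "i \<in> p" by blast
        from KK'[OF this] obtain u v where "snd i = {u..v}" "u \<le> v" by blast
        then show "0 \<le> e1 * (Sup (snd i) - Inf (snd i))" using e1 by simp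
      qed auto
      also have "(\<Sum>i\<in>p. e1 * (Sup (snd i) - Inf (snd i))) = e1 * (b - a)"
        by (simp add: sl sum_distrib_left case_prod_unfold)
      also have "e1 * (b - a) \<le> e / 2"
      proof -
        have "e1 * (2 * (b - a + 1)) = e" using ab unfolding e1_def by simp
        then have "2 * (e1 * (b - a)) + 2 * e1 = e" by (simp add: algebra_simps)
        then show ?thesis using e1 by linarith
      qed
      also have "(\<Sum>i\<in>p1. \<bar>h i\<bar>) < e / 2" using s1 h1 by simp
      finally show ?thesis by simp
    qed
    ultimately have "gauge \<gamma> \<and> (\<forall>\<D>. \<D> tagged_division_of cbox a b \<and> \<gamma> fine \<D> \<longrightarrow>
            norm ((\<Sum>(x, k)\<in>\<D>. measure lborel k *\<^sub>R g x) - (f b - f a)) < e)" by simp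
    then show "\<exists>\<gamma>. gauge \<gamma> \<and> (\<forall>\<D>. \<D> tagged_division_of cbox a b \<and> \<gamma> fine \<D> \<longrightarrow>
            norm ((\<Sum>(x, k)\<in>\<D>. measure lborel k *\<^sub>R g x) - (f b - f a)) < e)"
      by - (rule exI[of _ \<gamma>])
  qed
  then have "(g has_integral (f b - f a)) {a..b}" by simp
  then show ?thesis
    by (rule has_integral_spike[OF N, rotated]) (simp add: g_def)
qed

section \<open>Cutoff functions\<close>

text \<open>The span of the functions \<open>inverse x ^ n * exp (- inverse x)\<close>, extended by
  0, is closed under differentiation. One coinduction thus gives smoothness of the flat exponential,
  the member with \<open>n = 0\<close>.\<close>

inductive_set flat_exp_span :: "(real \<Rightarrow> real) set" where
  base: "(\<lambda>x. if x > 0 then inverse x ^ n * exp (- inverse x) else 0) \<in> flat_exp_span"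
| lincomb: "f \<in> flat_exp_span \<Longrightarrow> g \<in> flat_exp_span \<Longrightarrow> (\<lambda>x. f x + c * g x) \<in> flat_exp_span"

lemma flat_exp_tendsto_0: "((\<lambda>x. inverse x ^ n * exp (- inverse x)) \<longlongrightarrow> (0::real)) (at_right 0)"
proof -
  have "((\<lambda>x::real. x ^ n / exp x) \<longlongrightarrow> 0) at_top" by (rule tendsto_power_div_exp_0)
  from filterlim_compose[OF this filterlim_inverse_at_top_right]
  show ?thesis by (simp add: exp_minus divide_inverse)
qed

lemma flat_exp_deriv:
  fixes n :: nat
  defines "F \<equiv> \<lambda>n x. if x > 0 then inverse x ^ n * exp (- inverse x) else (0::real)"
  shows "(F n has_real_derivative (F (n + 2) x + (- real n) * F (n + 1) x)) (at x)"
proof -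
  consider "x > 0" | "x < 0" | "x = 0" by linarith
  then show ?thesis
  proof cases
    case 1
    have "((\<lambda>x. inverse x ^ n * exp (- inverse x)) has_real_derivative (F (n + 2) x + (- real n) * F (n + 1) x)) (at x)"
      using 1 by (auto intro!: derivative_eq_intros simp: F_def algebra_simps power2_eq_square)
        (cases n; simp add: algebra_simps)
    then show ?thesis
      by (rule has_field_derivative_transform_within_open[where S = "{0<..}"]) (use 1 in \<open>auto simp: F_def\<close>)
  next
    case 2
    have "((\<lambda>x. 0) has_real_derivative (F (n + 2) x + (- real n) * F (n + 1) x)) (at x)"
      using 2 by (simp add: F_def)
    then show ?thesis
      by (rule has_field_derivative_transform_within_open[where S = "{..<0}"]) (use 2 in \<open>auto simp: F_def\<close>)
  next
    case 3
    have "((\<lambda>y. F n y / y) \<longlongrightarrow> 0) (at_right 0)"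
    proof (rule Lim_transform_eventually[OF flat_exp_tendsto_0[of "n + 1"]])
      show "\<forall>\<^sub>F x in at_right 0. inverse x ^ (n + 1) * exp (- inverse x) = F n x / x"
        by (rule eventually_mono[OF eventually_at_right_less]) (simp add: F_def divide_inverse)
    qed
    moreover have "((\<lambda>y. F n y / y) \<longlongrightarrow> 0) (at_left 0)"
    proof (rule Lim_transform_eventually[OF tendsto_const])
      show "\<forall>\<^sub>F x in at_left 0. 0 = F n x / x"
        unfolding eventually_at_filter by (simp add: F_def)
    qed
    ultimately have "((\<lambda>y. F n y / y) \<longlongrightarrow> 0) (at 0)" by (simp add: filterlim_split_at)
    then show ?thesis using 3 by (simp add: has_field_derivative_iff F_def cong: if_cong)
  qed
qed

lemma flat_exp_span_deriv:
  assumes "f \<in> flat_exp_span"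
  shows "\<exists>g\<in>flat_exp_span. \<forall>x. (f has_real_derivative g x) (at x)"
  using assms
proof induction
  case (base n)
  show ?case
    by (rule bexI[OF _ flat_exp_span.lincomb[OF flat_exp_span.base[of "n + 2"] flat_exp_span.base[of "n + 1"], of "- real n"]])
       (intro allI flat_exp_deriv)
next
  case (lincomb f g c)
  then obtain f' g' where fg: "f' \<in> flat_exp_span" "g' \<in> flat_exp_span"
    "\<And>x. (f has_real_derivative f' x) (at x)" "\<And>x. (g has_real_derivative g' x) (at x)" by metis
  show ?case
    by (rule bexI[OF _ flat_exp_span.lincomb[OF fg(1,2), of c]])
       (auto intro!: derivative_eq_intros fg(3,4))
qed

lemma flat_exp_span_smooth:
  assumes "f \<in> flat_exp_span"
  shows "smooth f"
  using assms
proof (coinduction arbitrary: f rule: smooth.coinduct)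
  case (smooth f)
  obtain g where g: "g \<in> flat_exp_span" "\<And>x. (f has_real_derivative g x) (at x)"
    using flat_exp_span_deriv[OF smooth] by blast
  have "continuous_on UNIV f" using g(2) DERIV_isCont continuous_at_imp_continuous_on by blast
  moreover have "((\<lambda>t. f (x + t *\<^sub>R 1)) has_real_derivative g x) (at 0)" for x
    using g(2)[of x] DERIV_shift[of f "g x" 0 x] by (simp add: add.commute)
  ultimately show ?case using g(1) by (intro exI[of _ f]) auto
qed

definition flat_exp :: "real \<Rightarrow> real" where
  "flat_exp x = (if x > 0 then exp (- inverse x) else 0)"

lemma smooth_flat_exp: "smooth flat_exp"
proof -
  have "flat_exp = (\<lambda>x. if x > 0 then inverse x ^ 0 * exp (- inverse x) else 0)"
    by (simp add: flat_exp_def fun_eq_iff)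
  then show ?thesis using flat_exp_span_smooth[OF flat_exp_span.base[of 0]] by simp
qed

lemma flat_exp_nonneg [simp]: "flat_exp x \<ge> 0" by (simp add: flat_exp_def)
lemma flat_exp_pos_iff [simp]: "flat_exp x > 0 \<longleftrightarrow> x > 0" by (simp add: flat_exp_def)
lemma flat_exp_eq_0_iff [simp]: "flat_exp x = 0 \<longleftrightarrow> x \<le> 0" by (simp add: flat_exp_def)

section \<open>Steps, plateaus and bumps\<close>

lemma smooth_antiderivative:
  fixes g :: "real \<Rightarrow> real"
  assumes "smooth g"
  shows "\<exists>G. smooth G \<and> (\<forall>x. (G has_real_derivative g x) (at x)) \<and> G c = d"
proof -
  have "isCont g x" for x
    using smooth_imp_continuous_on[OF assms, of UNIV] by (simp add: continuous_on_eq_continuous_at)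
  then obtain G where G: "\<And>x. (G has_vector_derivative g x) (at x)"
    using einterval_antiderivative[of "-\<infinity>" "\<infinity>" g] by auto
  define H where "H x = G x + (d - G c)" for x
  have H: "(H has_real_derivative g x) (at x)" for x
    using G[of x] unfolding H_def has_real_derivative_iff_has_vector_derivative[symmetric]
    by (auto intro!: derivative_eq_intros)
  then have "smooth H" using smooth_deriv_rule assms by blast
  with H show ?thesis by (intro exI[of _ H]) (simp add: H_def)
qed

lemma smooth_affine: "smooth f \<Longrightarrow> smooth (\<lambda>x::real. f (c * x + d))" for f :: "real \<Rightarrow> real"
  by (rule smooth_compose[of f]) (auto intro!: smooth_add smooth_mult)

text \<open>The normalised primitive of a bump supported in the unit interval.\<close>

lemma smooth_step_exists:
  obtains s :: "real \<Rightarrow> real" where "smooth s" "mono s" "\<And>x. x \<le> 0 \<Longrightarrow> s x = 0" "\<And>x. x \<ge> 1 \<Longrightarrow> s x = 1"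
    "\<And>x. 0 \<le> s x" "\<And>x. s x \<le> 1"
proof -
  define g where "g x = flat_exp x * flat_exp (1 - x)" for x :: real
  have gs: "smooth g"
    unfolding g_def using smooth_affine[OF smooth_flat_exp, of "-1" 1]
    by (intro smooth_mult smooth_flat_exp) simp
  have g0: "g x \<ge> 0" for x by (simp add: g_def)
  obtain G where G: "smooth G" "\<And>x. (G has_real_derivative g x) (at x)" "G 0 = 0"
    using smooth_antiderivative[OF gs, of 0 0] by blast
  have Gmono: "G x \<le> G y" if "x \<le> y" for x y
    using G(2) g0 that by (intro DERIV_nonneg_imp_nondecreasing[of x y G]) blast+
  have Gneg: "G x = 0" if "x \<le> 0" for x
  proof (cases "x = 0")
    case False
    have "\<exists>z. x < z \<and> z < 0 \<and> G 0 - G x = (0 - x) * g z"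
      using False that G(2) by (intro MVT2) auto
    then show ?thesis using G(3) by (auto simp: g_def)
  qed (simp add: G)
  have G1: "G 1 > 0"
  proof -
    have "\<exists>z. 0 < z \<and> z < 1 \<and> G 1 - G 0 = (1 - 0) * g z"
      using G(2) by (intro MVT2) auto
    then show ?thesis using G(3) by (auto simp: g_def)
  qed
  have Gbig: "G x = G 1" if "x \<ge> 1" for x
  proof (cases "x = 1")
    case False
    have "\<exists>z. 1 < z \<and> z < x \<and> G x - G 1 = (x - 1) * g z"
      using False that G(2) by (intro MVT2) auto
    then obtain z where z: "1 < z" "G x - G 1 = (x - 1) * g z" by blast
    then have "g z = 0" by (simp add: g_def)
    then show ?thesis using z by simp
  qed simp
  define s where "s x = inverse (G 1) * G x" for x
  show thesis
  proof (rule that[of s])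
    show "smooth s" unfolding s_def by (intro smooth_mult G smooth_const)
    show ms: "mono s" using Gmono G1 by (auto simp: s_def mono_def intro!: mult_left_mono)
    show s0: "s x = 0" if "x \<le> 0" for x using Gneg that by (simp add: s_def)
    show s1: "s x = 1" if "x \<ge> 1" for x using Gbig[OF that] G1 by (simp add: s_def)
    show "0 \<le> s x" for x using monoD[OF ms, of "min x 0" x] s0[of "min x 0"] by simp
    show "s x \<le> 1" for x using monoD[OF ms, of x "max x 1"] s1[of "max x 1"] by simp
  qed
qed

lemma smooth_plateau_exists:
  obtains \<rho> :: "real \<Rightarrow> real" where "smooth \<rho>" "\<And>x. 0 \<le> \<rho> x" "\<And>x. \<rho> x \<le> 1"
    "\<And>x. \<bar>x\<bar> \<le> 1/2 \<Longrightarrow> \<rho> x = 1" "\<And>x. \<bar>x\<bar> \<ge> 1 \<Longrightarrow> \<rho> x = 0"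
proof -
  obtain s :: "real \<Rightarrow> real" where s: "smooth s" "mono s" "\<And>x. x \<le> 0 \<Longrightarrow> s x = 0" "\<And>x. x \<ge> 1 \<Longrightarrow> s x = 1"
    "\<And>x. 0 \<le> s x" "\<And>x. s x \<le> 1" using smooth_step_exists by blast
  show thesis
  \<comment> \<open>One factor rises between -1 and -1/2, the other falls between 1/2 and 1.\<close>
  proof (rule that[of "\<lambda>x. s (2 * x + 2) * s ((-2) * x + 2)"])
    show "smooth (\<lambda>x. s (2 * x + 2) * s ((-2) * x + 2))"
      by (intro smooth_mult smooth_affine s)
    show "s (2 * x + 2) * s ((-2) * x + 2) \<le> 1" for x using s(5,6) by (intro mult_le_one) auto
    show "s (2 * x + 2) * s ((-2) * x + 2) = 1" if "\<bar>x\<bar> \<le> 1/2" for x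
      using s(4)[of "2 * x + 2"] s(4)[of "(-2) * x + 2"] that by (auto simp: abs_le_iff)
    show "s (2 * x + 2) * s ((-2) * x + 2) = 0" if "\<bar>x\<bar> \<ge> 1" for x
      using s(3)[of "2 * x + 2"] s(3)[of "(-2) * x + 2"] that by (auto simp: abs_real_def split: if_splits)
  qed (use s in auto)
qed

text \<open>A function with values between 0 and 1 attains an extremum wherever it equals 0 or 1.
  This is how derivatives of cutoffs are seen to vanish off the support and on the plateau.\<close>

lemma deriv_at_extremum:
  fixes f :: "real \<Rightarrow> real"
  assumes "(f has_real_derivative D) (at x)" "(\<forall>y. f x \<le> f y) \<or> (\<forall>y. f y \<le> f x)"
  shows "D = 0"
  using assms(2) DERIV_local_min[OF assms(1), of 1] DERIV_local_max[OF assms(1), of 1] by auto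

lemma smooth_bounded_if_support_bounded:
  fixes g :: "real \<Rightarrow> real"
  assumes "smooth g" "\<And>x. \<bar>x\<bar> \<ge> R \<Longrightarrow> g x = 0"
  obtains D where "D \<ge> 0" "\<And>x. \<bar>g x\<bar> \<le> D"
proof -
  have "compact (g ` {-R..R})"
    by (intro compact_continuous_image smooth_imp_continuous_on assms) auto
  then obtain D where D: "\<And>x. x \<in> {-R..R} \<Longrightarrow> \<bar>g x\<bar> \<le> D"
    using compact_imp_bounded bounded_iff by (metis image_eqI real_norm_def)
  have "\<bar>g x\<bar> \<le> max D 0" for x
  proof (cases "\<bar>x\<bar> \<ge> R")
    case False
    then have "x \<in> {-R..R}" by (simp add: abs_real_def split: if_splits)
    from D[OF this] show ?thesis by simp
  qed (simp add: assms(2))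
  then show thesis using that[of "max D 0"] by simp
qed

text \<open>The function climbs only to a height of order \<open>e\<close> and comes down over a
  length of order \<open>\<epsilon>\<close>, so its negative slope is of order
  \<open>e / \<epsilon>\<close> and as small as desired. It is the product of a bounded function
  with slope 1 at scale \<open>e\<close> and a plateau at scale \<open>\<epsilon>\<close>.\<close>

lemma smooth_truncated_identity_exists:
  fixes \<epsilon> \<delta> :: real
  assumes "\<epsilon> > 0" "\<delta> > 0"
  shows "\<exists>e (\<Theta>::real \<Rightarrow> real) \<Theta>'. 0 < e \<and> e \<le> \<epsilon> \<and> e \<le> \<delta> \<and> smooth \<Theta> \<and> smooth \<Theta>' \<and>
    (\<forall>z. (\<Theta> has_real_derivative \<Theta>' z) (at z)) \<and> (\<forall>z. \<bar>z\<bar> \<le> e \<longrightarrow> \<Theta>' z = 1) \<and>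
    (\<forall>z. \<epsilon> \<le> \<bar>z\<bar> \<longrightarrow> \<Theta> z = 0 \<and> \<Theta>' z = 0) \<and> (\<forall>z. \<bar>\<Theta> z\<bar> \<le> \<delta> \<and> - \<delta> \<le> \<Theta>' z \<and> \<Theta>' z \<le> 1)"
proof -
  obtain \<rho> :: "real \<Rightarrow> real" where \<rho>: "smooth \<rho>" "\<And>x. 0 \<le> \<rho> x" "\<And>x. \<rho> x \<le> 1"
    "\<And>x. \<bar>x\<bar> \<le> 1/2 \<Longrightarrow> \<rho> x = 1" "\<And>x. \<bar>x\<bar> \<ge> 1 \<Longrightarrow> \<rho> x = 0"
    using smooth_plateau_exists by blast
  obtain \<rho>' where \<rho>': "smooth \<rho>'" "\<And>x. (\<rho> has_real_derivative \<rho>' x) (at x)"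
    using smooth_real_derivE[OF \<rho>(1)] by blast
  have \<rho>'0: "\<rho>' x = 0" if "\<rho> x = 0 \<or> \<rho> x = 1" for x
    using deriv_at_extremum[OF \<rho>'(2)[of x]] that \<rho>(2,3) by metis
  obtain D where D: "D \<ge> 0" "\<And>x. \<bar>\<rho>' x\<bar> \<le> D"
    using smooth_bounded_if_support_bounded[OF \<rho>'(1), of 1] \<rho>'0 \<rho>(5) by blast
  obtain K where K: "smooth K" "\<And>x. (K has_real_derivative \<rho> x) (at x)" "K 0 = 0"
    using smooth_antiderivative[OF \<rho>(1), of 0 0] by blast
  have Kb: "\<bar>K x\<bar> \<le> 1" for x
  proof -
    have mono: "K x \<le> K y" if "x \<le> y" for x y
      using K(2) \<rho>(2) that by (intro DERIV_nonneg_imp_nondecreasing[of x y K]) blast+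
    note mvt = MVT2[of _ _ K \<rho>, OF _ K(2)]
    have lip: "K y - K x \<le> y - x" if xy: "x < y" for x y
    proof -
      obtain z where "K y - K x = (y - x) * \<rho> z" using mvt[OF xy] by blast
      then show ?thesis using mult_left_mono[OF \<rho>(3)[of z], of "y - x"] xy by simp
    qed
    have big: "K x = K 1" if x: "x > 1" for x
    proof -
      obtain z where "z > 1" "K x - K 1 = (x - 1) * \<rho> z" using mvt[OF x] by blast
      then show ?thesis using \<rho>(5)[of z] by simp
    qed
    have small: "K x = K (-1)" if x: "x < -1" for x
    proof -
      obtain z where "z < -1" "K (-1) - K x = (-1 - x) * \<rho> z" using mvt[OF x] by blast
      then show ?thesis using \<rho>(5)[of z] by simp
    qed
    have "K x \<le> K 1" using mono[of x 1] big[of x] by (cases "x \<le> 1") auto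
    moreover have "K (-1) \<le> K x" using mono[of "-1" x] small[of x] by (cases "x < -1") auto
    moreover have "K 1 \<le> 1" "-1 \<le> K (-1)" using lip[of 0 1] lip[of "-1" 0] K(3) by auto
    ultimately show ?thesis by linarith
  qed
  \<comment> \<open>The first entry keeps the climb inside the plateau, the second bounds the
    height, the third bounds the slope of the descent by \<open>min \<delta> 1\<close>.\<close>
  define e where "e = Min {\<epsilon> / 2, \<delta>, \<epsilon> * min \<delta> 1 / (D + 1)}"
  have e_pos: "e > 0" using assms D(1) by (simp add: e_def)
  have e_le: "e \<le> x" if "x \<in> {\<epsilon> / 2, \<delta>, \<epsilon> * min \<delta> 1 / (D + 1)}" for x
    unfolding e_def by (rule Min_le) (use that in simp_all)
  have e: "e > 0" "e \<le> \<epsilon> / 2" "e \<le> \<delta>" "e \<le> \<epsilon> * min \<delta> 1 / (D + 1)"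
    by (rule e_pos e_le; simp)+
  have eD: "e * D / \<epsilon> \<le> min \<delta> 1"
  proof -
    have "e * (D + 1) \<le> \<epsilon> * min \<delta> 1" using e(4) D(1) by (simp add: pos_le_divide_eq)
    then have "e * D \<le> \<epsilon> * min \<delta> 1" using e(1) by (simp add: algebra_simps)
    then have "e * D / \<epsilon> \<le> \<epsilon> * min \<delta> 1 / \<epsilon>" by (rule divide_right_mono) (use assms in simp)
    also have "\<dots> = min \<delta> 1" using assms(1) by (rule nonzero_mult_div_cancel_left[OF less_imp_neq[THEN not_sym]])
    finally show ?thesis .
  qed
  define \<Theta> where "\<Theta> z = e * K (inverse e * z + 0) * \<rho> (inverse \<epsilon> * z + 0)" for z
  define \<Theta>' where "\<Theta>' z = \<rho> (inverse e * z + 0) * \<rho> (inverse \<epsilon> * z + 0)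
      + e * K (inverse e * z + 0) * (\<rho>' (inverse \<epsilon> * z + 0) * inverse \<epsilon>)" for z
  have der: "(\<Theta> has_real_derivative \<Theta>' z) (at z)" for z
  proof -
    have 1: "((\<lambda>z. K (inverse e * z + 0)) has_real_derivative \<rho> (inverse e * z + 0) * inverse e) (at z)"
      by (rule DERIV_chain2[OF K(2)]) (auto intro!: derivative_eq_intros)
    have 2: "((\<lambda>z. \<rho> (inverse \<epsilon> * z + 0)) has_real_derivative \<rho>' (inverse \<epsilon> * z + 0) * inverse \<epsilon>) (at z)"
      by (rule DERIV_chain2[OF \<rho>'(2)]) (auto intro!: derivative_eq_intros)
    show ?thesis unfolding \<Theta>_def \<Theta>'_def
      by (rule derivative_eq_intros 1 2 refl)+ (use e in \<open>simp add: algebra_simps\<close>)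
  qed
  have in1: "\<rho> (inverse \<epsilon> * z + 0) = 1" if "\<bar>z\<bar> \<le> e" for z
    using that e(2) assms(1) by (intro \<rho>(4)) (simp add: abs_mult divide_simps)
  have out1: "\<rho> (inverse \<epsilon> * z + 0) = 0" if "\<bar>z\<bar> \<ge> \<epsilon>" for z
    using that assms(1) by (intro \<rho>(5)) (simp add: abs_mult divide_simps)
  have out2: "\<rho> (inverse e * z + 0) = 0" if "\<bar>z\<bar> \<ge> e" for z
    using that e(1) by (intro \<rho>(5)) (simp add: abs_mult divide_simps)
  have bnd: "- min \<delta> 1 \<le> \<Theta>' z \<and> \<Theta>' z \<le> 1" for z
  proof (cases "\<bar>z\<bar> \<le> e")
    case True
    then have "\<Theta>' z = \<rho> (inverse e * z + 0)"
      using in1[OF True] \<rho>'0[of "inverse \<epsilon> * z + 0"] by (simp add: \<Theta>'_def)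
    then show ?thesis using \<rho>(2,3)[of "inverse e * z + 0"] assms by auto
  next
    case False
    then have "\<Theta>' z = e * K (inverse e * z + 0) * (\<rho>' (inverse \<epsilon> * z + 0) * inverse \<epsilon>)"
      using out2[of z] by (simp add: \<Theta>'_def)
    also have "\<bar>\<dots>\<bar> \<le> e * 1 * (D * inverse \<epsilon>)"
      unfolding abs_mult using e(1) assms(1) D Kb by (intro mult_mono) auto
    also have "\<dots> = e * D / \<epsilon>" by (simp add: divide_inverse)
    finally show ?thesis using eD by (auto simp: abs_le_iff)
  qed
  show ?thesis
  \<comment> \<open>The plateau of \<open>\<rho>\<close> reaches half as far as its support, whence
    the radius \<open>e / 2\<close>.\<close>
  proof (rule exI[of _ "e / 2"], rule exI[of _ \<Theta>], rule exI[of _ \<Theta>'], intro conjI allI impI)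
    show "(\<Theta> has_real_derivative \<Theta>' z) (at z)" for z by (rule der)
    show "smooth \<Theta>" unfolding \<Theta>_def by (intro smooth_mult smooth_const smooth_affine K \<rho>)
    show "smooth \<Theta>'" unfolding \<Theta>'_def by (intro smooth_add smooth_mult smooth_const smooth_affine K \<rho> \<rho>')
    show "\<Theta>' z = 1" if "\<bar>z\<bar> \<le> e / 2" for z
    proof -
      have "\<rho> (inverse e * z + 0) = 1" using that e(1) by (intro \<rho>(4)) (simp add: abs_mult divide_simps)
      moreover have "\<rho> (inverse \<epsilon> * z + 0) = 1" using in1[of z] that e(1) by simp
      ultimately show ?thesis using \<rho>'0[of "inverse \<epsilon> * z + 0"] by (simp add: \<Theta>'_def)
    qed
    show "\<Theta> z = 0" if "\<bar>z\<bar> \<ge> \<epsilon>" for z using out1[OF that] by (simp add: \<Theta>_def)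
    show "\<Theta>' z = 0" if "\<bar>z\<bar> \<ge> \<epsilon>" for z
      using out1[OF that] \<rho>'0[of "inverse \<epsilon> * z + 0"] by (simp add: \<Theta>'_def)
    show "\<bar>\<Theta> z\<bar> \<le> \<delta>" for z
    proof -
      have "\<bar>\<Theta> z\<bar> \<le> e * 1 * 1" unfolding \<Theta>_def abs_mult
        using e(1) Kb \<rho>(2,3) by (intro mult_mono) auto
      then show ?thesis using e(3) by simp
    qed
    show "- \<delta> \<le> \<Theta>' z" "\<Theta>' z \<le> 1" for z using bnd[of z] by linarith+
  qed (use e assms in auto)
qed

text \<open>The primitive of a step, with slope growing from 0 to 1 on the unit interval. That it is
  constant, and not just small, for \<open>s \<le> 0\<close> lets the limit defining the Lagrangian
  become stationary where the arguments themselves do not.\<close>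

lemma smooth_convex_positive_part_exists:
  obtains T :: "real \<Rightarrow> real" and c where "smooth T" "convex_on UNIV T" "\<And>s. 0 \<le> T s" "\<And>s. s \<le> T s"
    "\<And>s. s \<ge> 1 \<Longrightarrow> T s = s" "\<And>s. s \<le> 0 \<Longrightarrow> T s = c"
    "\<And>s. T s \<le> max s 0 + 1"
proof -
  obtain h :: "real \<Rightarrow> real" where h: "smooth h" "mono h" "\<And>x. x \<le> 0 \<Longrightarrow> h x = 0" "\<And>x. x \<ge> 1 \<Longrightarrow> h x = 1"
    "\<And>x. 0 \<le> h x" "\<And>x. h x \<le> 1" using smooth_step_exists by blast
  obtain T where T: "smooth T" "\<And>x. (T has_real_derivative h x) (at x)" "T 1 = 1"
    using smooth_antiderivative[OF h(1), of 1 1] by blast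
  have Tmono: "T x \<le> T y" if "x \<le> y" for x y
    using T(2) h(5) that by (intro DERIV_nonneg_imp_nondecreasing[of x y T]) blast+
  note mvt = MVT2[of _ _ T h, OF _ T(2)]
  have lip: "T y - T x \<le> y - x" if xy: "x \<le> y" for x y
  proof (cases "x = y")
    case False
    then have "x < y" using xy by simp
    then obtain z where "T y - T x = (y - x) * h z" using mvt by blast
    then show ?thesis using mult_left_mono[OF h(6)[of z], of "y - x"] xy by simp
  qed simp
  have big: "T s = s" if s: "s \<ge> 1" for s
  proof (cases "s = 1")
    case False
    then have "1 < s" using s by simp
    then obtain z where "1 < z" "T s - T 1 = (s - 1) * h z" using mvt by blast
    then show ?thesis using h(4)[of z] T(3) by simp
  qed (simp add: T)
  have small: "T s = T 0" if s: "s \<le> 0" for s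
  proof (cases "s = 0")
    case False
    then have "s < 0" using s by simp
    then obtain z where "z < 0" "T 0 - T s = (0 - s) * h z" using mvt by blast
    then show ?thesis using h(3)[of z] by simp
  qed simp
  have T0: "T 0 \<ge> 0" using lip[of 0 1] T(3) by simp
  show thesis
  proof (rule that[of T "T 0", OF T(1)])
    show "convex_on UNIV T"
      using h(2) T(2) by (intro convex_on_realI[where f' = h]) (auto dest: monoD)
    show "0 \<le> T s" for s using small[of s] Tmono[of 0 s] T0 by (cases "s \<le> 0") auto
    show "s \<le> T s" for s using big[of s] lip[of s 1] T(3) by (cases "s \<ge> 1") auto
    show "T s \<le> max s 0 + 1" for s using big[of s] Tmono[of s 1] T(3) by (cases "s \<ge> 1") auto
    show "T s = s" if "s \<ge> 1" for s using that by (rule big)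
    show "T s = T 0" if "s \<le> 0" for s using that by (rule small)
  qed
qed

text \<open>By compactness a finite sum \<open>f\<close> of bumps inside \<open>V \<inter> W\<close>
  is at least some \<open>m > 0\<close> on \<open>E\<close>, and a step applied to it yields
  \<open>\<beta>\<close>. As \<open>E\<close> is null, the support can have measure at most
  \<open>\<eta>\<close>; this also bounds the primitive that starts left of the support.\<close>

lemma smooth_bump_near_null_set:
  fixes E V :: "real set"
  assumes E: "compact E" "E \<in> null_sets lebesgue" and V: "open V" "E \<subseteq> V" and \<eta>: "\<eta> > 0"
  shows "\<exists>\<beta> \<beta>' Q G D. smooth \<beta> \<and> smooth \<beta>' \<and> smooth Q \<and>
    (\<forall>x. (\<beta> has_real_derivative \<beta>' x) (at x)) \<and> (\<forall>x. (Q has_real_derivative \<beta> x) (at x)) \<and>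
    (\<forall>x. 0 \<le> \<beta> x \<and> \<beta> x \<le> 1) \<and> open G \<and> E \<subseteq> G \<and> (\<forall>x\<in>G. \<beta> x = 1) \<and>
    (\<forall>x. \<beta> x \<noteq> 0 \<longrightarrow> x \<in> V) \<and> emeasure lebesgue {x. \<beta> x \<noteq> 0} \<le> ennreal \<eta> \<and>
    (\<forall>x. 0 \<le> Q x \<and> Q x \<le> \<eta>) \<and> (\<forall>x. \<bar>\<beta>' x\<bar> \<le> D)"
proof -
  obtain W where W: "open W" "E \<subseteq> W" "W - E \<in> lmeasurable" "emeasure lebesgue (W - E) < ennreal \<eta>"
    using sets_lebesgue_outer_open[of E \<eta>] E(2) \<eta> by blast
  have EW: "emeasure lebesgue W \<le> ennreal \<eta>"
  proof -
    have "emeasure lebesgue W = emeasure lebesgue (W - E)"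
      using emeasure_Diff_null_set[OF E(2), of W] W(1) by (simp add: sets_completionI_sets)
    then show ?thesis using W(4) by simp
  qed
  have "\<exists>r>0. ball x r \<subseteq> V \<inter> W" if "x \<in> E" for x
    using that V W by (meson IntI open_Int open_contains_ball subsetD)
  then obtain r where r: "\<And>x. x \<in> E \<Longrightarrow> r x > 0 \<and> ball x (r x) \<subseteq> V \<inter> W" by metis
  have cov: "E \<subseteq> (\<Union>c\<in>E. ball c (r c))" using r by fastforce
  obtain C where C: "C \<subseteq> E" "finite C" "E \<subseteq> (\<Union>c\<in>C. ball c (r c))"
    using compactE_image[OF E(1) _ cov] by blast
  define b where "b c x = flat_exp (1 * x + (r c - c)) * flat_exp ((-1) * x + (r c + c))" for c x
  have bs: "smooth (b c)" for c unfolding b_def by (intro smooth_mult smooth_affine smooth_flat_exp)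
  have b0: "b c x \<ge> 0" for c x by (simp add: b_def)
  have b1: "b c x > 0 \<longleftrightarrow> x \<in> ball c (r c)" for c x
  proof -
    have "\<not> flat_exp y < 0" for y using flat_exp_nonneg[of y] by linarith
    then show ?thesis by (auto simp: b_def zero_less_mult_iff dist_real_def abs_less_iff)
  qed
  define f where "f x = (\<Sum>c\<in>C. b c x)" for x
  have fs: "smooth f" unfolding f_def by (intro smooth_sum bs)
  have f0: "f x \<ge> 0" for x by (simp add: f_def b0 sum_nonneg)
  have f1: "f x > 0" if x: "x \<in> E" for x
  proof -
    obtain c where "c \<in> C" "x \<in> ball c (r c)" using C(3) x by blast
    then show ?thesis unfolding f_def using C(2) b0 b1 by (intro sum_pos2[of C c]) auto
  qed
  have f2: "\<exists>c\<in>C. x \<in> ball c (r c)" if "f x \<noteq> 0" for x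
    using that b0 b1 unfolding f_def by (metis less_le sum.neutral)
  obtain m where m: "m > 0" "\<And>x. x \<in> E \<Longrightarrow> m \<le> f x"
  proof (cases "E = {}")
    case False
    obtain x where "x \<in> E" "\<And>y. y \<in> E \<Longrightarrow> f x \<le> f y"
      using continuous_attains_inf[OF E(1) False smooth_imp_continuous_on[OF fs]] by blast
    then show thesis using that f1 by blast
  qed (use that[of 1] in auto)
  obtain s :: "real \<Rightarrow> real" where s: "smooth s" "mono s" "\<And>x. x \<le> 0 \<Longrightarrow> s x = 0" "\<And>x. x \<ge> 1 \<Longrightarrow> s x = 1"
    "\<And>x. 0 \<le> s x" "\<And>x. s x \<le> 1" using smooth_step_exists by blast
  \<comment> \<open>The factor \<open>2 / m\<close> makes \<open>\<beta>\<close> equal to 1 already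
    where \<open>f\<close> exceeds \<open>m / 2\<close>, which is a neighbourhood of
    \<open>E\<close>.\<close>
  define \<beta> where "\<beta> x = s (2 / m * f x)" for x
  have \<beta>s: "smooth \<beta>" unfolding \<beta>_def by (rule smooth_compose[OF s(1)]) (intro smooth_mult smooth_const fs)
  have \<beta>01: "0 \<le> \<beta> x" "\<beta> x \<le> 1" for x by (simp_all add: \<beta>_def s)
  have \<beta>n: "\<exists>c\<in>C. x \<in> ball c (r c)" if "\<beta> x \<noteq> 0" for x
  proof -
    have "f x \<noteq> 0" using that s(3)[of 0] by (auto simp: \<beta>_def)
    then show ?thesis by (rule f2)
  qed
  have \<beta>V: "x \<in> V \<inter> W" if "\<beta> x \<noteq> 0" for x using \<beta>n[OF that] r C(1) by blast
  obtain \<beta>' where \<beta>': "smooth \<beta>'" "\<And>x. (\<beta> has_real_derivative \<beta>' x) (at x)"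
    using smooth_real_derivE[OF \<beta>s] by blast
  have "bounded (\<Union>c\<in>C. ball c (r c))" using C(2) by auto
  then obtain R0 where R0: "\<And>x. x \<in> (\<Union>c\<in>C. ball c (r c)) \<Longrightarrow> \<bar>x\<bar> \<le> R0"
    unfolding bounded_iff real_norm_def by blast
  define R where "R = \<bar>R0\<bar> + 1"
  have R: "\<beta> x = 0" if "\<bar>x\<bar> \<ge> R" for x
  proof (rule ccontr)
    assume "\<beta> x \<noteq> 0"
    then have "x \<in> (\<Union>c\<in>C. ball c (r c))" using \<beta>n by blast
    then show False using R0 that by (fastforce simp: R_def)
  qed
  have "\<beta>' x = 0" if "\<bar>x\<bar> \<ge> R" for x
    using deriv_at_extremum[OF \<beta>'(2)[of x]] R[OF that] \<beta>01 by simp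
  then obtain D where D: "\<And>x. \<bar>\<beta>' x\<bar> \<le> D" using smooth_bounded_if_support_bounded[OF \<beta>'(1)] by metis
  obtain Q where Q: "smooth Q" "\<And>x. (Q has_real_derivative \<beta> x) (at x)" "Q (-R) = 0"
    using smooth_antiderivative[OF \<beta>s, of "-R" 0] by blast
  define S where "S = {x. \<beta> x \<noteq> 0}"
  have "S \<subseteq> W" using \<beta>V by (auto simp: S_def)
  moreover have Wm: "W \<in> sets lebesgue" using W(1) by (simp add: sets_completionI_sets)
  ultimately have eS: "emeasure lebesgue S \<le> ennreal \<eta>"
    using EW emeasure_mono order_trans by blast
  have "open S" unfolding S_def
    using smooth_imp_continuous_on[OF \<beta>s] by (intro open_Collect_neq continuous_on_const)
  then have Sm: "S \<in> lmeasurable"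
    using eS by (auto intro!: fmeasurableI sets_completionI_sets simp: le_less_trans)
  have mS: "measure lebesgue S \<le> \<eta>"
    using eS Sm \<eta> by (simp add: emeasure_eq_measure2)
  have Qmono: "Q x \<le> Q y" if "x \<le> y" for x y
    using Q(2) \<beta>01 that by (intro DERIV_nonneg_imp_nondecreasing[of x y Q]) blast+
  have Qdiff: "Q y - Q x \<le> \<eta>" if "x \<le> y" for x y
  proof -
    have "(\<beta> has_integral (Q y - Q x)) {x..y}"
      using Q(2) by (intro fundamental_theorem_of_calculus[OF that])
        (auto simp: has_real_derivative_iff_has_vector_derivative[symmetric] intro: has_field_derivative_at_within)
    then have "((\<lambda>t. if t \<in> {x..y} then \<beta> t else 0) has_integral (Q y - Q x)) UNIV"
      by (rule has_integral_restrict_UNIV[THEN iffD2])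
    moreover have "(indicat_real S has_integral measure lebesgue S) UNIV"
      using Sm lmeasurable_iff_indicator_has_integral by blast
    ultimately have "Q y - Q x \<le> measure lebesgue S"
      by (rule has_integral_le) (use \<beta>01 in \<open>auto simp: S_def indicator_def\<close>)
    then show ?thesis using mS by simp
  qed
  have Qleft: "Q x = 0" if x: "x \<le> -R" for x
  proof (cases "x = -R")
    case False
    then have "x < -R" using x by simp
    then obtain z where z: "z < -R" "Q (-R) - Q x = (-R - x) * \<beta> z" using MVT2[of x "-R" Q \<beta>, OF _ Q(2)] by blast
    then have "\<beta> z = 0" using R[of z] by (simp add: abs_if R_def split: if_splits)
    then show ?thesis using z Q(3) by simp
  qed (simp add: Q)
  show ?thesis
  proof (rule exI[of _ \<beta>], rule exI[of _ \<beta>'], rule exI[of _ Q], rule exI[of _ "{x. m / 2 < f x}"],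
      rule exI[of _ D], intro conjI ballI allI impI)
    show "open {x. m / 2 < f x}"
      using smooth_imp_continuous_on[OF fs] by (intro open_Collect_less continuous_on_const)
    show "E \<subseteq> {x. m / 2 < f x}" using m by fastforce
    show "\<beta> x = 1" if "x \<in> {x. m / 2 < f x}" for x
      unfolding \<beta>_def using that m(1) by (intro s(4)) (simp add: field_simps)
    show "x \<in> V" if "\<beta> x \<noteq> 0" for x using \<beta>V[OF that] by blast
    show "emeasure lebesgue {x. \<beta> x \<noteq> 0} \<le> ennreal \<eta>" using eS by (simp add: S_def)
    show "0 \<le> Q x" for x using Qleft[of "min x (-R)"] Qmono[of "min x (-R)" x] by simp
    show "Q x \<le> \<eta>" for x using Qleft[of "min x (-R)"] Qdiff[of "min x (-R)" x] by simp
  qed (fact \<beta>s \<beta>' Q \<beta>01 D)+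
qed

section \<open>The Lagrangian and the singular function\<close>

text \<open>Strict convexity is recorded as the strict tangent inequality, the form used in the
  calibration. Growth is recorded as a linear bound, which turns errors linear in
  \<open>\<bar>p\<bar>\<close> into multiples of the Lagrangian.\<close>

locale energy_density =
  fixes \<omega> \<omega>' :: "real \<Rightarrow> real" and M :: real
  assumes smooth_\<omega>: "smooth \<omega>" and smooth_\<omega>': "smooth \<omega>'"
    and D\<omega>: "(\<omega> has_real_derivative \<omega>' x) (at x)"
    and \<omega>_0: "\<omega> 0 = 0" and \<omega>_nonneg: "0 \<le> \<omega> p"
    and \<omega>_tangent: "p \<noteq> r \<Longrightarrow> \<omega> r + \<omega>' r * (p - r) < \<omega> p"
    and \<omega>_growth: "\<bar>p\<bar> \<le> \<omega> p + M" and M_nonneg: "0 \<le> M"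
begin

lemma \<omega>_tangent_le: "\<omega> r + \<omega>' r * (p - r) \<le> \<omega> p"
  using \<omega>_tangent[of p r] by (cases "p = r") auto

lemma \<omega>'_mono: "r \<le> p \<Longrightarrow> \<omega>' r \<le> \<omega>' p"
proof (cases "r = p")
  case False
  assume "r \<le> p"
  then have rp: "r < p" using False by simp
  have "\<omega>' r * (p - r) \<le> \<omega>' p * (p - r)"
    using \<omega>_tangent_le[of r p] \<omega>_tangent_le[of p r] by (simp add: algebra_simps)
  then show ?thesis using rp by (simp add: mult_le_cancel_right)
qed simp

lemma \<omega>'_nonneg: "0 \<le> p \<Longrightarrow> 0 \<le> \<omega>' p"
  using \<omega>'_mono[of 0 p] deriv_at_extremum[OF D\<omega>[of 0]] \<omega>_0 \<omega>_nonneg by simp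

lemma \<omega>_mono: "0 \<le> p \<Longrightarrow> p \<le> q \<Longrightarrow> \<omega> p \<le> \<omega> q"
  using \<omega>_tangent_le[of p q] \<omega>'_nonneg[of p] by (smt (verit) mult_nonneg_nonneg)

text \<open>The first summand makes \<open>s\<^sub>N \<le> 0\<close> near the graph of \<open>u\<close> over \<open>E\<close>, the second one makes
  \<open>s\<^sub>N \<ge> 1\<close> along \<open>u\<close> on levels \<open>n + 2\<close>; levels 0 and 1 are taken care of by \<open>C\<close>.\<close>
definition B :: "nat \<Rightarrow> real" where
  "B n = \<omega>' (real n + 2) * (2 * real n + 3) + \<omega> (real n + 3) + real n + 3"

definition C :: real where "C = \<omega> 2 + 3"

text \<open>Bounds \<open>L\<close>, \<open>P\<^sub>N\<close> and the error terms on level \<open>m\<close>, for slopes between \<open>0\<close> and \<open>\<psi> x + 1\<close>.\<close>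
definition bb :: "nat \<Rightarrow> real" where
  "bb m = \<omega> (real m + 2) + C + 3 + M + (\<Sum>k\<le>m. B k) * (real m + 2) + \<omega>' (real m + 1) * (real m + 1)"

lemma B_ge: "B n \<ge> 3" "B n \<ge> \<omega> (real n + 3) + 3"
  using \<omega>_nonneg[of "real n + 3"] mult_nonneg_nonneg[OF \<omega>'_nonneg[of "real n + 2"], of "2 * real n + 3"]
  by (simp_all add: B_def)

lemma C_ge: "C \<ge> 3" using \<omega>_nonneg[of 2] by (simp add: C_def)

lemma sum_B_nonneg: "0 \<le> (\<Sum>k\<le>m. B k)"
  using B_ge(1) by (auto intro!: sum_nonneg intro: order_trans[of 0 3])

lemma bb_ge: "bb m \<ge> 1"
  using \<omega>_nonneg[of "real m + 2"] C_ge M_nonneg mult_nonneg_nonneg[OF sum_B_nonneg[of m], of "real m + 2"]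
    mult_nonneg_nonneg[OF \<omega>'_nonneg[of "real m + 1"], of "real m + 1"]
  by (simp add: bb_def)

end

text \<open>Error budget of the \<open>n\<close>-th term of the potential.\<close>
definition \<kappa> :: "nat \<Rightarrow> real" where "\<kappa> n = (1/2) ^ (n + 2)"

lemma \<kappa>_pos [simp]: "0 < \<kappa> n" and \<kappa>_nonneg [simp]: "0 \<le> \<kappa> n"
  by (simp_all add: \<kappa>_def)

lemma sum_\<kappa>: "(\<Sum>n\<le>N. \<kappa> n) = 1/2 - (1/2) ^ (N + 2)"
  by (induction N) (simp_all add: \<kappa>_def field_simps)

lemma sum_\<kappa>_le: "(\<Sum>n\<le>N. \<kappa> n) \<le> 1/2"
  using zero_le_power[of "1/2::real" "N + 2"] unfolding sum_\<kappa> by linarith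

lemma sum_\<kappa>_tail: "(\<Sum>n\<in>{N<..N'}. \<kappa> n) \<le> (1/2) ^ N"
proof (cases "N \<le> N'")
  case True
  have "(\<Sum>n\<le>N'. \<kappa> n) = (\<Sum>n\<le>N. \<kappa> n) + (\<Sum>n\<in>{N<..N'}. \<kappa> n)"
    using True by (subst sum.union_disjoint[symmetric]) (auto intro!: sum.cong)
  then have "(\<Sum>n\<in>{N<..N'}. \<kappa> n) = (1/2) ^ (N + 2) - (1/2) ^ (N' + 2)" unfolding sum_\<kappa> by linarith
  moreover have "(0::real) \<le> (1/2) ^ (N' + 2)" by simp
  moreover have "(1/2) ^ (N + 2) \<le> ((1/2) ^ N :: real)" by (simp add: field_simps)
  ultimately show ?thesis by linarith
qed simp

text \<open>Within radius \<open>e n\<close> the functions \<open>\<Theta>' n\<close> and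
  \<open>\<rho> n\<close> equal 1, beyond \<open>\<epsilon> n\<close> they vanish. By
  \<open>Q_le\<close> and \<open>\<epsilon>_le\<close> the outer tube around
  \<open>u\<^sub>N (Suc n)\<close> lies in the inner tube around \<open>u\<^sub>N n\<close>. The
  conditions \<open>\<Theta>_small\<close> and \<open>\<delta>_small\<close> keep the unwanted parts
  of a term within the budget.\<close>

locale singular_construction = energy_density +
  fixes a b :: real and E :: "real set"
    and \<beta> \<beta>' Q \<Theta> \<Theta>' \<rho> :: "nat \<Rightarrow> real \<Rightarrow> real" and e \<epsilon> \<delta> :: "nat \<Rightarrow> real"
    and T :: "real \<Rightarrow> real" and c\<^sub>T :: real
  assumes ab: "a < b" and E_sub: "E \<subseteq> {a..b}" and closed_E: "closed E" and null_E: "E \<in> null_sets lebesgue"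
    and T: "smooth T" "convex_on UNIV T" "0 \<le> T s" "s \<le> T s" "1 \<le> s \<Longrightarrow> T s = s" "s \<le> 0 \<Longrightarrow> T s = c\<^sub>T"
      "T s \<le> max s 0 + 1"
    and \<beta>_0: "\<beta> 0 x = 1" and Q_0: "Q 0 x = x"
    and smooth_\<beta>: "smooth (\<beta> n)" and smooth_\<beta>': "smooth (\<beta>' n)" and smooth_Q: "smooth (Q n)"
    and D\<beta>: "(\<beta> n has_real_derivative \<beta>' n x) (at x)" and DQ: "(Q n has_real_derivative \<beta> n x) (at x)"
    and \<beta>_nonneg: "0 \<le> \<beta> n x" and \<beta>_le_1: "\<beta> n x \<le> 1"
    and \<beta>_near_E: "\<exists>G. open G \<and> E \<subseteq> G \<and> (\<forall>x\<in>G. \<beta> n x = 1)"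
    and \<beta>_supp: "\<beta> (Suc n) x \<noteq> 0 \<Longrightarrow> \<exists>y\<in>E. \<bar>x - y\<bar> < 1 / (real n + 1)"
    and \<beta>_nested: "\<beta> (Suc n) x \<noteq> 0 \<Longrightarrow> \<beta> n x = 1"
    and \<beta>_measure: "emeasure lebesgue {x. \<beta> (Suc n) x \<noteq> 0} \<le> ennreal ((1/2) ^ n / bb (Suc n))"
    and \<beta>'_bounded: "\<exists>D. \<forall>x. \<bar>\<beta>' n x\<bar> \<le> D"
    and Q_nonneg: "0 \<le> Q (Suc n) x" and Q_le: "Q (Suc n) x \<le> e n / 4"
    and smooth_\<Theta>: "smooth (\<Theta> n)" and smooth_\<Theta>': "smooth (\<Theta>' n)"
    and D\<Theta>: "(\<Theta> n has_real_derivative \<Theta>' n z) (at z)"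
    and \<Theta>'_in: "\<bar>z\<bar> \<le> e n \<Longrightarrow> \<Theta>' n z = 1"
    and \<Theta>_out: "\<epsilon> n \<le> \<bar>z\<bar> \<Longrightarrow> \<Theta> n z = 0" and \<Theta>'_out: "\<epsilon> n \<le> \<bar>z\<bar> \<Longrightarrow> \<Theta>' n z = 0"
    and \<Theta>_small: "B n * \<bar>\<beta>' n x * \<Theta> n z\<bar> \<le> \<kappa> n" and \<Theta>_bounded: "\<bar>\<Theta> n z\<bar> \<le> 1"
    and \<Theta>'_ge: "- \<delta> n \<le> \<Theta>' n z" and \<Theta>'_le: "\<Theta>' n z \<le> 1"
    and \<delta>_nonneg: "0 \<le> \<delta> n" and \<delta>_le_1: "\<delta> n \<le> 1" and \<delta>_small: "B n * \<delta> n * (real n + 1) \<le> \<kappa> n"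
    and smooth_\<rho>: "smooth (\<rho> n)" and \<rho>_nonneg: "0 \<le> \<rho> n z" and \<rho>_le_1: "\<rho> n z \<le> 1"
    and \<rho>_in: "\<bar>z\<bar> \<le> e n \<Longrightarrow> \<rho> n z = 1" and \<rho>_out: "\<epsilon> n \<le> \<bar>z\<bar> \<Longrightarrow> \<rho> n z = 0"
    and e_pos: "0 < e n" and e_le: "e n \<le> \<epsilon> n" and \<epsilon>_le: "\<epsilon> (Suc n) \<le> e n / 2"
begin

definition "\<psi>\<^sub>N n x = (\<Sum>k\<le>n. \<beta> k x)"
definition "u\<^sub>N n x = (\<Sum>k\<le>n. Q k x)"
definition "\<psi> x = (\<Sum>k. \<beta> k x)"
definition "u x = (\<Sum>k. Q k x)"
definition "r\<^sub>N N x y = (\<Sum>n\<le>N. \<beta> n x * \<rho> n (y - u\<^sub>N n x))"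
definition "t n x y p = B n * (\<beta>' n x * \<Theta> n (y - u\<^sub>N n x) + \<beta> n x * \<Theta>' n (y - u\<^sub>N n x) * (p - \<psi>\<^sub>N n x))"
definition "P\<^sub>N N x y p = C + (\<Sum>n\<le>N. t n x y p)"
definition "s\<^sub>N N x y p = P\<^sub>N N x y p + \<omega>' (r\<^sub>N N x y) * (r\<^sub>N N x y - p) - \<omega> (r\<^sub>N N x y)"
text \<open>The limit exists because the sequence is eventually constant at every point; see
  \<open>W_eventually\<close>.\<close>

definition "W x y p = lim (\<lambda>N. T (s\<^sub>N N x y p))"
definition "L x y p = \<omega> p + W x y p"

section \<open>Supports, levels and partial sums\<close>

lemma \<beta>_chain: "\<beta> m x \<noteq> 0 \<Longrightarrow> k < m \<Longrightarrow> \<beta> k x = 1"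
proof (induction m arbitrary: k)
  case (Suc m)
  have "\<beta> m x = 1" using Suc.prems(1) by (rule \<beta>_nested)
  then show ?case using Suc.IH[of k] Suc.prems(2) by (cases "k = m") auto
qed simp

lemma \<beta>_zero_up: "\<beta> m x = 0 \<Longrightarrow> m \<le> k \<Longrightarrow> \<beta> k x = 0"
  using \<beta>_chain[of k x m] by (cases "m = k") auto

lemma \<beta>_on_E: "x \<in> E \<Longrightarrow> \<beta> n x = 1" using \<beta>_near_E[of n] by blast

lemma \<beta>'_zero: "\<beta> n x = 0 \<Longrightarrow> \<beta>' n x = 0"
  using deriv_at_extremum[OF D\<beta>[of n x]] \<beta>_nonneg[of n] by simp

lemma \<psi>\<^sub>N_ge: "\<beta> n x \<noteq> 0 \<Longrightarrow> real n \<le> \<psi>\<^sub>N n x"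
proof -
  assume n: "\<beta> n x \<noteq> 0"
  have "\<psi>\<^sub>N n x = (\<Sum>k<n. \<beta> k x) + \<beta> n x" by (simp add: \<psi>\<^sub>N_def lessThan_Suc_atMost[symmetric])
  also have "(\<Sum>k<n. \<beta> k x) = real n" using \<beta>_chain[OF n] by simp
  finally show ?thesis using \<beta>_nonneg[of n x] by simp
qed

lemma \<psi>\<^sub>N_nonneg: "0 \<le> \<psi>\<^sub>N n x" unfolding \<psi>\<^sub>N_def by (intro sum_nonneg \<beta>_nonneg)

lemma \<psi>\<^sub>N_le: "\<psi>\<^sub>N n x \<le> real n + 1"
  using sum_bounded_above[of "{..n}" "\<lambda>k. \<beta> k x" 1] \<beta>_le_1 by (simp add: \<psi>\<^sub>N_def)

lemma \<psi>\<^sub>N_mono: "n \<le> m \<Longrightarrow> \<psi>\<^sub>N n x \<le> \<psi>\<^sub>N m x"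
  unfolding \<psi>\<^sub>N_def by (intro sum_mono2) (auto simp: \<beta>_nonneg)

text \<open>A point off the closed set \<open>E\<close> has a neighbourhood at positive distance
  from it, while the supports shrink towards \<open>E\<close>. Nestedness passes the vanishing of
  one cutoff on to all later ones.\<close>

lemma \<beta>_eventually_zero:
  assumes "x \<notin> E"
  shows "\<exists>n d. d > 0 \<and> (\<forall>k\<ge>n. \<forall>y. \<bar>y - x\<bar> < d \<longrightarrow> \<beta> k y = 0)"
proof -
  obtain d where d: "d > 0" "ball x d \<subseteq> - E" using closed_E assms by (meson ComplI open_Compl open_contains_ball)
  obtain n where n: "1 / (real n + 1) < d / 2" using d(1) nat_approx_posE[of "d / 2"]
    by (metis add.commute half_gt_zero of_nat_Suc)
  have z: "\<beta> (Suc n) y = 0" if "\<bar>y - x\<bar> < d / 2" for y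
  proof (rule ccontr)
    assume "\<beta> (Suc n) y \<noteq> 0"
    then obtain z where z: "z \<in> E" "\<bar>y - z\<bar> < 1 / (real n + 1)" using \<beta>_supp by blast
    then have "\<bar>x - z\<bar> < d" using that n by linarith
    then have "z \<in> ball x d" by (simp add: dist_real_def)
    then show False using z d by blast
  qed
  have "\<beta> k y = 0" if "Suc n \<le> k" "\<bar>y - x\<bar> < d / 2" for k y
    using z[OF that(2)] that(1) by (rule \<beta>_zero_up)
  then show ?thesis using d(1) by (intro exI[of _ "Suc n"] exI[of _ "d / 2"]) auto
qed

text \<open>The index of the last active cutoff. It exists off \<open>E\<close>, turns the infinite
  sums at \<open>x\<close> into finite ones and determines \<open>\<psi> x\<close> up to 1.\<close>

definition "level x m \<longleftrightarrow> \<beta> m x \<noteq> 0 \<and> (\<forall>k>m. \<beta> k x = 0)"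

lemma levelD: "level x m \<Longrightarrow> \<beta> m x \<noteq> 0" "level x m \<Longrightarrow> m < k \<Longrightarrow> \<beta> k x = 0"
  by (auto simp: level_def)

lemma level_exists: "x \<notin> E \<Longrightarrow> \<exists>m. level x m"
proof -
  assume "x \<notin> E"
  then obtain n where n: "\<And>k. n \<le> k \<Longrightarrow> \<beta> k x = 0"
    using \<beta>_eventually_zero[of x] by (metis abs_zero diff_self)
  define m where "m = Max {k. \<beta> k x \<noteq> 0}"
  have fin: "finite {k. \<beta> k x \<noteq> 0}" by (rule finite_subset[of _ "{..n}"]) (use n nat_le_linear in blast)+
  moreover have "0 \<in> {k. \<beta> k x \<noteq> 0}" by (simp add: \<beta>_0)
  ultimately have "m \<in> {k. \<beta> k x \<noteq> 0}" unfolding m_def by (intro Max_in) auto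
  moreover have "\<beta> k x = 0" if "m < k" for k using Max_ge[OF fin, of k] that unfolding m_def by force
  ultimately show ?thesis by (auto simp: level_def)
qed

lemma \<psi>_eq: "level x m \<Longrightarrow> m \<le> n \<Longrightarrow> \<psi>\<^sub>N n x = \<psi> x"
  unfolding \<psi>\<^sub>N_def \<psi>_def by (rule suminf_finite[symmetric]) (auto simp: level_def)

lemma e_le_half: "e (Suc n) \<le> e n / 2" using e_le \<epsilon>_le order_trans by blast

lemma e_tendsto_0: "e \<longlonglongrightarrow> 0"
proof (rule tendsto_sandwich[of "\<lambda>_. 0" _ _ "\<lambda>n. e 0 * (1/2) ^ n"])
  have "e n \<le> e 0 * (1/2) ^ n" for n
  proof (induction n)
    case (Suc n)
    then show ?case using e_le_half[of n] by simp
  qed simp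
  then show "\<forall>\<^sub>F n in sequentially. e n \<le> e 0 * (1/2) ^ n" by simp
  show "(\<lambda>n. e 0 * (1/2) ^ n) \<longlonglongrightarrow> 0" by (intro tendsto_mult_right_zero LIMSEQ_power_zero) simp
  show "\<forall>\<^sub>F n in sequentially. 0 \<le> e n" using e_pos by (intro always_eventually) (simp add: less_imp_le)
qed simp

lemma u\<^sub>N_Suc: "u\<^sub>N (Suc n) x = u\<^sub>N n x + Q (Suc n) x" by (simp add: u\<^sub>N_def)

text \<open>Downward induction on \<open>n\<close>: the next summand takes at most
  \<open>e n / 4\<close> and the later ones at most \<open>e (Suc n) / 2\<close>, which is again at
  most \<open>e n / 4\<close>.\<close>

lemma u\<^sub>N_diff: "n \<le> m \<Longrightarrow> 0 \<le> u\<^sub>N m x - u\<^sub>N n x \<and> u\<^sub>N m x - u\<^sub>N n x \<le> e n / 2"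
proof (induction n rule: inc_induct)
  case base
  then show ?case using e_pos[of m] by simp
next
  case (step n)
  have "u\<^sub>N m x - u\<^sub>N n x = Q (Suc n) x + (u\<^sub>N m x - u\<^sub>N (Suc n) x)" by (simp add: u\<^sub>N_Suc)
  then show ?case using step.IH Q_nonneg[of n x] Q_le[of n x] e_le_half[of n] by linarith
qed

lemma u\<^sub>N_tendsto: "(\<lambda>n. u\<^sub>N n x) \<longlonglongrightarrow> u x"
proof -
  have "incseq (\<lambda>n. u\<^sub>N n x)" using u\<^sub>N_diff[of _ _ x] by (force simp: incseq_def)
  moreover have "u\<^sub>N n x \<le> u\<^sub>N 0 x + e 0 / 2" for n using u\<^sub>N_diff[of 0 n x] by simp
  ultimately obtain l where l: "(\<lambda>n. u\<^sub>N n x) \<longlonglongrightarrow> l" using incseq_convergent by blast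
  then have "(\<lambda>n. Q n x) sums l" by (simp add: sums_def_le u\<^sub>N_def)
  then have "u x = l" unfolding u_def by (rule sums_unique[symmetric])
  with l show ?thesis by simp
qed

lemma u_diff: "0 \<le> u x - u\<^sub>N n x \<and> u x - u\<^sub>N n x \<le> e n / 2"
proof -
  have "(\<lambda>m. u\<^sub>N m x - u\<^sub>N n x) \<longlonglongrightarrow> u x - u\<^sub>N n x" by (intro tendsto_intros u\<^sub>N_tendsto)
  moreover have "\<forall>\<^sub>F m in sequentially. 0 \<le> u\<^sub>N m x - u\<^sub>N n x \<and> u\<^sub>N m x - u\<^sub>N n x \<le> e n / 2"
    by (rule eventually_mono[OF eventually_ge_at_top[of n]]) (rule u\<^sub>N_diff)
  ultimately show ?thesis
    by (intro conjI tendsto_lowerbound[of "\<lambda>m. u\<^sub>N m x - u\<^sub>N n x" _ sequentially]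
        tendsto_upperbound[of "\<lambda>m. u\<^sub>N m x - u\<^sub>N n x" _ sequentially]) (auto elim: eventually_mono)
qed

lemma smooth_u\<^sub>N: "smooth (u\<^sub>N n)" unfolding u\<^sub>N_def[abs_def] by (intro smooth_sum smooth_Q)
lemma smooth_\<psi>\<^sub>N: "smooth (\<psi>\<^sub>N n)" unfolding \<psi>\<^sub>N_def[abs_def] by (intro smooth_sum smooth_\<beta>)

lemma Du\<^sub>N: "(u\<^sub>N n has_real_derivative \<psi>\<^sub>N n x) (at x)"
  unfolding u\<^sub>N_def[abs_def] \<psi>\<^sub>N_def by (intro DERIV_sum DQ)

lemma r\<^sub>N_nonneg: "0 \<le> r\<^sub>N N x y" unfolding r\<^sub>N_def by (intro sum_nonneg mult_nonneg_nonneg \<beta>_nonneg \<rho>_nonneg)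

lemma r\<^sub>N_le_\<psi>\<^sub>N: "r\<^sub>N N x y \<le> \<psi>\<^sub>N N x"
  unfolding r\<^sub>N_def \<psi>\<^sub>N_def by (intro sum_mono mult_left_le \<beta>_nonneg \<rho>_le_1)

section \<open>Bounds for the terms of the potential\<close>

lemma t_drift: "B n * (\<beta>' n x * \<Theta> n z) \<le> \<kappa> n" "- \<kappa> n \<le> B n * (\<beta>' n x * \<Theta> n z)"
proof -
  have "\<bar>B n * (\<beta>' n x * \<Theta> n z)\<bar> \<le> \<kappa> n"
    using \<Theta>_small[of n x z] B_ge(1)[of n] by (simp add: abs_mult)
  then show "B n * (\<beta>' n x * \<Theta> n z) \<le> \<kappa> n" "- \<kappa> n \<le> B n * (\<beta>' n x * \<Theta> n z)" by linarith+
qed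

lemma t_eq: "t n x y p = B n * (\<beta>' n x * \<Theta> n (y - u\<^sub>N n x)) + B n * (\<beta> n x * \<Theta>' n (y - u\<^sub>N n x)) * (p - \<psi>\<^sub>N n x)"
  by (simp add: t_def algebra_simps)

lemma \<beta>\<Theta>'_bounds: "B n * (\<beta> n x * \<Theta>' n z) \<le> B n" "- (B n * \<delta> n) \<le> B n * (\<beta> n x * \<Theta>' n z)"
proof -
  have 1: "\<beta> n x * \<Theta>' n z \<le> 1"
    using \<beta>_nonneg[of n x] \<beta>_le_1[of n x] \<Theta>'_le[of n z] by (smt (verit) mult_left_le mult_nonneg_nonpos mult_le_one)
  have "- (\<beta> n x * \<delta> n) \<le> \<beta> n x * \<Theta>' n z"
    using mult_left_mono[OF \<Theta>'_ge[of n z] \<beta>_nonneg[of n x]] by simp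
  moreover have "\<beta> n x * \<delta> n \<le> \<delta> n" using \<beta>_le_1[of n x] \<delta>_nonneg[of n] by (simp add: mult_left_le_one_le \<beta>_nonneg)
  ultimately have 2: "- \<delta> n \<le> \<beta> n x * \<Theta>' n z" by linarith
  have "B n \<ge> 0" using B_ge(1)[of n] by simp
  then show "B n * (\<beta> n x * \<Theta>' n z) \<le> B n" "- (B n * \<delta> n) \<le> B n * (\<beta> n x * \<Theta>' n z)"
    using mult_left_mono[OF 1] mult_left_mono[OF 2] by auto
qed

lemma B\<delta>: "B n * \<delta> n \<le> \<kappa> n" "0 \<le> B n * \<delta> n"
proof -
  show 0: "0 \<le> B n * \<delta> n" using B_ge(1)[of n] \<delta>_nonneg[of n] by simp
  then have "B n * \<delta> n * 1 \<le> B n * \<delta> n * (real n + 1)" by (intro mult_left_mono) auto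
  then show "B n * \<delta> n \<le> \<kappa> n" using \<delta>_small[of n] by simp
qed

lemma t_abs_le: "\<bar>t n x y p\<bar> \<le> \<kappa> n + B n * \<bar>p - \<psi>\<^sub>N n x\<bar>"
proof -
  let ?k = "B n * (\<beta> n x * \<Theta>' n (y - u\<^sub>N n x))"
  have "B n * \<delta> n \<le> B n" using B_ge(1)[of n] \<delta>_le_1[of n] by (simp add: mult_left_le)
  then have "\<bar>?k\<bar> \<le> B n" using \<beta>\<Theta>'_bounds[of n x "y - u\<^sub>N n x"] by linarith
  then have "\<bar>?k * (p - \<psi>\<^sub>N n x)\<bar> \<le> B n * \<bar>p - \<psi>\<^sub>N n x\<bar>" unfolding abs_mult[of ?k] by (intro mult_right_mono) auto
  then show ?thesis using t_drift[of n x "y - u\<^sub>N n x"] unfolding t_eq by linarith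
qed

text \<open>For \<open>p\<close> below \<open>\<psi>\<^sub>N n x\<close> the slope part of the term
  is positive only where \<open>\<Theta> n\<close> descends, and there its coefficient is at least
  \<open>- (B n * \<delta> n)\<close>.\<close>

lemma t_le_below:
  assumes "p \<le> \<psi>\<^sub>N n x \<or> \<beta> n x = 0"
  shows "t n x y p \<le> \<kappa> n * (2 + \<bar>p\<bar>)"
proof -
  let ?k = "B n * (\<beta> n x * \<Theta>' n (y - u\<^sub>N n x))"
  have "?k * (p - \<psi>\<^sub>N n x) \<le> \<kappa> n * (1 + \<bar>p\<bar>)"
  proof (cases "\<beta> n x = 0")
    case False
    then have p: "p \<le> \<psi>\<^sub>N n x" using assms by simp
    have "?k * (p - \<psi>\<^sub>N n x) \<le> (B n * \<delta> n) * (\<psi>\<^sub>N n x - p)"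
      using mult_right_mono[OF \<beta>\<Theta>'_bounds(2)[of n x "y - u\<^sub>N n x"], of "\<psi>\<^sub>N n x - p"] p by (simp add: algebra_simps)
    also have "\<dots> \<le> (B n * \<delta> n) * ((real n + 1) + \<bar>p\<bar>)"
      using \<psi>\<^sub>N_le[of n x] B\<delta>[of n] by (intro mult_left_mono) auto
    also have "\<dots> = B n * \<delta> n * (real n + 1) + B n * \<delta> n * \<bar>p\<bar>" by (simp add: distrib_left)
    also have "\<dots> \<le> \<kappa> n + \<kappa> n * \<bar>p\<bar>"
      using \<delta>_small[of n] B\<delta>[of n] by (intro add_mono mult_right_mono) auto
    finally show ?thesis by (simp add: distrib_left)
  qed simp
  then show ?thesis using t_drift(1)[of n x "y - u\<^sub>N n x"] unfolding t_eq distrib_left by linarith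
qed

lemma t_bounds_above:
  assumes "\<psi>\<^sub>N n x \<le> p"
  shows "- (\<kappa> n * (1 + \<bar>p\<bar>)) \<le> t n x y p" "t n x y p \<le> \<kappa> n + B n * (p - \<psi>\<^sub>N n x)"
proof -
  let ?k = "B n * (\<beta> n x * \<Theta>' n (y - u\<^sub>N n x))"
  have "- ((B n * \<delta> n) * (p - \<psi>\<^sub>N n x)) \<le> ?k * (p - \<psi>\<^sub>N n x)"
    using mult_right_mono[OF \<beta>\<Theta>'_bounds(2)[of n x "y - u\<^sub>N n x"], of "p - \<psi>\<^sub>N n x"] assms by simp
  moreover have "(B n * \<delta> n) * (p - \<psi>\<^sub>N n x) \<le> \<kappa> n * \<bar>p\<bar>"
    using B\<delta>[of n] \<psi>\<^sub>N_nonneg[of n x] assms by (intro mult_mono) auto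
  ultimately show "- (\<kappa> n * (1 + \<bar>p\<bar>)) \<le> t n x y p"
    using t_drift(2)[of n x "y - u\<^sub>N n x"] unfolding t_eq distrib_left by linarith
  show "t n x y p \<le> \<kappa> n + B n * (p - \<psi>\<^sub>N n x)"
    using t_drift(1)[of n x "y - u\<^sub>N n x"] mult_right_mono[OF \<beta>\<Theta>'_bounds(1)[of n x "y - u\<^sub>N n x"], of "p - \<psi>\<^sub>N n x"] assms
    unfolding t_eq by simp
qed

lemma t_zero: "\<beta> n x = 0 \<or> \<epsilon> n \<le> \<bar>y - u\<^sub>N n x\<bar> \<Longrightarrow> t n x y p = 0 \<and> \<beta> n x * \<rho> n (y - u\<^sub>N n x) = 0"
  using \<beta>'_zero[of n x] \<Theta>_out[of n "y - u\<^sub>N n x"] \<Theta>'_out[of n "y - u\<^sub>N n x"] \<rho>_out[of n "y - u\<^sub>N n x"]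
  by (auto simp: t_def)

lemma stationary:
  assumes "\<And>n. m < n \<Longrightarrow> \<beta> n x = 0 \<or> \<epsilon> n \<le> \<bar>y - u\<^sub>N n x\<bar>" "m \<le> N"
  shows "P\<^sub>N N x y p = P\<^sub>N m x y p" "r\<^sub>N N x y = r\<^sub>N m x y" "s\<^sub>N N x y p = s\<^sub>N m x y p"
proof -
  have "(\<Sum>n\<le>N. f n) = (\<Sum>n\<le>m. f n)" if "\<And>n. m < n \<Longrightarrow> f n = 0" for f :: "nat \<Rightarrow> real"
    using assms(2) that by (intro sum.mono_neutral_right) auto
  then show *: "P\<^sub>N N x y p = P\<^sub>N m x y p" "r\<^sub>N N x y = r\<^sub>N m x y"
    unfolding P\<^sub>N_def r\<^sub>N_def using t_zero[OF assms(1)] by auto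
  show "s\<^sub>N N x y p = s\<^sub>N m x y p" by (simp add: s\<^sub>N_def *)
qed

lemma W_eqI: "(\<And>N. m \<le> N \<Longrightarrow> T (s\<^sub>N N x y p) = c) \<Longrightarrow> W x y p = c"
  unfolding W_def by (intro limI tendsto_eventually) (auto simp: eventually_sequentially)

text \<open>Let \<open>m\<close> be the last index with \<open>\<rho> m\<close> active, so that \<open>r\<^sub>N \<le> m + 1\<close>. Then the term of index
  \<open>m - 1\<close> sees slope \<open>\<Theta>' = 1\<close> and contributes at most \<open>- B (m - 1)\<close>, because \<open>p\<close> is below \<open>\<psi>\<^sub>N (m - 1) x = m\<close> by at
  least 1. This outweighs the finitely many positive terms, those with \<open>n < P0\<close>.\<close>
lemma s\<^sub>N_le_near_graph:
  fixes P0 M0 :: nat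
  assumes p: "\<bar>p\<bar> \<le> real P0" and M0: "P0 + 1 \<le> M0"
    and big: "C + 2 + real P0 + (\<Sum>n<P0. B n * (real P0 + real n + 1)) \<le> real M0"
    and near: "\<And>n. n \<le> M0 \<Longrightarrow> \<beta> n x = 1 \<and> \<bar>y - u\<^sub>N n x\<bar> \<le> e n" and N: "M0 \<le> N"
  shows "s\<^sub>N N x y p \<le> 0"
proof -
  define A where "A = {n. n \<le> N \<and> \<beta> n x * \<rho> n (y - u\<^sub>N n x) \<noteq> 0}"
  have fin: "finite A" by (simp add: A_def)
  have M0A: "M0 \<in> A" using near[of M0] \<rho>_in[of "y - u\<^sub>N M0 x" M0] N by (simp add: A_def)
  define m where "m = Max A"
  have mA: "m \<in> A" and mM: "M0 \<le> m" using Max_in[OF fin] Max_ge[OF fin M0A] M0A unfolding m_def by blast+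
  have m: "m \<le> N" "\<beta> m x \<noteq> 0" "\<rho> m (y - u\<^sub>N m x) \<noteq> 0" using mA by (auto simp: A_def)
  obtain k where k: "m = Suc k" using mM M0 by (cases m) auto
  have r_le: "r\<^sub>N N x y \<le> real m + 1"
  proof -
    have "r\<^sub>N N x y = r\<^sub>N m x y"
      unfolding r\<^sub>N_def
    proof (rule sum.mono_neutral_right)
      show "\<forall>n\<in>{..N} - {..m}. \<beta> n x * \<rho> n (y - u\<^sub>N n x) = 0"
        using Max_ge[OF fin] unfolding m_def A_def by fastforce
    qed (use m in auto)
    then show ?thesis using r\<^sub>N_le_\<psi>\<^sub>N[of m x y] \<psi>\<^sub>N_le[of m x] by simp
  qed
  \<comment> \<open>An active \<open>\<rho> m\<close> puts \<open>y\<close> into the outer tube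
    around \<open>u\<^sub>N m\<close>, hence into the inner tube around \<open>u\<^sub>N k\<close>,
    where \<open>\<Theta>' k\<close> is 1.\<close>
  have "\<bar>y - u\<^sub>N m x\<bar> < \<epsilon> m" using \<rho>_out[of m "y - u\<^sub>N m x"] m(3) by force
  then have zk: "\<bar>y - u\<^sub>N k x\<bar> \<le> e k"
    using u\<^sub>N_diff[of k m x] \<epsilon>_le[of k] k by auto
  have \<beta>k: "\<beta> i x = 1" if "i \<le> k" for i using \<beta>_chain[OF m(2), of i] k that by simp
  have \<psi>k: "\<psi>\<^sub>N k x = real m" using \<beta>k by (simp add: \<psi>\<^sub>N_def k)
  have tk: "t k x y p \<le> \<kappa> k - B k"
  proof -
    have "t k x y p = B k * (\<beta>' k x * \<Theta> k (y - u\<^sub>N k x)) + B k * (p - real m)"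
      using \<beta>k[of k] \<Theta>'_in[OF zk] \<psi>k by (simp add: t_eq)
    moreover have "B k * (p - real m) \<le> B k * (-1)"
      using B_ge(1)[of k] p mM M0 by (intro mult_left_mono) auto
    ultimately show ?thesis using t_drift(1)[of k x "y - u\<^sub>N k x"] by simp
  qed
  \<comment> \<open>One formula for three kinds of terms: index \<open>k\<close> contributes
    \<open>- B k\<close>; an index below \<open>P0\<close> may contribute positively, since
    \<open>p\<close> can exceed \<open>\<psi>\<^sub>N n x\<close>; from \<open>P0\<close> on,
    \<open>p\<close> lies below \<open>\<psi>\<^sub>N n x\<close> or the cutoff vanishes.\<close>
  have tn: "t n x y p \<le> \<kappa> n * (2 + real P0) + (if n < P0 then B n * (real P0 + real n + 1) else 0)
      - (if n = k then B k else 0)" for n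
  proof -
    have \<kappa>P: "\<kappa> n * (2 + \<bar>p\<bar>) \<le> \<kappa> n * (2 + real P0)" using p by (intro mult_left_mono) auto
    consider "n = k" | "n < P0" "n \<noteq> k" | "P0 \<le> n" "n \<noteq> k" by linarith
    then show ?thesis
    proof cases
      case 1
      have "\<kappa> k * 1 \<le> \<kappa> k * (2 + real P0)" by (intro mult_left_mono) auto
      then have "t k x y p \<le> \<kappa> k * (2 + real P0) - B k" using tk by linarith
      then show ?thesis using 1 k mM M0 by simp
    next
      case 2
      have "B n * \<bar>p - \<psi>\<^sub>N n x\<bar> \<le> B n * (real P0 + real n + 1)"
        using B_ge(1)[of n] p \<psi>\<^sub>N_nonneg[of n x] \<psi>\<^sub>N_le[of n x] by (intro mult_left_mono) auto
      moreover have "\<kappa> n * 1 \<le> \<kappa> n * (2 + real P0)" by (intro mult_left_mono) auto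
      ultimately have "t n x y p \<le> \<kappa> n * (2 + real P0) + B n * (real P0 + real n + 1)"
        using t_abs_le[of n x y p] by linarith
      then show ?thesis using 2 by simp
    next
      case 3
      have "p \<le> \<psi>\<^sub>N n x \<or> \<beta> n x = 0" using \<psi>\<^sub>N_ge[of n x] p 3 by force
      from order_trans[OF t_le_below[OF this, of y] \<kappa>P] show ?thesis using 3 by simp
    qed
  qed
  have "(\<Sum>n\<le>N. t n x y p) \<le> (\<Sum>n\<le>N. \<kappa> n * (2 + real P0) + (if n < P0 then B n * (real P0 + real n + 1) else 0)
      - (if n = k then B k else 0))" by (intro sum_mono tn)
  also have "\<dots> = (\<Sum>n\<le>N. \<kappa> n) * (2 + real P0) + (\<Sum>n\<le>N. if n < P0 then B n * (real P0 + real n + 1) else 0)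
      - (\<Sum>n\<le>N. if n = k then B k else 0)"
    by (simp only: sum_subtractf sum.distrib sum_distrib_right)
  also have "(\<Sum>n\<le>N. if n < P0 then B n * (real P0 + real n + 1) else 0) = (\<Sum>n<P0. B n * (real P0 + real n + 1))"
    using M0 N by (intro sum.mono_neutral_cong_right) auto
  also have "(\<Sum>n\<le>N. if n = k then B k else 0) = B k" using m(1) k by simp
  also have "(\<Sum>n\<le>N. \<kappa> n) * (2 + real P0) \<le> 1/2 * (2 + real P0)"
    by (intro mult_right_mono sum_\<kappa>_le) simp
  finally have "(\<Sum>n\<le>N. t n x y p) \<le> (2 + real P0) / 2 + (\<Sum>n<P0. B n * (real P0 + real n + 1)) - B k" by simp
  then have sumt: "(\<Sum>n\<le>N. t n x y p) \<le> 1 + real P0 / 2 + (\<Sum>n<P0. B n * (real P0 + real n + 1)) - B k" by argo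
  let ?r = "r\<^sub>N N x y"
  have "\<omega>' ?r * (?r - p) \<le> \<omega>' ?r * (2 * real m + 1)"
    using r_le p mM M0 r\<^sub>N_nonneg[of N x y] by (intro mult_left_mono \<omega>'_nonneg) auto
  also have "\<dots> \<le> \<omega>' (real m + 1) * (2 * real m + 1)" by (intro mult_right_mono \<omega>'_mono r_le) auto
  \<comment> \<open>As \<open>m = k + 1\<close>, the left side is the first summand of
    \<open>B k\<close>. The other summands leave at least \<open>real m\<close>, which has to beat
    \<open>C\<close> and the terms below \<open>P0\<close>.\<close>
  also have "\<dots> \<le> B k - real m"
    using \<omega>_nonneg[of "real k + 3"] by (simp add: B_def k algebra_simps)
  finally have "\<omega>' ?r * (?r - p) \<le> B k - real m" .
  moreover have "real M0 \<le> real m" using mM by simp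
  ultimately show ?thesis
    using sumt big \<omega>_nonneg[of ?r] unfolding s\<^sub>N_def P\<^sub>N_def by linarith
qed

end

section \<open>Smoothness and strict convexity of the Lagrangian\<close>

lemma smooth_fst3: "smooth (\<lambda>q::real\<times>real\<times>real. fst q)"
  using smooth_inner_left[of "(1::real, 0::real, 0::real)"] by (simp add: inner_prod_def)
lemma smooth_snd3: "smooth (\<lambda>q::real\<times>real\<times>real. fst (snd q))"
  using smooth_inner_left[of "(0::real, 1::real, 0::real)"] by (simp add: inner_prod_def)
lemma smooth_thd3: "smooth (\<lambda>q::real\<times>real\<times>real. snd (snd q))"
  using smooth_inner_left[of "(0::real, 0::real, 1::real)"] by (simp add: inner_prod_def)

context singular_construction
begin

lemma smooth_s\<^sub>N: "smooth (\<lambda>q. s\<^sub>N N (fst q) (fst (snd q)) (snd (snd q)))"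
proof -
  have z: "smooth (\<lambda>q::real\<times>real\<times>real. fst (snd q) - u\<^sub>N n (fst q))" for n
    by (intro smooth_diff smooth_snd3 smooth_compose[OF smooth_u\<^sub>N smooth_fst3])
  have r: "smooth (\<lambda>q::real\<times>real\<times>real. r\<^sub>N N (fst q) (fst (snd q)))"
    unfolding r\<^sub>N_def
    by (intro smooth_sum smooth_mult smooth_compose[OF smooth_\<beta> smooth_fst3] smooth_compose[OF smooth_\<rho> z])
  have t: "smooth (\<lambda>q::real\<times>real\<times>real. t n (fst q) (fst (snd q)) (snd (snd q)))" for n
    unfolding t_def
    by (intro smooth_mult smooth_add smooth_diff smooth_const smooth_thd3 smooth_compose[OF smooth_\<beta> smooth_fst3]
        smooth_compose[OF smooth_\<beta>' smooth_fst3] smooth_compose[OF smooth_\<psi>\<^sub>N smooth_fst3]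
        smooth_compose[OF smooth_\<Theta> z] smooth_compose[OF smooth_\<Theta>' z])
  show ?thesis unfolding s\<^sub>N_def P\<^sub>N_def
    by (intro smooth_mult smooth_add smooth_diff smooth_const smooth_sum smooth_thd3 t r
        smooth_compose[OF smooth_\<omega>' r] smooth_compose[OF smooth_\<omega> r])
qed

text \<open>Off \<open>E\<close> the later cutoffs vanish nearby. Over \<open>E\<close> but off the
  graph, later tubes are too narrow to reach the point. On the graph over \<open>E\<close> it is
  only \<open>T (s\<^sub>N \<dots>)\<close> that is shown to settle, the arguments being nonpositive
  there.\<close>

lemma s\<^sub>N_locally_stationary:
  fixes x y p :: real
  shows "\<exists>V m. open V \<and> (x, y, p) \<in> V \<and>
    (\<forall>q\<in>V. \<forall>N\<ge>m. T (s\<^sub>N N (fst q) (fst (snd q)) (snd (snd q))) = T (s\<^sub>N m (fst q) (fst (snd q)) (snd (snd q))))"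
proof -
  have finish: ?thesis if V: "open V" "(x, y, p) \<in> V"
    and st: "\<And>x' y' p' N. (x', y', p') \<in> V \<Longrightarrow> m \<le> N \<Longrightarrow> T (s\<^sub>N N x' y' p') = T (s\<^sub>N m x' y' p')" for V m
  proof (intro exI[of _ V] exI[of _ m] conjI ballI allI impI V)
    fix q N assume "q \<in> V" "m \<le> N"
    then show "T (s\<^sub>N N (fst q) (fst (snd q)) (snd (snd q))) = T (s\<^sub>N m (fst q) (fst (snd q)) (snd (snd q)))"
      by (intro st) simp_all
  qed
  consider "x \<notin> E" | "x \<in> E" "y \<noteq> u x" | "x \<in> E" "y = u x" by blast
  then show ?thesis
  proof cases
    case 1
    obtain n d where nd: "d > 0" "\<forall>k\<ge>n. \<forall>y. \<bar>y - x\<bar> < d \<longrightarrow> \<beta> k y = 0"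
      using \<beta>_eventually_zero[OF 1] by (elim exE conjE)
    show ?thesis
    proof (rule finish[of "ball x d \<times> UNIV" n])
      fix x' y' p' :: real and N
      assume h: "(x', y', p') \<in> ball x d \<times> UNIV" "n \<le> N"
      have "\<beta> k x' = 0" if "n < k" for k
        using nd(2) h(1) that by (simp add: dist_real_def abs_minus_commute)
      then show "T (s\<^sub>N N x' y' p') = T (s\<^sub>N n x' y' p')"
        using stationary(3)[OF _ h(2), of x' y' p'] by simp
    qed (use nd(1) in \<open>auto intro: open_Times\<close>)
  next
    case 2
    define d where "d = \<bar>y - u x\<bar>"
    have d: "d > 0" using 2 by (simp add: d_def)
    \<comment> \<open>Beyond \<open>K\<close> all centres stay within \<open>e K / 2\<close> of
      \<open>u\<^sub>N K\<close> and all outer radii are at most \<open>e K / 2\<close>, so points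
      farther than \<open>d / 2\<close> from \<open>u\<^sub>N K\<close> are out of reach.\<close>
    have "\<forall>\<^sub>F n in sequentially. e n < d / 4" using order_tendstoD(2)[OF e_tendsto_0, of "d / 4"] d by simp
    then obtain K where K: "e K < d / 4" by (auto simp: eventually_sequentially)
    define V where "V = {q::real\<times>real\<times>real. d / 2 < \<bar>fst (snd q) - u\<^sub>N K (fst q)\<bar>}"
    have "continuous_on UNIV (\<lambda>q::real\<times>real\<times>real. fst (snd q) - u\<^sub>N K (fst q))"
      by (intro smooth_imp_continuous_on smooth_diff smooth_snd3 smooth_compose[OF smooth_u\<^sub>N smooth_fst3])
    then have "open V" unfolding V_def by (intro open_Collect_less continuous_on_const continuous_on_rabs)
    moreover have "d / 2 < \<bar>y - u\<^sub>N K x\<bar>"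
    proof -
      have "d \<le> \<bar>y - u\<^sub>N K x\<bar> + \<bar>u\<^sub>N K x - u x\<bar>"
        using abs_triangle_ineq[of "y - u\<^sub>N K x" "u\<^sub>N K x - u x"] by (simp add: d_def)
      moreover have "\<bar>u\<^sub>N K x - u x\<bar> \<le> e K / 2" using u_diff[of x K] by simp
      ultimately show ?thesis using K d e_pos[of K] by linarith
    qed
    then have "(x, y, p) \<in> V" by (simp add: V_def)
    moreover have "s\<^sub>N N x' y' p' = s\<^sub>N K x' y' p'" if V: "(x', y', p') \<in> V" and N: "K \<le> N" for x' y' p' N
    proof (rule stationary(3)[OF _ N], rule disjI2)
      fix n assume n: "K < n"
      then obtain j where j: "n = Suc j" "K \<le> j" by (cases n) auto
      have "e j \<le> e K" using j(2)
      proof (induction j rule: dec_induct)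
        case (step i)
        then show ?case using e_le_half[of i] e_pos[of i] by linarith
      qed simp
      then have "\<epsilon> n \<le> e K / 2" using \<epsilon>_le[of j] j by simp
      moreover have "\<bar>u\<^sub>N n x' - u\<^sub>N K x'\<bar> \<le> e K / 2" using u\<^sub>N_diff[of K n x'] n by auto
      moreover have "d / 2 < \<bar>y' - u\<^sub>N K x'\<bar>" using V by (simp add: V_def)
      moreover have "\<bar>y' - u\<^sub>N K x'\<bar> \<le> \<bar>y' - u\<^sub>N n x'\<bar> + \<bar>u\<^sub>N n x' - u\<^sub>N K x'\<bar>"
        using abs_triangle_ineq[of "y' - u\<^sub>N n x'" "u\<^sub>N n x' - u\<^sub>N K x'"] by simp
      ultimately show "\<epsilon> n \<le> \<bar>y' - u\<^sub>N n x'\<bar>" using K by linarith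
    qed
    ultimately show ?thesis by (intro finish[of V K] arg_cong[where f = T])
  next
    case 3
    obtain P0 :: nat where P0: "\<bar>p\<bar> < real P0" using reals_Archimedean2 by blast
    obtain M0 :: nat where M0: "C + 2 + real P0 + (\<Sum>n<P0. B n * (real P0 + real n + 1)) + real P0 + 1 \<le> real M0"
      using real_arch_simple by blast
    have nn: "0 \<le> (\<Sum>n<P0. B n * (real P0 + real n + 1))"
      by (intro sum_nonneg mult_nonneg_nonneg) (use B_ge(1) in \<open>auto intro: order_trans[of 0 3]\<close>)
    have M1: "P0 + 1 \<le> M0" "C + 2 + real P0 + (\<Sum>n<P0. B n * (real P0 + real n + 1)) \<le> real M0"
      using M0 nn C_ge by linarith+
    obtain G where G: "\<And>n. open (G n)" "\<And>n. E \<subseteq> G n" "\<And>n x. x \<in> G n \<Longrightarrow> \<beta> n x = 1"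
      using \<beta>_near_E by metis
    \<comment> \<open>The tube conditions concern only the indices up to \<open>M0\<close>, so
      \<open>V\<close> is a finite intersection of open sets; yet they fix the sign of
      \<open>s\<^sub>N\<close> for every \<open>N \<ge> M0\<close>.\<close>
    define V where "V = (\<Inter>n\<in>{..M0}. fst -` G n \<inter> {q::real\<times>real\<times>real. \<bar>fst (snd q) - u\<^sub>N n (fst q)\<bar> < e n})
      \<inter> {q. \<bar>snd (snd q)\<bar> < real P0}"
    have "open V"
      unfolding V_def
    proof (intro open_Int open_INT ballI finite_atMost)
      show "open (fst -` G n :: (real\<times>real\<times>real) set)" for n
        by (intro open_vimage G continuous_on_fst continuous_on_id)
      show "open {q::real\<times>real\<times>real. \<bar>fst (snd q) - u\<^sub>N n (fst q)\<bar> < e n}" for n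
        by (intro open_Collect_less continuous_on_const continuous_on_rabs
            smooth_imp_continuous_on smooth_diff smooth_snd3 smooth_compose[OF smooth_u\<^sub>N smooth_fst3])
      show "open {q::real\<times>real\<times>real. \<bar>snd (snd q)\<bar> < real P0}"
        by (intro open_Collect_less continuous_intros)
    qed
    moreover have "\<bar>u x - u\<^sub>N n x\<bar> < e n" for n using u_diff[of x n] e_pos[of n] by auto
    then have "(x, y, p) \<in> V" unfolding V_def using 3 G(2) P0 by auto
    moreover have "T (s\<^sub>N N x' y' p') = T (s\<^sub>N M0 x' y' p')" if V: "(x', y', p') \<in> V" and N: "M0 \<le> N" for x' y' p' N
    proof -
      have "\<bar>p'\<bar> \<le> real P0" using V by (simp add: V_def)
      moreover have "\<beta> n x' = 1 \<and> \<bar>y' - u\<^sub>N n x'\<bar> \<le> e n" if "n \<le> M0" for n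
      proof -
        have "x' \<in> G n \<and> \<bar>y' - u\<^sub>N n x'\<bar> < e n" using V that by (simp add: V_def)
        then show ?thesis using G(3)[of x' n] by simp
      qed
      ultimately have "s\<^sub>N N x' y' p' \<le> 0" "s\<^sub>N M0 x' y' p' \<le> 0"
        using s\<^sub>N_le_near_graph[OF _ M1] N by blast+
      then show ?thesis by (simp add: T(6))
    qed
    ultimately show ?thesis by (intro finish[of V M0])
  qed
qed

lemma W_eventually: "\<exists>m. \<forall>N\<ge>m. T (s\<^sub>N N x y p) = W x y p"
proof -
  obtain V m where V0: "(x, y, p) \<in> V" and V: "\<forall>q\<in>V. \<forall>N\<ge>m. T (s\<^sub>N N (fst q) (fst (snd q)) (snd (snd q))) =
      T (s\<^sub>N m (fst q) (fst (snd q)) (snd (snd q)))"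
    using s\<^sub>N_locally_stationary[of x y p] by (elim exE conjE)
  have m: "T (s\<^sub>N N x y p) = T (s\<^sub>N m x y p)" if "m \<le> N" for N
    using bspec[OF V V0] that unfolding fst_conv snd_conv by blast
  have W: "W x y p = T (s\<^sub>N m x y p)" by (rule W_eqI[OF m])
  show ?thesis
  proof (intro exI[of _ m] allI impI)
    fix N assume "m \<le> N"
    from trans[OF m[OF this] W[symmetric]] show "T (s\<^sub>N N x y p) = W x y p" .
  qed
qed

lemma smooth_L: "smooth (\<lambda>(x, y, p). L x y p)"
proof (rule smooth_locally)
  fix q0 :: "real \<times> real \<times> real"
  obtain V m where V: "open V" "q0 \<in> V"
    and st: "\<forall>q\<in>V. \<forall>N\<ge>m. T (s\<^sub>N N (fst q) (fst (snd q)) (snd (snd q))) = T (s\<^sub>N m (fst q) (fst (snd q)) (snd (snd q)))"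
    using s\<^sub>N_locally_stationary[of "fst q0" "fst (snd q0)" "snd (snd q0)"]
    unfolding prod.collapse by (elim exE conjE)
  have "\<forall>q\<in>V. (case q of (x, y, p) \<Rightarrow> L x y p) = \<omega> (snd (snd q)) + T (s\<^sub>N m (fst q) (fst (snd q)) (snd (snd q)))"
  proof
    fix q assume "q \<in> V"
    then have "W (fst q) (fst (snd q)) (snd (snd q)) = T (s\<^sub>N m (fst q) (fst (snd q)) (snd (snd q)))"
      using st by (intro W_eqI) blast
    then show "(case q of (x, y, p) \<Rightarrow> L x y p) = \<omega> (snd (snd q)) + T (s\<^sub>N m (fst q) (fst (snd q)) (snd (snd q)))"
      by (simp add: L_def case_prod_unfold)
  qed
  moreover have "smooth (\<lambda>q. \<omega> (snd (snd q)) + T (s\<^sub>N m (fst q) (fst (snd q)) (snd (snd q))))"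
    by (intro smooth_add smooth_compose[OF smooth_\<omega> smooth_thd3] smooth_compose[OF T(1) smooth_s\<^sub>N])
  ultimately show "\<exists>V h. open V \<and> q0 \<in> V \<and> smooth h \<and> (\<forall>z\<in>V. (case z of (x, y, p) \<Rightarrow> L x y p) = h z)"
    using V(1,2) by blast
qed

lemma L_ge_\<omega>: "\<omega> p \<le> L x y p"
proof -
  obtain m where "T (s\<^sub>N m x y p) = W x y p" using W_eventually[of x y p] by blast
  then show ?thesis using T(3)[of "s\<^sub>N m x y p"] by (simp add: L_def)
qed

lemma L_nonneg: "0 \<le> L x y p" using L_ge_\<omega> \<omega>_nonneg order_trans by blast

lemma W_convex:
  assumes \<tau>: "0 < \<tau>" "\<tau> < 1"
  shows "W x y ((1 - \<tau>) * p + \<tau> * q) \<le> (1 - \<tau>) * W x y p + \<tau> * W x y q"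
proof -
  let ?c = "(1 - \<tau>) * p + \<tau> * q"
  obtain m1 m2 m3 where m: "\<And>N. m1 \<le> N \<Longrightarrow> T (s\<^sub>N N x y p) = W x y p"
    "\<And>N. m2 \<le> N \<Longrightarrow> T (s\<^sub>N N x y q) = W x y q" "\<And>N. m3 \<le> N \<Longrightarrow> T (s\<^sub>N N x y ?c) = W x y ?c"
    using W_eventually[of x y p] W_eventually[of x y q] W_eventually[of x y ?c] by blast
  define N where "N = max m1 (max m2 m3)"
  have t: "t n x y ?c = (1 - \<tau>) * t n x y p + \<tau> * t n x y q" for n
    unfolding t_def by (simp add: algebra_simps)
  have P: "P\<^sub>N N x y ?c = (1 - \<tau>) * P\<^sub>N N x y p + \<tau> * P\<^sub>N N x y q"
    unfolding P\<^sub>N_def t sum.distrib sum_distrib_left[symmetric] by (simp add: algebra_simps)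
  have "s\<^sub>N N x y ?c = (1 - \<tau>) * s\<^sub>N N x y p + \<tau> * s\<^sub>N N x y q"
    unfolding s\<^sub>N_def P by (simp add: algebra_simps)
  then have "T (s\<^sub>N N x y ?c) \<le> (1 - \<tau>) * T (s\<^sub>N N x y p) + \<tau> * T (s\<^sub>N N x y q)"
    using convex_onD[OF T(2), of \<tau> "s\<^sub>N N x y p" "s\<^sub>N N x y q"] \<tau> by simp
  then show ?thesis using m[of N] by (simp add: N_def)
qed

lemma strict_convex_L: "strict_convex_on UNIV (L x y)"
  unfolding strict_convex_on_def
proof (intro conjI ballI allI impI)
  fix p q \<tau> :: real assume h: "p \<noteq> q \<and> 0 < \<tau> \<and> \<tau> < 1"
  let ?c = "(1 - \<tau>) * p + \<tau> * q"
  \<comment> \<open>Tangent at the intermediate point: averaging the strict inequality at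
    \<open>p\<close> with the weak one at \<open>q\<close> cancels the slopes.\<close>
  have "\<omega> ?c + \<omega>' ?c * (p - ?c) < \<omega> p"
  proof (rule \<omega>_tangent)
    have "p - ?c = \<tau> * (p - q)" by (simp add: algebra_simps)
    then show "p \<noteq> ?c" using h by auto
  qed
  then have "(1 - \<tau>) * (\<omega> ?c + \<omega>' ?c * (p - ?c)) < (1 - \<tau>) * \<omega> p" using h by simp
  moreover have "\<tau> * (\<omega> ?c + \<omega>' ?c * (q - ?c)) \<le> \<tau> * \<omega> q"
    using h \<omega>_tangent_le by (intro mult_left_mono) auto
  moreover have "(1 - \<tau>) * (\<omega> ?c + \<omega>' ?c * (p - ?c)) + \<tau> * (\<omega> ?c + \<omega>' ?c * (q - ?c)) = \<omega> ?c"
    by (simp add: algebra_simps)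
  ultimately show "L x y ((1 - \<tau>) *\<^sub>R p + \<tau> *\<^sub>R q) < (1 - \<tau>) * L x y p + \<tau> * L x y q"
    using W_convex[of \<tau> x y p q] h by (simp add: L_def distrib_left)
qed simp

section \<open>Calibration\<close>

lemma stationary_level:
  assumes "level x m" "m \<le> N"
  shows "P\<^sub>N N x y p = P\<^sub>N m x y p" "s\<^sub>N N x y p = s\<^sub>N m x y p"
  using stationary(1,3)[OF disjI1[OF levelD(2)[OF assms(1)]] assms(2)] by blast+

text \<open>The inequality \<open>s \<le> T s\<close>, solved for the potential: the Lagrangian
  exceeds the derivative of the potential by the gap between \<open>\<omega>\<close> and its tangent
  at \<open>r\<^sub>N\<close>.\<close>

lemma calibration:
  assumes m: "level x m"
  shows "P\<^sub>N m x y p + (\<omega> p - \<omega> (r\<^sub>N m x y) - \<omega>' (r\<^sub>N m x y) * (p - r\<^sub>N m x y)) \<le> L x y p"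
    and "W x y p = T (s\<^sub>N m x y p)"
proof -
  show W: "W x y p = T (s\<^sub>N m x y p)"
    by (rule W_eqI) (rule arg_cong[OF stationary_level(2)[OF m]])
  show "P\<^sub>N m x y p + (\<omega> p - \<omega> (r\<^sub>N m x y) - \<omega>' (r\<^sub>N m x y) * (p - r\<^sub>N m x y)) \<le> L x y p"
    using T(4)[of "s\<^sub>N m x y p"] unfolding L_def W s\<^sub>N_def by (simp add: algebra_simps)
qed

text \<open>What \<open>L\<close> gains over the potential for slopes above \<open>\<psi>\<close>. Nothing is claimed for slopes below:
  a competitor other than \<open>u\<close> with the same end values exceeds slope \<open>\<psi>\<close> on a set of positive measure.\<close>
definition "excess x p = (if \<psi> x < p then \<omega> p - \<omega> (\<psi> x) - \<omega>' (\<psi> x) * (p - \<psi> x) else 0)"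
text \<open>Pays for stopping the potential at stage \<open>N\<close> at points of deeper level. It
  lives on the support of the next cutoff, so its integral tends to 0.\<close>

definition "tail_bound N x = (if \<beta> (Suc N) x = 0 then 0 else C + 2 + M + \<psi> x * (\<Sum>k\<le>N. B k))"

lemma excess_nonneg: "0 \<le> excess x p"
  using \<omega>_tangent_le[of "\<psi> x" p] by (simp add: excess_def)

lemma excess_pos: "\<psi> x < p \<Longrightarrow> 0 < excess x p"
  using \<omega>_tangent[of p "\<psi> x"] by (simp add: excess_def)

text \<open>The tangent point \<open>r\<^sub>N\<close> depends on \<open>y\<close> but never exceeds
  \<open>\<psi> x\<close>. For \<open>p\<close> above \<open>\<psi> x\<close>, monotonicity of
  \<open>\<omega>'\<close> makes the gap at the lower tangent point the larger one; for other
  \<open>p\<close> the gap is nonnegative.\<close>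

lemma calibration_excess:
  assumes m: "level x m"
  shows "P\<^sub>N m x y p + excess x p \<le> L x y p"
proof (cases "\<psi> x < p")
  case True
  let ?r = "r\<^sub>N m x y"
  have r\<psi>: "?r \<le> \<psi> x" using r\<^sub>N_le_\<psi>\<^sub>N[of m x y] \<psi>_eq[OF m, of m] by simp
  have "0 \<le> (\<omega>' (\<psi> x) - \<omega>' ?r) * (p - \<psi> x)" using True \<omega>'_mono[OF r\<psi>] by simp
  moreover have "\<omega> ?r + \<omega>' ?r * (\<psi> x - ?r) \<le> \<omega> (\<psi> x)" by (rule \<omega>_tangent_le)
  ultimately have "excess x p \<le> \<omega> p - \<omega> ?r - \<omega>' ?r * (p - ?r)"
    using True by (simp add: excess_def algebra_simps)
  then show ?thesis using calibration(1)[OF m, of y p] by linarith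
next
  case False
  then show ?thesis
    using calibration(1)[OF m, of y p] \<omega>_tangent_le[of "r\<^sub>N m x y" p] by (simp add: excess_def)
qed

lemma \<psi>_nonneg_level:
  assumes m: "level x m"
  shows "real m \<le> \<psi> x" "\<psi> x \<le> real m + 1" "\<psi>\<^sub>N n x \<le> \<psi> x"
proof -
  show "real m \<le> \<psi> x" "\<psi> x \<le> real m + 1"
    using \<psi>_eq[OF m, of m] \<psi>\<^sub>N_ge[OF levelD(1)[OF m]] \<psi>\<^sub>N_le[of m x] by auto
  show "\<psi>\<^sub>N n x \<le> \<psi> x"
    using \<psi>_eq[OF m, of "max n m"] \<psi>\<^sub>N_mono[of n "max n m" x] by simp
qed

text \<open>At levels up to \<open>N\<close> the stage is exact. At a deeper level \<open>m\<close>
  the terms between \<open>N\<close> and \<open>m\<close> are missing. If \<open>p\<close> exceeds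
  \<open>\<psi> x\<close>, they are bounded below by a small tail of \<open>\<kappa>\<close>, so
  dropping them costs little. Otherwise they can be very negative, and \<open>P\<^sub>N\<close> is
  bounded outright at the expense of \<open>tail_bound\<close>.\<close>

lemma key_inequality:
  assumes x: "x \<notin> E"
  shows "P\<^sub>N N x y p + excess x p \<le> (1 + (1/2) ^ N) * L x y p + (1/2) ^ N * (1 + M) + tail_bound N x"
proof -
  obtain m where m: "level x m" using level_exists[OF x] by blast
  note lev = \<psi>_nonneg_level[OF m]
  have \<psi>0: "0 \<le> \<psi> x" using lev(1) by linarith
  have tb: "0 \<le> tail_bound N x"
    using C_ge M_nonneg \<psi>0 sum_B_nonneg[of N] by (simp add: tail_bound_def)
  have pL: "\<bar>p\<bar> \<le> L x y p + M" using \<omega>_growth[of p] L_ge_\<omega>[of p x y] by linarith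
  have extra: "0 \<le> (1/2) ^ N * L x y p + (1/2) ^ N * (1 + M)" using L_nonneg[of x y p] M_nonneg by simp
  have RHS: "(1 + (1/2) ^ N) * L x y p = L x y p + (1/2) ^ N * L x y p" by (simp add: distrib_right)
  show ?thesis
  proof (cases "m \<le> N")
    case True
    have "P\<^sub>N N x y p = P\<^sub>N m x y p" using m True by (rule stationary_level)
    then show ?thesis using calibration_excess[OF m, of y p] tb extra unfolding RHS by linarith
  next
    case False
    show ?thesis
    proof (cases "\<psi> x < p")
      case True
      have split: "P\<^sub>N m x y p = P\<^sub>N N x y p + (\<Sum>n\<in>{N<..m}. t n x y p)"
        unfolding P\<^sub>N_def using False by (subst add.assoc, subst sum.union_disjoint[symmetric]) (auto intro!: sum.cong)
      have "(\<Sum>n\<in>{N<..m}. - (\<kappa> n * (1 + \<bar>p\<bar>))) \<le> (\<Sum>n\<in>{N<..m}. t n x y p)"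
      proof (rule sum_mono)
        fix n
        have "\<psi>\<^sub>N n x \<le> p" using lev(3)[of n] True by linarith
        then show "- (\<kappa> n * (1 + \<bar>p\<bar>)) \<le> t n x y p" by (rule t_bounds_above)
      qed
      moreover have "(\<Sum>n\<in>{N<..m}. \<kappa> n) * (1 + \<bar>p\<bar>) \<le> (1/2) ^ N * (1 + (L x y p + M))"
        using pL by (intro mult_mono sum_\<kappa>_tail) auto
      moreover have "(\<Sum>n\<in>{N<..m}. - (\<kappa> n * (1 + \<bar>p\<bar>))) = - ((\<Sum>n\<in>{N<..m}. \<kappa> n) * (1 + \<bar>p\<bar>))"
        by (simp only: sum_negf sum_distrib_right)
      moreover have "(1/2) ^ N * (1 + (L x y p + M)) = (1/2) ^ N * L x y p + (1/2) ^ N * (1 + M)"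
        by (simp add: algebra_simps)
      ultimately show ?thesis
        using split calibration_excess[OF m, of y p] tb unfolding RHS by linarith
    next
      case p: False
      have "\<beta> (Suc N) x \<noteq> 0" using levelD(1)[OF m] False \<beta>_zero_up[of "Suc N" x m] by auto
      then have tb': "tail_bound N x = C + 2 + M + \<psi> x * (\<Sum>k\<le>N. B k)" by (simp add: tail_bound_def)
      have "t n x y p \<le> \<kappa> n * (2 + \<bar>p\<bar>) + B n * \<psi> x" for n
      proof (cases "p \<le> \<psi>\<^sub>N n x")
        case True
        have "0 \<le> B n * \<psi> x" using B_ge(1)[of n] \<psi>0 by simp
        then show ?thesis using t_le_below[of p n x y] True by linarith
      next
        case False
        have "B n * (p - \<psi>\<^sub>N n x) \<le> B n * \<psi> x"
          using B_ge(1)[of n] \<psi>\<^sub>N_nonneg[of n x] p by (intro mult_left_mono) auto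
        moreover have "\<kappa> n * 1 \<le> \<kappa> n * (2 + \<bar>p\<bar>)" by (intro mult_left_mono) auto
        ultimately show ?thesis using t_bounds_above(2)[of n x p y] False by linarith
      qed
      then have "(\<Sum>n\<le>N. t n x y p) \<le> (\<Sum>n\<le>N. \<kappa> n * (2 + \<bar>p\<bar>) + B n * \<psi> x)" by (intro sum_mono)
      also have "\<dots> = (\<Sum>n\<le>N. \<kappa> n) * (2 + \<bar>p\<bar>) + \<psi> x * (\<Sum>n\<le>N. B n)"
        by (simp add: sum.distrib sum_distrib_right sum_distrib_left mult.commute)
      also have "(\<Sum>n\<le>N. \<kappa> n) * (2 + \<bar>p\<bar>) \<le> 1/2 * (2 + \<bar>p\<bar>)"
        by (intro mult_right_mono sum_\<kappa>_le) simp
      finally have "P\<^sub>N N x y p \<le> C + (2 + \<bar>p\<bar>) / 2 + \<psi> x * (\<Sum>n\<le>N. B n)" by (simp add: P\<^sub>N_def)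
      then have "P\<^sub>N N x y p \<le> C + 1 + \<bar>p\<bar> / 2 + \<psi> x * (\<Sum>n\<le>N. B n)" by argo
      moreover have "excess x p = 0" using p by (simp add: excess_def)
      ultimately show ?thesis using pL tb' extra unfolding RHS by linarith
    qed
  qed
qed

text \<open>On the graph every active tube function is exact, so \<open>r\<^sub>N\<close> is
  \<open>\<psi>\<close> and each term is nonnegative up to its budget. The term of index
  \<open>m - 2\<close> alone is about \<open>B (m - 2)\<close> or more and lifts
  \<open>s\<^sub>N\<close> to at least 1, where \<open>T s = s\<close>.\<close>

lemma graph_equality:
  assumes m: "level x m"
  shows "L x (u x) (\<psi> x) = P\<^sub>N m x (u x) (\<psi> x)"
proof -
  note lev = \<psi>_nonneg_level[OF m]
  have \<psi>m: "\<psi>\<^sub>N m x = \<psi> x" using \<psi>_eq[OF m, of m] by simp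
  have z: "\<bar>u x - u\<^sub>N n x\<bar> \<le> e n" for n using u_diff[of x n] e_pos[of n] by auto
  have r: "r\<^sub>N m x (u x) = \<psi> x"
    unfolding r\<^sub>N_def \<psi>m[symmetric] \<psi>\<^sub>N_def using \<rho>_in[OF z] by simp
  have tn: "t n x (u x) (\<psi> x) \<ge> B n * \<beta> n x * (\<psi> x - \<psi>\<^sub>N n x) - \<kappa> n" for n
    using t_drift(2)[of n x "u x - u\<^sub>N n x"] \<Theta>'_in[OF z, of n] by (simp add: t_eq)
  have nn: "0 \<le> B n * \<beta> n x * (\<psi> x - \<psi>\<^sub>N n x)" for n
    using B_ge(1)[of n] \<beta>_nonneg[of n x] lev(3)[of n] by (intro mult_nonneg_nonneg) auto
  have "(\<Sum>n\<le>m. B n * \<beta> n x * (\<psi> x - \<psi>\<^sub>N n x) - \<kappa> n) \<le> (\<Sum>n\<le>m. t n x (u x) (\<psi> x))"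
    by (intro sum_mono tn)
  then have sum1: "(\<Sum>n\<le>m. B n * \<beta> n x * (\<psi> x - \<psi>\<^sub>N n x)) - 1/2 \<le> (\<Sum>n\<le>m. t n x (u x) (\<psi> x))"
    using zero_le_power[of "1/2::real" "m + 2"] by (simp only: sum_subtractf sum_\<kappa>) linarith
  have "\<omega> (\<psi> x) + 1 \<le> P\<^sub>N m x (u x) (\<psi> x)"
  proof (cases "m \<le> 1")
    case True
    have "\<omega> (\<psi> x) \<le> \<omega> 2" using lev True by (intro \<omega>_mono) auto
    moreover have "0 \<le> (\<Sum>n\<le>m. B n * \<beta> n x * (\<psi> x - \<psi>\<^sub>N n x))" by (intro sum_nonneg nn)
    ultimately show ?thesis using sum1 by (simp add: P\<^sub>N_def C_def)
  next
    case False
    \<comment> \<open>Index \<open>m - 1\<close> would not do: there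
      \<open>\<psi>\<^sub>N (m - 1) x\<close> equals \<open>m\<close>, which \<open>\<psi> x\<close>
      may exceed by arbitrarily little.\<close>
    then obtain j where j: "m = j + 2" by (metis add.commute le_add_diff_inverse nat_le_linear not_less_eq_eq numeral_2_eq_2 One_nat_def)
    have \<beta>j: "\<beta> i x = 1" if "i \<le> j" for i using \<beta>_chain[OF levelD(1)[OF m], of i] that j by simp
    have "\<psi>\<^sub>N j x = real j + 1" using \<beta>j by (simp add: \<psi>\<^sub>N_def)
    then have "B j * 1 \<le> B j * (\<psi> x - \<psi>\<^sub>N j x)"
      using lev(1) j B_ge(1)[of j] by (intro mult_left_mono) auto
    also have "\<dots> = B j * \<beta> j x * (\<psi> x - \<psi>\<^sub>N j x)" using \<beta>j[of j] by simp
    also have "\<dots> \<le> (\<Sum>n\<le>m. B n * \<beta> n x * (\<psi> x - \<psi>\<^sub>N n x))"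
      using nn j by (intro member_le_sum) auto
    finally have "B j \<le> (\<Sum>n\<le>m. B n * \<beta> n x * (\<psi> x - \<psi>\<^sub>N n x))" by simp
    moreover have "\<omega> (\<psi> x) \<le> \<omega> (real j + 3)" using lev j by (intro \<omega>_mono) auto
    ultimately show ?thesis using sum1 B_ge(2)[of j] C_ge by (simp add: P\<^sub>N_def)
  qed
  then have "1 \<le> s\<^sub>N m x (u x) (\<psi> x)" by (simp add: s\<^sub>N_def r)
  then show ?thesis using calibration(2)[OF m, of "u x" "\<psi> x"] T(5)[of "s\<^sub>N m x (u x) (\<psi> x)"]
    by (simp add: L_def s\<^sub>N_def r)
qed

lemma sum_t_abs_le:
  assumes m: "level x m" and p: "0 \<le> p" "p \<le> \<psi> x + 1" and N: "N \<le> m"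
  shows "\<bar>\<Sum>n\<le>N. t n x y p\<bar> \<le> 1/2 + (\<Sum>k\<le>m. B k) * (real m + 2)"
proof -
  note lev = \<psi>_nonneg_level[OF m]
  have "\<bar>\<Sum>n\<le>N. t n x y p\<bar> \<le> (\<Sum>n\<le>N. \<bar>t n x y p\<bar>)" by (rule sum_abs)
  also have "\<dots> \<le> (\<Sum>n\<le>N. \<kappa> n + B n * (real m + 2))"
  proof (rule sum_mono)
    fix n
    have "B n * \<bar>p - \<psi>\<^sub>N n x\<bar> \<le> B n * (real m + 2)"
      using B_ge(1)[of n] \<psi>\<^sub>N_nonneg[of n x] lev(2) lev(3)[of n] p by (intro mult_left_mono) auto
    then show "\<bar>t n x y p\<bar> \<le> \<kappa> n + B n * (real m + 2)" using t_abs_le[of n x y p] by linarith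
  qed
  also have "\<dots> \<le> (\<Sum>n\<le>m. \<kappa> n + B n * (real m + 2))"
    using N B_ge(1) by (intro sum_mono2) (auto intro!: add_nonneg_nonneg mult_nonneg_nonneg intro: order_trans[of 0 3])
  also have "\<dots> = (\<Sum>n\<le>m. \<kappa> n) + (\<Sum>n\<le>m. B n) * (real m + 2)" by (simp only: sum.distrib sum_distrib_right)
  also have "(\<Sum>n\<le>m. \<kappa> n) \<le> 1/2" by (rule sum_\<kappa>_le)
  finally show ?thesis by simp
qed

lemma L_le_bb:
  assumes m: "level x m" and p: "0 \<le> p" "p \<le> \<psi> x + 1"
  shows "L x y p \<le> bb m"
proof -
  note lev = \<psi>_nonneg_level[OF m]
  let ?r = "r\<^sub>N m x y"
  have r: "0 \<le> ?r" "?r \<le> real m + 1" using r\<^sub>N_nonneg[of m x y] r\<^sub>N_le_\<psi>\<^sub>N[of m x y] \<psi>\<^sub>N_le[of m x] by auto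
  have "\<omega>' ?r * (?r - p) \<le> \<omega>' ?r * (real m + 1)" using r p by (intro mult_left_mono \<omega>'_nonneg) auto
  also have "\<dots> \<le> \<omega>' (real m + 1) * (real m + 1)" using r by (intro mult_right_mono \<omega>'_mono) auto
  finally have 1: "\<omega>' ?r * (?r - p) \<le> \<omega>' (real m + 1) * (real m + 1)" .
  have 2: "(\<Sum>n\<le>m. t n x y p) \<le> 1/2 + (\<Sum>k\<le>m. B k) * (real m + 2)"
    using sum_t_abs_le[OF m p order_refl, of y] by linarith
  have nn: "0 \<le> (\<Sum>k\<le>m. B k) * (real m + 2)" "0 \<le> \<omega>' (real m + 1) * (real m + 1)"
    using sum_B_nonneg[of m] \<omega>'_nonneg[of "real m + 1"] by auto
  have "max (s\<^sub>N m x y p) 0 \<le> C + 1/2 + (\<Sum>k\<le>m. B k) * (real m + 2) + \<omega>' (real m + 1) * (real m + 1)"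
    using 1 2 nn \<omega>_nonneg[of ?r] C_ge by (simp add: s\<^sub>N_def P\<^sub>N_def)
  moreover have "\<omega> p \<le> \<omega> (real m + 2)" using p lev by (intro \<omega>_mono) auto
  ultimately show ?thesis
    using T(7)[of "s\<^sub>N m x y p"] calibration(2)[OF m, of y p] M_nonneg unfolding L_def bb_def by linarith
qed

lemma P\<^sub>N_abs_le_bb:
  assumes m: "level x m"
  shows "\<bar>P\<^sub>N N x y (\<psi> x)\<bar> \<le> bb m"
proof -
  note lev = \<psi>_nonneg_level[OF m]
  have "P\<^sub>N N x y (\<psi> x) = P\<^sub>N (min N m) x y (\<psi> x)"
  proof (cases "m \<le> N")
    case True
    from stationary_level(1)[OF m this] show ?thesis using True by (simp add: min.absorb2)
  qed (simp add: min.absorb1)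
  moreover have "\<bar>\<Sum>n\<le>min N m. t n x y (\<psi> x)\<bar> \<le> 1/2 + (\<Sum>k\<le>m. B k) * (real m + 2)"
    using lev(1) by (intro sum_t_abs_le m) auto
  moreover have "0 \<le> \<omega>' (real m + 1) * (real m + 1)" using \<omega>'_nonneg[of "real m + 1"] by simp
  ultimately show ?thesis
    using C_ge M_nonneg \<omega>_nonneg[of "real m + 2"] unfolding P\<^sub>N_def bb_def by linarith
qed

lemma tail_bound_le_bb:
  assumes m: "level x m"
  shows "0 \<le> tail_bound N x" "tail_bound N x \<le> bb m" "m \<le> N \<Longrightarrow> tail_bound N x = 0"
proof -
  note lev = \<psi>_nonneg_level[OF m]
  have \<psi>0: "0 \<le> \<psi> x" using lev(1) by linarith
  show "0 \<le> tail_bound N x"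
    using C_ge M_nonneg \<psi>0 sum_B_nonneg[of N] by (simp add: tail_bound_def)
  show "m \<le> N \<Longrightarrow> tail_bound N x = 0" using levelD(2)[OF m, of "Suc N"] by (simp add: tail_bound_def)
  show "tail_bound N x \<le> bb m"
  proof (cases "m \<le> N")
    case True
    then show ?thesis using levelD(2)[OF m, of "Suc N"] bb_ge[of m] by (simp add: tail_bound_def)
  next
    case False
    have "(\<Sum>k\<le>N. B k) \<le> (\<Sum>k\<le>m. B k)"
      using False B_ge(1) by (intro sum_mono2) (auto intro: order_trans[of 0 3])
    then have "\<psi> x * (\<Sum>k\<le>N. B k) \<le> (real m + 2) * (\<Sum>k\<le>m. B k)"
      using lev \<psi>0 sum_B_nonneg[of N] by (intro mult_mono) auto
    moreover have "0 \<le> \<omega>' (real m + 1) * (real m + 1)" using \<omega>'_nonneg[of "real m + 1"] by simp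
    moreover have "0 \<le> (real m + 2) * (\<Sum>k\<le>m. B k)" using sum_B_nonneg[of m] by simp
    ultimately show ?thesis
      using C_ge M_nonneg \<omega>_nonneg[of "real m + 2"] unfolding tail_bound_def bb_def by (simp add: mult.commute)
  qed
qed

end

section \<open>The minimizer\<close>

lemma borel_measurable_lebesgue_on: "f \<in> borel_measurable borel \<Longrightarrow> f \<in> borel_measurable (lebesgue_on S)"
  for f :: "real \<Rightarrow> 'b::topological_space"
  by (intro measurable_restrict_space1 measurable_completion) simp

lemma negligible_AE_lebesgue_on:
  assumes "negligible N" "\<And>x. x \<in> {a..b::real} - N \<Longrightarrow> P x"
  shows "AE x in lebesgue_on {a..b}. P x"
proof -
  have "AE x in lebesgue. x \<notin> N" using assms(1) by (simp add: negligible_iff_null_sets AE_not_in)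
  then show ?thesis using assms(2) by (subst AE_restrict_space_iff) (auto elim!: eventually_mono)
qed

text \<open>A Borel substitute for \<open>deriv v\<close>: the limit of difference quotients of a
  continuous extension \<open>v0\<close>, taken along one fixed null sequence. It makes the
  integrand of the functional measurable although \<open>v\<close> is arbitrary outside the
  interval.\<close>

lemma absolutely_continuous_on_derivative:
  fixes v :: "real \<Rightarrow> real"
  assumes ac: "absolutely_continuous_on a b v" and ab: "a < b"
  shows "\<exists>v0 p N. continuous_on UNIV v0 \<and> (\<forall>x\<in>{a..b}. v0 x = v x) \<and> p \<in> borel_measurable borel \<and>
    negligible N \<and> (\<forall>x\<in>{a..b} - N. (v has_real_derivative p x) (at x))"
proof -
  obtain N0 where N0: "negligible N0" "\<And>x. x \<in> {a..b} - N0 \<Longrightarrow> v differentiable (at x)"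
    using absolutely_continuous_on_differentiable_ae[OF ac] by metis
  define v0 where "v0 x = v (max a (min b x))" for x
  have c0: "continuous_on UNIV v0"
    unfolding v0_def using ab absolutely_continuous_on_imp_continuous_on[OF ac]
    by (intro continuous_on_compose2[of "{a..b}" v UNIV "\<lambda>x. max a (min b x)"] continuous_intros) auto
  define h where "h n = 1 / (real n + 1)" for n :: nat
  have h: "h n \<noteq> 0" for n by (simp add: h_def)
  have h0: "filterlim h (at 0) sequentially"
  proof (rule filterlim_atI)
    show "h \<longlonglongrightarrow> 0" unfolding h_def using LIMSEQ_inverse_real_of_nat by (simp add: inverse_eq_divide add.commute)
  qed (simp add: h)
  define p where "p x = lim (\<lambda>n. (v0 (x + h n) - v0 x) / h n)" for x
  have pm: "p \<in> borel_measurable borel"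
    unfolding p_def
  proof (rule borel_measurable_lim_metric)
    fix n
    have "continuous_on UNIV (\<lambda>x. (v0 (x + h n) - v0 x) / h n)"
      using h[of n] by (intro continuous_intros continuous_on_compose2[OF c0] c0) auto
    then show "(\<lambda>x. (v0 (x + h n) - v0 x) / h n) \<in> borel_measurable borel"
      by (rule borel_measurable_continuous_onI)
  qed
  \<comment> \<open>At \<open>a\<close> and \<open>b\<close> the extension need not follow
    \<open>v\<close> on both sides.\<close>
  have pd: "(v has_real_derivative p x) (at x)" if x: "x \<in> {a..b} - (N0 \<union> {a, b})" for x
  proof -
    have "x \<in> {a..b} - N0" using x by blast
    from N0(2)[OF this] obtain D where D: "(v has_real_derivative D) (at x)" by (auto simp: real_differentiable_def)
    have "(v0 has_real_derivative D) (at x)"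
      by (rule has_field_derivative_transform_within_open[OF D, where S = "{a<..<b}"])
        (use x in \<open>auto simp: v0_def\<close>)
    then have "(\<lambda>k. (v0 (x + k) - v0 x) / k) \<midarrow>0\<rightarrow> D" by (simp add: DERIV_def)
    from filterlim_compose[OF this h0] have "p x = D" unfolding p_def by (rule limI)
    then show ?thesis using D by simp
  qed
  have "negligible (N0 \<union> {a, b})" using N0(1) by auto
  moreover have "\<forall>x\<in>{a..b}. v0 x = v x" by (auto simp: v0_def)
  ultimately show ?thesis using c0 pm pd by blast
qed

text \<open>The gauge form of the fundamental theorem integrates \<open>G'\<close> without Lebesgue
  integrability, so a one-sided bound by an integrable \<open>h\<close> suffices.\<close>

lemma absolutely_continuous_on_increment_le:
  fixes G G' h :: "real \<Rightarrow> real"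
  assumes G: "absolutely_continuous_on a b G" and ab: "a \<le> b" and N: "negligible N"
    and der: "\<And>x. x \<in> {a..b} - N \<Longrightarrow> (G has_real_derivative G' x) (at x)"
    and h: "integrable (lebesgue_on {a..b}) h" and le: "\<And>x. x \<in> {a..b} - N \<Longrightarrow> G' x \<le> h x"
  shows "G b - G a \<le> integral\<^sup>L (lebesgue_on {a..b}) h"
proof -
  have "(G' has_integral (G b - G a)) {a..b}"
    by (rule absolutely_continuous_on_fundamental_theorem[OF G ab N]) (rule has_field_derivative_at_within[OF der])
  moreover have "(h has_integral integral\<^sup>L (lebesgue_on {a..b}) h) {a..b}"
    using h by (rule has_integral_integral_lebesgue_on) simp
  then have "((\<lambda>x. if x \<in> N then G' x else h x) has_integral integral\<^sup>L (lebesgue_on {a..b}) h) {a..b}"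
    by (rule has_integral_spike[OF N, rotated]) simp
  ultimately show ?thesis by (rule has_integral_le) (use le in auto)
qed

lemma absolutely_continuous_on_increment_eq:
  fixes G G' :: "real \<Rightarrow> real"
  assumes G: "absolutely_continuous_on a b G" and ab: "a \<le> b" and N: "negligible N"
    and der: "\<And>x. x \<in> {a..b} - N \<Longrightarrow> (G has_real_derivative G' x) (at x)"
    and h: "integrable (lebesgue_on {a..b}) G'"
  shows "G b - G a = integral\<^sup>L (lebesgue_on {a..b}) G'"
proof -
  have "(G' has_integral (G b - G a)) {a..b}"
    by (rule absolutely_continuous_on_fundamental_theorem[OF G ab N]) (rule has_field_derivative_at_within[OF der])
  moreover have "(G' has_integral integral\<^sup>L (lebesgue_on {a..b}) G') {a..b}"
    using h by (rule has_integral_integral_lebesgue_on) simp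
  ultimately show ?thesis by (rule has_integral_unique)
qed

lemma absolutely_continuous_on_subinterval:
  assumes "absolutely_continuous_on a b f" "a \<le> c" "d \<le> b"
  shows "absolutely_continuous_on c d f"
  unfolding absolutely_continuous_on_def
proof (intro allI impI)
  fix \<epsilon> :: real assume \<epsilon>: "\<epsilon> > 0"
  obtain \<delta> where \<delta>: "\<delta> > 0" and D: "\<forall>(n::nat) s t. (\<forall>i<n. a \<le> s i \<and> s i \<le> t i \<and> t i \<le> b) \<and>
        (\<forall>i<n. \<forall>j<n. i \<noteq> j \<longrightarrow> t i \<le> s j \<or> t j \<le> s i) \<and> (\<Sum>i<n. t i - s i) < \<delta> \<longrightarrow>
        (\<Sum>i<n. \<bar>f (t i) - f (s i)\<bar>) < \<epsilon>"
    using absolutely_continuous_onD[OF assms(1) \<epsilon>] by (elim exE conjE)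
  have "(\<Sum>i<n. \<bar>f (t i) - f (s i)\<bar>) < \<epsilon>"
    if h: "(\<forall>i<n. c \<le> s i \<and> s i \<le> t i \<and> t i \<le> d) \<and>
      (\<forall>i<n. \<forall>j<n. i \<noteq> j \<longrightarrow> t i \<le> s j \<or> t j \<le> s i) \<and> (\<Sum>i<n. t i - s i) < \<delta>" for n :: nat and s t
  proof (rule D[rule_format], intro conjI)
    show "\<forall>i<n. a \<le> s i \<and> s i \<le> t i \<and> t i \<le> b" using h assms(2,3) by (meson order_trans)
  qed (use h in blast)+
  then show "\<exists>\<delta>>0. \<forall>(n::nat) s t. (\<forall>i<n. c \<le> s i \<and> s i \<le> t i \<and> t i \<le> d) \<and>
        (\<forall>i<n. \<forall>j<n. i \<noteq> j \<longrightarrow> t i \<le> s j \<or> t j \<le> s i) \<and> (\<Sum>i<n. t i - s i) < \<delta> \<longrightarrow>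
        (\<Sum>i<n. \<bar>f (t i) - f (s i)\<bar>) < \<epsilon>"
    using \<delta> by (intro exI[of _ \<delta>]) blast
qed

text \<open>Remove an interval with the largest left end: the others end before it starts. If it is
  degenerate it is merely dropped, since another interval may start at the same point.\<close>

lemma mono_sum_increments_le:
  fixes R :: "real \<Rightarrow> real"
  assumes "finite I" "mono R" "a \<le> b" "\<And>i. i \<in> I \<Longrightarrow> a \<le> s i \<and> s i \<le> t i \<and> t i \<le> b"
    and "\<And>i j. i \<in> I \<Longrightarrow> j \<in> I \<Longrightarrow> i \<noteq> j \<Longrightarrow> t i \<le> s j \<or> t j \<le> s i"
  shows "(\<Sum>i\<in>I. R (t i) - R (s i)) \<le> R b - R a"
  using assms(1,3-5)
proof (induction I arbitrary: b rule: finite_psubset_induct)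
  case (psubset I)
  show ?case
  proof (cases "I = {}")
    case True
    then show ?thesis using monoD[OF assms(2) psubset.prems(1)] by simp
  next
    case False
    define M where "M = Max (s ` I)"
    have "M \<in> s ` I" unfolding M_def using psubset.hyps False by (intro Max_in) auto
    then obtain i where i: "i \<in> I" "s i = M" by auto
    have Mge: "s j \<le> s i" if "j \<in> I" for j unfolding i M_def using psubset.hyps that by (intro Max_ge) auto
    have split: "(\<Sum>j\<in>I. R (t j) - R (s j)) = (R (t i) - R (s i)) + (\<Sum>j\<in>I - {i}. R (t j) - R (s j))"
      using psubset.hyps i(1) by (rule sum.remove)
    have sub: "I - {i} \<subset> I" using i by blast
    have ti: "a \<le> s i" "s i \<le> t i" "t i \<le> b" using psubset.prems(2)[OF i(1)] by auto
    show ?thesis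
    proof (cases "s i = t i")
      case True
      have "(\<Sum>j\<in>I - {i}. R (t j) - R (s j)) \<le> R b - R a"
        by (rule psubset.IH[OF sub psubset.prems(1)]) (use psubset.prems in auto)
      then show ?thesis using split True by simp
    next
      case False
      have "t j \<le> s i" if "j \<in> I - {i}" for j
        using psubset.prems(3)[of j i] Mge[of j] that i(1) ti(2) False by force
      then have "(\<Sum>j\<in>I - {i}. R (t j) - R (s j)) \<le> R (s i) - R a"
        by (intro psubset.IH[OF sub ti(1)]) (use psubset.prems in auto)
      then show ?thesis using split monoD[OF assms(2) ti(3)] by linarith
    qed
  qed
qed

lemma deriv_bounded_imp_Lipschitz:
  fixes f :: "real \<Rightarrow> real"
  assumes "\<And>x. (f has_real_derivative f' x) (at x)" "\<And>x. \<bar>f' x\<bar> \<le> D"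
  shows "\<bar>f t - f s\<bar> \<le> D * \<bar>t - s\<bar>"
proof -
  have "norm (f t - f s) \<le> D * norm (t - s)"
    by (rule field_differentiable_bound[of UNIV f f']) (use assms in auto)
  then show ?thesis by simp
qed

section \<open>The potential along a curve\<close>

context singular_construction
begin

abbreviation "\<mu> \<equiv> lebesgue_on {a..b}"

text \<open>\<open>Phi_N\<close> of the overview along the curve \<open>v\<close>. Its increment
  over the interval depends on the end values of \<open>v\<close> alone.\<close>

definition "F N v x = C * x + (\<Sum>n\<le>N. B n * (\<beta> n x * \<Theta> n (v x - u\<^sub>N n x)))"

lemma F_deriv:
  assumes "(v has_real_derivative p) (at x)"
  shows "(F N v has_real_derivative P\<^sub>N N x (v x) p) (at x)"
proof -
  have "((\<lambda>x. B n * (\<beta> n x * \<Theta> n (v x - u\<^sub>N n x))) has_real_derivative t n x (v x) p) (at x)" for n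
  proof -
    have "((\<lambda>x. v x - u\<^sub>N n x) has_real_derivative (p - \<psi>\<^sub>N n x)) (at x)"
      using assms Du\<^sub>N by (rule DERIV_diff)
    from DERIV_chain2[OF D\<Theta> this]
    have "((\<lambda>x. \<Theta> n (v x - u\<^sub>N n x)) has_real_derivative \<Theta>' n (v x - u\<^sub>N n x) * (p - \<psi>\<^sub>N n x)) (at x)" .
    from DERIV_cmult[OF DERIV_mult[OF D\<beta> this], of "B n"] show ?thesis
      by (simp add: t_def algebra_simps)
  qed
  then have "((\<lambda>x. C * x + (\<Sum>n\<le>N. B n * (\<beta> n x * \<Theta> n (v x - u\<^sub>N n x)))) has_real_derivative C * 1 + (\<Sum>n\<le>N. t n x (v x) p)) (at x)"
    by (intro DERIV_add DERIV_cmult DERIV_ident DERIV_sum)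
  then show ?thesis by (simp add: F_def[abs_def] P\<^sub>N_def)
qed

lemma u\<^sub>N_Lipschitz: "\<bar>u\<^sub>N n y - u\<^sub>N n x\<bar> \<le> (real n + 1) * \<bar>y - x\<bar>"
  by (rule deriv_bounded_imp_Lipschitz[OF Du\<^sub>N]) (use \<psi>\<^sub>N_nonneg \<psi>\<^sub>N_le in \<open>simp add: abs_of_nonneg\<close>)

lemma \<Theta>_Lipschitz: "\<bar>\<Theta> n z - \<Theta> n w\<bar> \<le> 1 * \<bar>z - w\<bar>"
proof (rule deriv_bounded_imp_Lipschitz[OF D\<Theta>])
  show "\<bar>\<Theta>' n x\<bar> \<le> 1" for x
    using \<Theta>'_ge[of n x] \<Theta>'_le[of n x] \<delta>_le_1[of n] by (simp add: abs_le_iff)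
qed

lemma F_AC:
  assumes v: "absolutely_continuous_on a b v"
  shows "absolutely_continuous_on a b (F N v)"
proof -
  obtain D where D: "\<And>n x. \<bar>\<beta>' n x\<bar> \<le> D n" using \<beta>'_bounded by metis
  have D0: "0 \<le> D n" for n using D[of n 0] by linarith
  define K where "K = \<bar>C\<bar> + (\<Sum>n\<le>N. B n * (D n + real n + 2))"
  have B0: "0 \<le> B n" for n using B_ge(1)[of n] by linarith
  have K0: "0 \<le> K" unfolding K_def using B0 D0 by (intro add_nonneg_nonneg sum_nonneg mult_nonneg_nonneg) auto
  show ?thesis
  proof (rule absolutely_continuous_on_Lipschitz_comparison[OF v K0])
    fix s t' :: real
    let ?d = "\<bar>t' - s\<bar> + \<bar>v t' - v s\<bar>"
    have term_le: "\<bar>B n * (\<beta> n t' * \<Theta> n (v t' - u\<^sub>N n t')) - B n * (\<beta> n s * \<Theta> n (v s - u\<^sub>N n s))\<bar>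
        \<le> B n * (D n + real n + 2) * ?d" for n
    proof -
      let ?z = "v t' - u\<^sub>N n t'" and ?w = "v s - u\<^sub>N n s"
      have "\<bar>(\<beta> n t' - \<beta> n s) * \<Theta> n ?z\<bar> \<le> (D n * \<bar>t' - s\<bar>) * 1"
        unfolding abs_mult using deriv_bounded_imp_Lipschitz[OF D\<beta> D, of n t' s] \<Theta>_bounded[of n ?z] D0[of n]
        by (intro mult_mono) auto
      moreover have "\<bar>\<beta> n s * (\<Theta> n ?z - \<Theta> n ?w)\<bar> \<le> 1 * \<bar>?z - ?w\<bar>"
        unfolding abs_mult using \<Theta>_Lipschitz[of n ?z ?w] \<beta>_nonneg[of n s] \<beta>_le_1[of n s] by (intro mult_mono) auto
      moreover have "\<bar>?z - ?w\<bar> \<le> \<bar>v t' - v s\<bar> + (real n + 1) * \<bar>t' - s\<bar>"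
        using u\<^sub>N_Lipschitz[of n t' s] by linarith
      moreover have "\<beta> n t' * \<Theta> n ?z - \<beta> n s * \<Theta> n ?w = (\<beta> n t' - \<beta> n s) * \<Theta> n ?z + \<beta> n s * (\<Theta> n ?z - \<Theta> n ?w)"
        by (simp add: algebra_simps)
      then have "\<bar>\<beta> n t' * \<Theta> n ?z - \<beta> n s * \<Theta> n ?w\<bar> \<le> \<bar>(\<beta> n t' - \<beta> n s) * \<Theta> n ?z\<bar> + \<bar>\<beta> n s * (\<Theta> n ?z - \<Theta> n ?w)\<bar>"
        by (simp only: abs_triangle_ineq)
      ultimately have "\<bar>\<beta> n t' * \<Theta> n ?z - \<beta> n s * \<Theta> n ?w\<bar> \<le> D n * \<bar>t' - s\<bar> + \<bar>v t' - v s\<bar> + (real n + 1) * \<bar>t' - s\<bar>"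
        by linarith
      also have "\<dots> = (D n + real n + 1) * \<bar>t' - s\<bar> + \<bar>v t' - v s\<bar>" by (simp add: algebra_simps)
      also have "\<dots> \<le> (D n + real n + 2) * \<bar>t' - s\<bar> + (D n + real n + 2) * \<bar>v t' - v s\<bar>"
        using D0[of n] mult_right_mono[of 1 "D n + real n + 2" "\<bar>v t' - v s\<bar>"]
        by (intro add_mono mult_right_mono) auto
      also have "\<dots> = (D n + real n + 2) * ?d" by (simp add: algebra_simps)
      finally have "B n * \<bar>\<beta> n t' * \<Theta> n ?z - \<beta> n s * \<Theta> n ?w\<bar> \<le> B n * ((D n + real n + 2) * ?d)"
        by (rule mult_left_mono[OF _ B0])
      moreover have "\<bar>B n * (\<beta> n t' * \<Theta> n ?z) - B n * (\<beta> n s * \<Theta> n ?w)\<bar> = B n * \<bar>\<beta> n t' * \<Theta> n ?z - \<beta> n s * \<Theta> n ?w\<bar>"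
        using B0[of n] by (simp add: right_diff_distrib[symmetric] abs_mult)
      ultimately show ?thesis by (simp add: mult.assoc)
    qed
    have "\<bar>F N v t' - F N v s\<bar> \<le> \<bar>C * t' - C * s\<bar> +
        \<bar>(\<Sum>n\<le>N. B n * (\<beta> n t' * \<Theta> n (v t' - u\<^sub>N n t'))) - (\<Sum>n\<le>N. B n * (\<beta> n s * \<Theta> n (v s - u\<^sub>N n s)))\<bar>"
      unfolding F_def by linarith
    also have "\<bar>C * t' - C * s\<bar> \<le> \<bar>C\<bar> * ?d"
      by (simp add: right_diff_distrib[symmetric] abs_mult mult_left_mono)
    also have "\<bar>(\<Sum>n\<le>N. B n * (\<beta> n t' * \<Theta> n (v t' - u\<^sub>N n t'))) - (\<Sum>n\<le>N. B n * (\<beta> n s * \<Theta> n (v s - u\<^sub>N n s)))\<bar>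
        \<le> (\<Sum>n\<le>N. B n * (D n + real n + 2) * ?d)"
      unfolding sum_subtractf[symmetric] by (rule order_trans[OF sum_abs]) (intro sum_mono term_le)
    also have "\<bar>C\<bar> * ?d + (\<Sum>n\<le>N. B n * (D n + real n + 2) * ?d) = K * ?d"
      unfolding K_def by (simp only: sum_distrib_right[symmetric] distrib_right)
    finally show "\<bar>F N v t' - F N v s\<bar> \<le> K * ?d" by simp
  qed
qed

section \<open>Absolute continuity and singular set of \<open>u\<close>\<close>

lemma remainder_mono: "x \<le> y \<Longrightarrow> u x - u\<^sub>N n x \<le> u y - u\<^sub>N n y"
proof -
  assume xy: "x \<le> y"
  have Qm: "Q k x \<le> Q k y" for k
    using DQ \<beta>_nonneg xy by (intro DERIV_nonneg_imp_nondecreasing[of x y "Q k"]) blast+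
  have "u\<^sub>N m x - u\<^sub>N n x \<le> u\<^sub>N m y - u\<^sub>N n y" if "n \<le> m" for m
    using that
  proof (induction m rule: dec_induct)
    case (step m)
    then show ?case using Qm[of "Suc m"] by (simp add: u\<^sub>N_Suc)
  qed simp
  then have "\<exists>N. \<forall>m\<ge>N. u\<^sub>N m x - u\<^sub>N n x \<le> u\<^sub>N m y - u\<^sub>N n y" by blast
  then show ?thesis
    by (rule LIMSEQ_le[OF tendsto_diff[OF u\<^sub>N_tendsto tendsto_const] tendsto_diff[OF u\<^sub>N_tendsto tendsto_const]])
qed

text \<open>The partial sum \<open>u\<^sub>N n\<close> is Lipschitz, and the monotone remainder
  varies by at most \<open>e n / 2\<close> over the whole interval, whatever the family of
  subintervals.\<close>

lemma u_AC: "absolutely_continuous_on a b u"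
  unfolding absolutely_continuous_on_def
proof (intro allI impI)
  fix \<epsilon>0 :: real assume \<epsilon>0: "\<epsilon>0 > 0"
  have "\<forall>\<^sub>F n in sequentially. e n < \<epsilon>0" using order_tendstoD(2)[OF e_tendsto_0] \<epsilon>0 by simp
  then obtain n where n: "e n < \<epsilon>0" by (auto simp: eventually_sequentially)
  define d where "d = \<epsilon>0 / (2 * (real n + 1))"
  have d: "d > 0" using \<epsilon>0 by (simp add: d_def)
  have R: "mono (\<lambda>x. u x - u\<^sub>N n x)" by (intro monoI remainder_mono)
  have "(\<Sum>i<k. \<bar>u (t' i) - u (s i)\<bar>) < \<epsilon>0"
    if h: "(\<forall>i<k. a \<le> s i \<and> s i \<le> t' i \<and> t' i \<le> b) \<and>
      (\<forall>i<k. \<forall>j<k. i \<noteq> j \<longrightarrow> t' i \<le> s j \<or> t' j \<le> s i) \<and> (\<Sum>i<k. t' i - s i) < d" for k :: nat and s t'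
  proof -
    have "(\<Sum>i<k. \<bar>u (t' i) - u (s i)\<bar>) \<le>
      (\<Sum>i<k. (real n + 1) * (t' i - s i) + ((u (t' i) - u\<^sub>N n (t' i)) - (u (s i) - u\<^sub>N n (s i))))"
    proof (rule sum_mono)
      fix i assume "i \<in> {..<k}"
      then have st: "s i \<le> t' i" using h by simp
      have "\<bar>u\<^sub>N n (t' i) - u\<^sub>N n (s i)\<bar> \<le> (real n + 1) * (t' i - s i)"
        using u\<^sub>N_Lipschitz[of n "t' i" "s i"] st by simp
      moreover have "u (s i) - u\<^sub>N n (s i) \<le> u (t' i) - u\<^sub>N n (t' i)" using st by (rule remainder_mono)
      ultimately show "\<bar>u (t' i) - u (s i)\<bar> \<le> (real n + 1) * (t' i - s i) + ((u (t' i) - u\<^sub>N n (t' i)) - (u (s i) - u\<^sub>N n (s i)))"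
        by linarith
    qed
    also have "\<dots> = (real n + 1) * (\<Sum>i<k. t' i - s i) + (\<Sum>i<k. (u (t' i) - u\<^sub>N n (t' i)) - (u (s i) - u\<^sub>N n (s i)))"
      by (simp only: sum.distrib sum_distrib_left)
    also have "(\<Sum>i<k. (u (t' i) - u\<^sub>N n (t' i)) - (u (s i) - u\<^sub>N n (s i))) \<le> (u b - u\<^sub>N n b) - (u a - u\<^sub>N n a)"
      using h ab by (intro mono_sum_increments_le[OF _ R]) auto
    also have "\<dots> \<le> e n / 2" using u_diff[of b n] u_diff[of a n] by linarith
    also have "(real n + 1) * (\<Sum>i<k. t' i - s i) \<le> (real n + 1) * d" using h by (intro mult_left_mono) auto
    also have "(real n + 1) * d = \<epsilon>0 / 2" unfolding d_def by (simp add: field_simps)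
    finally show ?thesis using n by simp
  qed
  then show "\<exists>\<delta>>0. \<forall>(k::nat) s t. (\<forall>i<k. a \<le> s i \<and> s i \<le> t i \<and> t i \<le> b) \<and>
        (\<forall>i<k. \<forall>j<k. i \<noteq> j \<longrightarrow> t i \<le> s j \<or> t j \<le> s i) \<and> (\<Sum>i<k. t i - s i) < \<delta> \<longrightarrow>
        (\<Sum>i<k. \<bar>u (t i) - u (s i)\<bar>) < \<epsilon>0"
    using d by (intro exI[of _ d]) blast
qed

lemma u_deriv:
  assumes x: "x \<notin> E"
  shows "(u has_real_derivative \<psi> x) (at x)"
proof -
  obtain n d where d: "d > 0" and z: "\<forall>k\<ge>n. \<forall>y. \<bar>y - x\<bar> < d \<longrightarrow> \<beta> k y = 0"
    using \<beta>_eventually_zero[OF x] by (elim exE conjE)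
  have zx: "\<beta> k x = 0" if "n \<le> k" for k using z that d by auto
  have Qc: "Q k y = Q k x" if y: "\<bar>y - x\<bar> < d" and k: "n \<le> k" for k y
  proof -
    have "\<exists>c. \<forall>w\<in>ball x d. Q k w = c"
    proof (rule has_field_derivative_zero_constant)
      show "(Q k has_real_derivative 0) (at w within ball x d)" if "w \<in> ball x d" for w
        using has_field_derivative_at_within[OF DQ[of k w], of "ball x d"] z k that
        by (auto simp: dist_real_def abs_minus_commute)
    qed simp
    then show ?thesis using y d by (auto simp: dist_real_def abs_minus_commute)
  qed
  have uloc: "u y = u\<^sub>N n y + (u x - u\<^sub>N n x)" if y: "\<bar>y - x\<bar> < d" for y
  proof -
    have "u\<^sub>N m y - u\<^sub>N m x = u\<^sub>N n y - u\<^sub>N n x" if "n \<le> m" for m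
      using that
    proof (induction m rule: dec_induct)
      case (step m)
      then show ?case using Qc[OF y, of "Suc m"] by (simp add: u\<^sub>N_Suc)
    qed simp
    then have "\<forall>\<^sub>F m in sequentially. u\<^sub>N m y - u\<^sub>N m x = u\<^sub>N n y - u\<^sub>N n x"
      by (rule eventually_sequentiallyI)
    then have "(\<lambda>m. u\<^sub>N m y - u\<^sub>N m x) \<longlonglongrightarrow> u\<^sub>N n y - u\<^sub>N n x" by (rule tendsto_eventually)
    moreover have "(\<lambda>m. u\<^sub>N m y - u\<^sub>N m x) \<longlonglongrightarrow> u y - u x" by (intro tendsto_diff u\<^sub>N_tendsto)
    ultimately have "u y - u x = u\<^sub>N n y - u\<^sub>N n x" by (rule LIMSEQ_unique[rotated])
    then show ?thesis by linarith
  qed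
  obtain m where m: "level x m" using level_exists[OF x] by blast
  have "m \<le> n" using levelD(1)[OF m] zx[of m] by force
  then have \<psi>n: "\<psi>\<^sub>N n x = \<psi> x" by (rule \<psi>_eq[OF m])
  have "((\<lambda>y. u\<^sub>N n y + (u x - u\<^sub>N n x)) has_real_derivative \<psi> x + 0) (at x)"
    unfolding \<psi>n[symmetric] by (intro DERIV_add Du\<^sub>N DERIV_const)
  then have "((\<lambda>y. u\<^sub>N n y + (u x - u\<^sub>N n x)) has_real_derivative \<psi> x) (at x)" by simp
  then show ?thesis
  proof (rule has_field_derivative_transform_within_open[where S = "ball x d"])
    show "x \<in> ball x d" using d by simp
    fix y assume "y \<in> ball x d"
    then have "\<bar>y - x\<bar> < d" by (simp add: dist_real_def abs_minus_commute)
    from uloc[OF this] show "u\<^sub>N n y + (u x - u\<^sub>N n x) = u y" by (rule sym)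
  qed simp
qed

lemma singular_set_u: "singular_set u a b = E"
proof (intro equalityI subsetI)
  fix x assume x: "x \<in> singular_set u a b"
  then have xab: "x \<in> {a..b}" and inf: "infinite_deriv_at u a b x" by (auto simp: singular_set_def)
  show "x \<in> E"
  proof (rule ccontr)
    assume "x \<notin> E"
    then have "((\<lambda>y. (u y - u x) / (y - x)) \<longlongrightarrow> \<psi> x) (at x within {a..b})"
      using u_deriv[of x] has_field_derivative_at_within by (auto simp: has_field_derivative_iff[symmetric])
    moreover have nb: "at x within {a..b} \<noteq> bot"
      using xab ab by (simp add: at_within_Icc_at trivial_limit_within islimpt_Icc)
    ultimately show False
      using inf not_tendsto_and_filterlim_at_infinity[OF nb] filterlim_at_top_imp_at_infinity filterlim_at_bot_imp_at_infinity
      unfolding infinite_deriv_at_def by blast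
  qed
next
  fix x assume x: "x \<in> E"
  have "filterlim (\<lambda>y. (u y - u x) / (y - x)) at_top (at x within {a..b})"
    unfolding filterlim_at_top
  proof
    fix Z :: real
    obtain n :: nat where n: "Z < real n" using reals_Archimedean2 by blast
    have \<psi>n: "\<psi>\<^sub>N n x = real n + 1" using \<beta>_on_E[OF x] by (simp add: \<psi>\<^sub>N_def)
    have "((\<lambda>y. (u\<^sub>N n y - u\<^sub>N n x) / (y - x)) \<longlongrightarrow> \<psi>\<^sub>N n x) (at x within {a..b})"
      using has_field_derivative_at_within[OF Du\<^sub>N] by (simp add: has_field_derivative_iff)
    from order_tendstoD(1)[OF this, of Z]
    have "\<forall>\<^sub>F y in at x within {a..b}. Z < (u\<^sub>N n y - u\<^sub>N n x) / (y - x)" using n \<psi>n by simp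
    moreover have "\<forall>\<^sub>F y in at x within {a..b}. y \<noteq> x" by (simp add: eventually_at_filter)
    ultimately show "\<forall>\<^sub>F y in at x within {a..b}. Z \<le> (u y - u x) / (y - x)"
    proof eventually_elim
      case (elim y)
      have "(u\<^sub>N n y - u\<^sub>N n x) / (y - x) \<le> (u y - u x) / (y - x)"
      proof (cases "x < y")
        case True
        then show ?thesis using remainder_mono[of x y n] by (intro divide_right_mono) auto
      next
        case False
        then show ?thesis using remainder_mono[of y x n] elim(2) by (intro divide_right_mono_neg) auto
      qed
      then show ?case using elim(1) by linarith
    qed
  qed
  then show "x \<in> singular_set u a b" using x E_sub by (auto simp: singular_set_def infinite_deriv_at_def)
qed

section \<open>The integrable majorant and limits of integrals\<close>

lemma negligible_E: "negligible E" using null_E by (simp add: negligible_iff_null_sets)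

lemma AE_not_E: "AE x in \<mu>. x \<notin> E" using negligible_E by (rule negligible_AE_lebesgue_on) auto

lemma finite_\<mu>: "finite_measure \<mu>"
  using ab by (intro finite_measureI) (simp add: emeasure_restrict_space)

lemma measure_\<mu>: "measure \<mu> (space \<mu>) = b - a"
  using ab by (simp add: measure_restrict_space)

lemma open_\<beta>: "open {x. \<beta> k x \<noteq> 0}"
  using smooth_imp_continuous_on[OF smooth_\<beta>] by (intro open_Collect_neq continuous_on_const)

text \<open>At a point of level \<open>m\<close> the summand \<open>k = m\<close> alone is
  \<open>bb m\<close>, the bound for everything to be integrated. The bound on the measures of the
  supports makes the integrals from \<open>k = 1\<close> on at most geometric.\<close>

definition "J x = (\<Sum>k. bb k * indicat_real {x. \<beta> k x \<noteq> 0} x)"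

lemma bb_le_J: "level x m \<Longrightarrow> bb m \<le> J x"
proof -
  assume m: "level x m"
  have "J x = (\<Sum>k\<le>m. bb k * indicat_real {x. \<beta> k x \<noteq> 0} x)"
    unfolding J_def using levelD(2)[OF m] by (intro suminf_finite) auto
  moreover have "bb m * indicat_real {x. \<beta> m x \<noteq> 0} x \<le> (\<Sum>k\<le>m. bb k * indicat_real {x. \<beta> k x \<noteq> 0} x)"
    using bb_ge by (intro member_le_sum) (auto intro!: mult_nonneg_nonneg intro: order_trans[of 0 1])
  ultimately show ?thesis using levelD(1)[OF m] by simp
qed

lemma J_integrable: "integrable \<mu> J"
proof -
  interpret finite_measure \<mu> by (rule finite_\<mu>)
  define f where "f k x = bb k * indicat_real {x. \<beta> k x \<noteq> 0} x" for k x
  have sets: "{x. \<beta> k x \<noteq> 0} \<inter> {a..b} \<in> sets \<mu>" for k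
    using open_\<beta>[of k] by (auto simp: sets_restrict_space intro!: image_eqI[of _ _ "{x. \<beta> k x \<noteq> 0}"] sets_completionI_sets)
  have ind: "integrable \<mu> (indicat_real ({x. \<beta> k x \<noteq> 0} \<inter> {a..b}))" for k
    using sets by (intro integrable_real_indicator) (auto simp: less_top[symmetric])
  have fi: "integrable \<mu> (f k)" for k
  proof -
    have "integrable \<mu> (\<lambda>x. bb k * indicat_real ({x. \<beta> k x \<noteq> 0} \<inter> {a..b}) x)" using ind by simp
    then show ?thesis
      by (rule Bochner_Integration.integrable_cong[THEN iffD1, OF refl, rotated]) (auto simp: f_def indicator_def)
  qed
  have fn: "norm (f k x) = f k x" for k x using bb_ge[of k] by (simp add: f_def indicator_def)
  have int: "(LINT x|\<mu>. norm (f (Suc k) x)) \<le> (1/2) ^ k" for k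
  proof -
    have "(LINT x|\<mu>. norm (f (Suc k) x)) = (LINT x|\<mu>. bb (Suc k) * indicat_real ({x. \<beta> (Suc k) x \<noteq> 0} \<inter> {a..b}) x)"
      unfolding fn by (intro Bochner_Integration.integral_cong) (auto simp: f_def indicator_def)
    also have "\<dots> = bb (Suc k) * measure \<mu> ({x. \<beta> (Suc k) x \<noteq> 0} \<inter> {a..b})"
      using sets[of "Suc k"] by simp
    also have "measure \<mu> ({x. \<beta> (Suc k) x \<noteq> 0} \<inter> {a..b}) \<le> (1/2) ^ k / bb (Suc k)"
    proof -
      have "emeasure \<mu> ({x. \<beta> (Suc k) x \<noteq> 0} \<inter> {a..b}) = emeasure lebesgue ({x. \<beta> (Suc k) x \<noteq> 0} \<inter> {a..b})"
        by (simp add: emeasure_restrict_space)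
      also have "\<dots> \<le> emeasure lebesgue {x. \<beta> (Suc k) x \<noteq> 0}"
        using open_\<beta>[of "Suc k"] by (intro emeasure_mono) (auto intro!: sets_completionI_sets)
      also have "\<dots> \<le> ennreal ((1/2) ^ k / bb (Suc k))" by (rule \<beta>_measure)
      finally show ?thesis
        using bb_ge[of "Suc k"] by (simp add: emeasure_eq_measure)
    qed
    then have "bb (Suc k) * measure \<mu> ({x. \<beta> (Suc k) x \<noteq> 0} \<inter> {a..b}) \<le> bb (Suc k) * ((1/2) ^ k / bb (Suc k))"
      using bb_ge[of "Suc k"] by (intro mult_left_mono) auto
    also have "\<dots> = (1/2) ^ k" using bb_ge[of "Suc k"] by simp
    finally show ?thesis .
  qed
  have "integrable \<mu> (\<lambda>x. \<Sum>k. f k x)"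
  proof (rule integrable_suminf[OF fi])
    have "summable (\<lambda>k. norm (f k x))" if x: "x \<notin> E" for x
    proof -
      obtain m where m: "level x m" using level_exists[OF x] by blast
      show ?thesis
        by (rule summable_finite[of "{..m}"]) (use levelD(2)[OF m] in \<open>auto simp: f_def\<close>)
    qed
    then show "AE x in \<mu>. summable (\<lambda>k. norm (f k x))" using AE_not_E by (auto elim: eventually_mono)
    \<comment> \<open>The measure bound concerns indices from 1 on; index 0, where the cutoff is 1
      everywhere, is a single term.\<close>
    have "summable (\<lambda>k. LINT x|\<mu>. norm (f (Suc k) x))"
      by (rule summable_comparison_test'[of "\<lambda>k. (1/2) ^ k" 0])
        (use int in \<open>auto simp: fn integral_nonneg_AE intro!: Bochner_Integration.integral_nonneg\<close>)
    then show "summable (\<lambda>k. LINT x|\<mu>. norm (f k x))" by (subst (asm) summable_Suc_iff)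
  qed
  then show ?thesis by (simp add: J_def[abs_def] f_def)
qed

lemma \<psi>_measurable [measurable]: "\<psi> \<in> borel_measurable borel"
proof -
  have "\<beta> k \<in> borel_measurable borel" for k
    by (intro borel_measurable_continuous_onI smooth_imp_continuous_on smooth_\<beta>)
  then show ?thesis unfolding \<psi>_def[abs_def] by (intro borel_measurable_suminf)
qed

lemma L_measurable:
  assumes "v \<in> borel_measurable borel" "p \<in> borel_measurable borel"
  shows "(\<lambda>x. L x (v x) (p x)) \<in> borel_measurable borel"
proof -
  have c: "continuous_on UNIV (\<lambda>(x, y, p). L x y p)" by (rule smooth_imp_continuous_on[OF smooth_L])
  have "(\<lambda>x. (x, v x, p x)) \<in> borel \<rightarrow>\<^sub>M borel"
    using assms by (intro borel_measurable_Pair) auto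
  from measurable_compose[OF this borel_measurable_continuous_onI[OF c]] show ?thesis by simp
qed

text \<open>The null set \<open>N\<close> absorbs the points where \<open>deriv v\<close> is an arbitrary value.\<close>
lemma functional_eq:
  assumes N: "negligible N" and p: "\<And>x. x \<in> {a..b} - N \<Longrightarrow> (v has_real_derivative p x) (at x)"
  shows "functional L a b v = (\<integral>\<^sup>+x. ennreal (L x (v x) (p x)) \<partial>\<mu>)"
proof -
  have "functional L a b v = (\<integral>\<^sup>+x. ennreal (L x (v x) (deriv v x)) \<partial>\<mu>)"
    unfolding functional_def by (simp add: nn_integral_restrict_space)
  also have "\<dots> = (\<integral>\<^sup>+x. ennreal (L x (v x) (p x)) \<partial>\<mu>)"
  proof (rule nn_integral_cong_AE, rule negligible_AE_lebesgue_on[OF N])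
    fix x assume "x \<in> {a..b} - N"
    from DERIV_imp_deriv[OF p[OF this]] show "ennreal (L x (v x) (deriv v x)) = ennreal (L x (v x) (p x))" by simp
  qed
  finally show ?thesis .
qed

lemma u_measurable [measurable]: "u \<in> borel_measurable borel"
proof -
  have "Q k \<in> borel_measurable borel" for k
    by (intro borel_measurable_continuous_onI smooth_imp_continuous_on smooth_Q)
  then show ?thesis unfolding u_def[abs_def] by (intro borel_measurable_suminf)
qed

definition "I\<^sub>u = (LINT x|\<mu>. L x (u x) (\<psi> x))"

lemma \<psi>_nonneg: "x \<notin> E \<Longrightarrow> 0 \<le> \<psi> x"
  using level_exists \<psi>_nonneg_level(1) by (meson of_nat_0_le_iff order_trans)

lemma L_u_le_J: "x \<notin> E \<Longrightarrow> L x (u x) (\<psi> x) \<le> J x"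
proof -
  assume x: "x \<notin> E"
  obtain m where m: "level x m" using level_exists[OF x] by blast
  have "L x (u x) (\<psi> x) \<le> bb m" using \<psi>_nonneg[OF x] by (intro L_le_bb m) auto
  also have "\<dots> \<le> J x" by (rule bb_le_J[OF m])
  finally show ?thesis .
qed

lemma L_u_integrable: "integrable \<mu> (\<lambda>x. L x (u x) (\<psi> x))"
proof (rule Bochner_Integration.integrable_bound[OF J_integrable])
  show "(\<lambda>x. L x (u x) (\<psi> x)) \<in> borel_measurable \<mu>"
    by (intro borel_measurable_lebesgue_on L_measurable u_measurable \<psi>_measurable)
  show "AE x in \<mu>. norm (L x (u x) (\<psi> x)) \<le> norm (J x)"
    using AE_not_E by eventually_elim (use L_u_le_J L_nonneg in \<open>force simp: abs_of_nonneg intro: order_trans\<close>)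
qed

lemma functional_u: "functional L a b u = ennreal I\<^sub>u"
proof -
  have "functional L a b u = (\<integral>\<^sup>+x. ennreal (L x (u x) (\<psi> x)) \<partial>\<mu>)"
    using negligible_E by (rule functional_eq) (use u_deriv in blast)
  also have "\<dots> = ennreal I\<^sub>u" unfolding I\<^sub>u_def
    by (intro nn_integral_eq_integral L_u_integrable) (simp add: L_nonneg)
  finally show ?thesis .
qed

lemma P\<^sub>N_u_integrable: "integrable \<mu> (\<lambda>x. P\<^sub>N N x (u x) (\<psi> x))"
  and P\<^sub>N_u_tendsto: "(\<lambda>N. LINT x|\<mu>. P\<^sub>N N x (u x) (\<psi> x)) \<longlonglongrightarrow> I\<^sub>u"
proof -
  have meas: "(\<lambda>x. P\<^sub>N N x (u x) (\<psi> x)) \<in> borel_measurable \<mu>" for N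
  proof -
    have [measurable]: "\<beta> k \<in> borel_measurable borel" "\<beta>' k \<in> borel_measurable borel" "\<Theta> k \<in> borel_measurable borel"
      "\<Theta>' k \<in> borel_measurable borel" "u\<^sub>N k \<in> borel_measurable borel" "\<psi>\<^sub>N k \<in> borel_measurable borel" for k
      by (intro borel_measurable_continuous_onI smooth_imp_continuous_on smooth_\<beta> smooth_\<beta>' smooth_\<Theta> smooth_\<Theta>' smooth_u\<^sub>N smooth_\<psi>\<^sub>N)+
    show ?thesis unfolding P\<^sub>N_def t_def by (intro borel_measurable_lebesgue_on) measurable
  qed
  have bnd: "AE x in \<mu>. norm (P\<^sub>N N x (u x) (\<psi> x)) \<le> J x" for N
    using AE_not_E
  proof eventually_elim
    case (elim x)
    then obtain m where m: "level x m" using level_exists by blast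
    show ?case using P\<^sub>N_abs_le_bb[OF m, of N "u x"] bb_le_J[OF m] by simp
  qed
  have lim: "AE x in \<mu>. (\<lambda>N. P\<^sub>N N x (u x) (\<psi> x)) \<longlonglongrightarrow> L x (u x) (\<psi> x)"
    using AE_not_E
  proof eventually_elim
    case (elim x)
    then obtain m where m: "level x m" using level_exists by blast
    have "P\<^sub>N N x (u x) (\<psi> x) = L x (u x) (\<psi> x)" if "m \<le> N" for N
      unfolding stationary_level(1)[OF m that] by (rule graph_equality[OF m, symmetric])
    then show ?case by (intro tendsto_eventually eventually_sequentiallyI)
  qed
  have Lm: "(\<lambda>x. L x (u x) (\<psi> x)) \<in> borel_measurable \<mu>" using L_u_integrable by simp
  show "integrable \<mu> (\<lambda>x. P\<^sub>N N x (u x) (\<psi> x))"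
    by (rule integrable_dominated_convergence2[OF Lm meas J_integrable lim bnd])
  show "(\<lambda>N. LINT x|\<mu>. P\<^sub>N N x (u x) (\<psi> x)) \<longlonglongrightarrow> I\<^sub>u"
    unfolding I\<^sub>u_def by (rule integral_dominated_convergence[OF Lm meas J_integrable lim bnd])
qed

lemma F_u_increment: "F N u b - F N u a = (LINT x|\<mu>. P\<^sub>N N x (u x) (\<psi> x))"
  using ab by (intro absolutely_continuous_on_increment_eq[OF F_AC[OF u_AC] _ negligible_E F_deriv P\<^sub>N_u_integrable] u_deriv) auto

lemma tail_bound_integrable: "integrable \<mu> (tail_bound N)"
  and tail_bound_tendsto: "(\<lambda>N. LINT x|\<mu>. tail_bound N x) \<longlonglongrightarrow> 0"
proof -
  have meas: "tail_bound N \<in> borel_measurable \<mu>" for N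
  proof -
    have [measurable]: "\<beta> k \<in> borel_measurable borel" for k
      by (intro borel_measurable_continuous_onI smooth_imp_continuous_on smooth_\<beta>)
    show ?thesis unfolding tail_bound_def[abs_def] by (intro borel_measurable_lebesgue_on) measurable
  qed
  have bnd: "AE x in \<mu>. norm (tail_bound N x) \<le> J x" for N
    using AE_not_E
  proof eventually_elim
    case (elim x)
    then obtain m where m: "level x m" using level_exists by blast
    show ?case using tail_bound_le_bb(1,2)[OF m, of N] bb_le_J[OF m] by simp
  qed
  have lim: "AE x in \<mu>. (\<lambda>N. tail_bound N x) \<longlonglongrightarrow> 0"
    using AE_not_E
  proof eventually_elim
    case (elim x)
    then obtain m where m: "level x m" using level_exists by blast
    show ?case using tail_bound_le_bb(3)[OF m] by (intro tendsto_eventually eventually_sequentiallyI)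
  qed
  show "integrable \<mu> (tail_bound N)"
    by (rule integrable_dominated_convergence2[OF _ meas J_integrable lim bnd]) simp
  show "(\<lambda>N. LINT x|\<mu>. tail_bound N x) \<longlonglongrightarrow> 0"
    using integral_dominated_convergence[OF _ meas J_integrable lim bnd] by simp
qed

text \<open>Integrate \<open>key_inequality\<close> along \<open>v\<close>. The left side is the
  increment of \<open>F n v\<close>, which equals that of \<open>F n u\<close> by the common end
  values and so tends to \<open>I\<^sub>u\<close>; the error terms tend to 0. Truncating the excess
  at 1 makes it integrable and keeps its zeros.\<close>

lemma lower_bound:
  assumes v: "absolutely_continuous_on a b v" and va: "v a = u a" and vb: "v b = u b"
    and N: "negligible N" and p: "\<And>x. x \<in> {a..b} - N \<Longrightarrow> (v has_real_derivative p x) (at x)"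
    and pm: "p \<in> borel_measurable borel" and Lv: "integrable \<mu> (\<lambda>x. L x (v x) (p x))"
  shows "integrable \<mu> (\<lambda>x. min 1 (excess x (p x)))"
    "I\<^sub>u + (LINT x|\<mu>. min 1 (excess x (p x))) \<le> (LINT x|\<mu>. L x (v x) (p x))"
proof -
  interpret finite_measure \<mu> by (rule finite_\<mu>)
  let ?D = "\<lambda>x. min 1 (excess x (p x))"
  note pm[measurable]
  show D: "integrable \<mu> ?D"
  proof (rule integrable_const_bound[of _ 1])
    have [measurable]: "\<omega> \<in> borel_measurable borel" "\<omega>' \<in> borel_measurable borel"
      by (intro borel_measurable_continuous_onI smooth_imp_continuous_on smooth_\<omega> smooth_\<omega>')+
    show "?D \<in> borel_measurable \<mu>"
      unfolding excess_def by (intro borel_measurable_lebesgue_on) measurable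
    show "AE x in \<mu>. norm (?D x) \<le> 1" using excess_nonneg by (intro AE_I2) simp
  qed
  let ?IL = "LINT x|\<mu>. L x (v x) (p x)"
  have ineq: "(LINT x|\<mu>. P\<^sub>N n x (u x) (\<psi> x)) \<le>
      (1 + (1/2) ^ n) * ?IL + (1/2) ^ n * (1 + M) * (b - a) + (LINT x|\<mu>. tail_bound n x) - (LINT x|\<mu>. ?D x)" for n
  proof -
    let ?h = "\<lambda>x. (1 + (1/2) ^ n) * L x (v x) (p x) + (1/2) ^ n * (1 + M) + tail_bound n x - ?D x"
    have hi: "integrable \<mu> ?h"
      by (intro Bochner_Integration.integrable_diff Bochner_Integration.integrable_add integrable_mult_right Lv
          integrable_const tail_bound_integrable D)
    have "F n v b - F n v a \<le> integral\<^sup>L \<mu> ?h"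
    proof (rule absolutely_continuous_on_increment_le[OF F_AC[OF v] less_imp_le[OF ab] negligible_Un[OF N negligible_E] _ hi])
      show "(F n v has_real_derivative P\<^sub>N n x (v x) (p x)) (at x)" if "x \<in> {a..b} - (N \<union> E)" for x
        using that by (intro F_deriv p) blast
      fix x assume "x \<in> {a..b} - (N \<union> E)"
      then have "P\<^sub>N n x (v x) (p x) + excess x (p x) \<le>
          (1 + (1/2) ^ n) * L x (v x) (p x) + (1/2) ^ n * (1 + M) + tail_bound n x"
        by (intro key_inequality) blast
      then show "P\<^sub>N n x (v x) (p x) \<le> ?h x" by linarith
    qed
    also have "integral\<^sup>L \<mu> ?h = (1 + (1/2) ^ n) * ?IL + (1/2) ^ n * (1 + M) * (b - a) + (LINT x|\<mu>. tail_bound n x) - (LINT x|\<mu>. ?D x)"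
    proof -
      note ii = integrable_mult_right[OF Lv, of "1 + (1/2) ^ n"] integrable_const[of "(1/2) ^ n * (1 + M)"] tail_bound_integrable[of n] D
      show ?thesis
        using measure_\<mu>
        by (simp only: Bochner_Integration.integral_diff[OF Bochner_Integration.integrable_add[OF Bochner_Integration.integrable_add[OF ii(1,2)] ii(3)] ii(4)]
            Bochner_Integration.integral_add[OF Bochner_Integration.integrable_add[OF ii(1,2)] ii(3)]
            Bochner_Integration.integral_add[OF ii(1,2)] integral_mult_right_zero lebesgue_integral_const)
          simp
    qed
    also have "F n v b - F n v a = F n u b - F n u a" by (simp add: F_def va vb)
    finally show ?thesis unfolding F_u_increment .
  qed
  have q0: "(\<lambda>n. (1/2) ^ n) \<longlonglongrightarrow> (0::real)" by (intro LIMSEQ_power_zero) simp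
  have "(\<lambda>n. (1 + (1/2) ^ n) * ?IL + (1/2) ^ n * (1 + M) * (b - a) + (LINT x|\<mu>. tail_bound n x) - (LINT x|\<mu>. ?D x))
      \<longlonglongrightarrow> (1 + 0) * ?IL + 0 * (1 + M) * (b - a) + 0 - (LINT x|\<mu>. ?D x)"
    by (intro tendsto_intros q0 tail_bound_tendsto)
  from LIMSEQ_le[OF P\<^sub>N_u_tendsto this] ineq
  have "I\<^sub>u \<le> (1 + 0) * ?IL + 0 * (1 + M) * (b - a) + 0 - (LINT x|\<mu>. ?D x)" by blast
  then show "I\<^sub>u + (LINT x|\<mu>. ?D x) \<le> ?IL" by simp
qed

lemma minimizer:
  assumes v: "absolutely_continuous_on a b v" and va: "v a = u a" and vb: "v b = u b"
  shows "functional L a b u \<le> functional L a b v"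
    and "\<exists>x\<in>{a..b}. v x \<noteq> u x \<Longrightarrow> functional L a b u < functional L a b v"
proof -
  obtain v0 p N where v0: "continuous_on UNIV v0" "\<forall>x\<in>{a..b}. v0 x = v x" and pm: "p \<in> borel_measurable borel"
    and N: "negligible N" and p: "\<forall>x\<in>{a..b} - N. (v has_real_derivative p x) (at x)"
    using absolutely_continuous_on_derivative[OF v ab] by (elim exE conjE)
  have p': "x \<in> {a..b} - N \<Longrightarrow> (v has_real_derivative p x) (at x)" for x using p by blast
  have fv: "functional L a b v = (\<integral>\<^sup>+x. ennreal (L x (v x) (p x)) \<partial>\<mu>)" by (rule functional_eq[OF N p'])
  have Lm: "(\<lambda>x. L x (v x) (p x)) \<in> borel_measurable \<mu>"
  proof -
    have "(\<lambda>x. L x (v0 x) (p x)) \<in> borel_measurable \<mu>"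
      by (intro borel_measurable_lebesgue_on L_measurable pm borel_measurable_continuous_onI v0(1))
    then show ?thesis by (rule measurable_cong[THEN iffD1, rotated]) (use v0(2) in simp)
  qed
  have "functional L a b u \<le> functional L a b v \<and>
     ((\<exists>x\<in>{a..b}. v x \<noteq> u x) \<longrightarrow> functional L a b u < functional L a b v)"
  proof (cases "functional L a b v = \<infinity>")
    case True
    then show ?thesis by (simp add: functional_u)
  next
    case False
    have Lv: "integrable \<mu> (\<lambda>x. L x (v x) (p x))"
      using Lm False by (intro integrableI_nonneg) (auto simp: L_nonneg fv less_top[symmetric] infinity_ennreal_def)
    let ?IL = "LINT x|\<mu>. L x (v x) (p x)"
    let ?D = "\<lambda>x. min 1 (excess x (p x))"
    have fvI: "functional L a b v = ennreal ?IL"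
      unfolding fv by (intro nn_integral_eq_integral Lv) (simp add: L_nonneg)
    note lb = lower_bound[OF v va vb N p' pm Lv]
    have D0: "0 \<le> (LINT x|\<mu>. ?D x)" using excess_nonneg by (intro integral_nonneg_AE AE_I2) simp
    have Iu0: "0 \<le> I\<^sub>u" unfolding I\<^sub>u_def using L_nonneg by (intro integral_nonneg_AE AE_I2) simp
    have "v x = u x" if eq: "?IL \<le> I\<^sub>u" and x: "x \<in> {a..b}" for x
    proof -
      have "(LINT x|\<mu>. ?D x) = 0" using lb(2) D0 eq by linarith
      then have "AE x in \<mu>. ?D x = 0"
        using integral_nonneg_eq_0_iff_AE[OF lb(1)] excess_nonneg by simp
      then have "AE x in \<mu>. p x \<le> \<psi> x"
      proof eventually_elim
        case (elim x)
        then show ?case using excess_pos[of x "p x"] by (simp add: min_def split: if_splits) force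
      qed
      then have "AE x in lebesgue. x \<in> {a..b} \<longrightarrow> p x \<le> \<psi> x" by (subst (asm) AE_restrict_space_iff) auto
      then obtain N' where N': "N' \<in> null_sets lebesgue" "{x \<in> space lebesgue. \<not> (x \<in> {a..b} \<longrightarrow> p x \<le> \<psi> x)} \<subseteq> N'"
        unfolding eventually_ae_filter by blast
      let ?N = "N \<union> E \<union> N'"
      have nN: "negligible ?N" using N negligible_E N'(1)[folded negligible_iff_null_sets] by (intro negligible_Un)
      have le: "p y \<le> \<psi> y" if "y \<in> {a..b} - ?N" for y using N'(2) that by auto
      have inc: "v d - v c \<le> u d - u c" if cd: "a \<le> c" "c \<le> d" "d \<le> b" for c d
      proof -
        have "(p has_integral (v d - v c)) {c..d}"
          by (rule absolutely_continuous_on_fundamental_theorem[OF absolutely_continuous_on_subinterval[OF v cd(1,3)] cd(2) nN])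
            (rule has_field_derivative_at_within[OF p'], use cd in auto)
        moreover have "(\<psi> has_integral (u d - u c)) {c..d}"
          by (rule absolutely_continuous_on_fundamental_theorem[OF absolutely_continuous_on_subinterval[OF u_AC cd(1,3)] cd(2) nN])
            (rule has_field_derivative_at_within[OF u_deriv], use cd in auto)
        \<comment> \<open>The comparison of integrals is pointwise everywhere, so
          \<open>\<psi>\<close> is replaced by \<open>p\<close> on the null set.\<close>
        then have "((\<lambda>y. if y \<in> ?N then p y else \<psi> y) has_integral (u d - u c)) {c..d}"
          by (rule has_integral_spike[OF nN, rotated]) simp
        ultimately show ?thesis by (rule has_integral_le) (use le cd in auto)
      qed
      \<comment> \<open>From the left end this gives \<open>v x \<le> u x\<close>, from the right
        end \<open>u x \<le> v x\<close>.\<close>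
      show ?thesis using inc[of a x] inc[of x b] x va vb by auto
    qed
    then have "(\<exists>x\<in>{a..b}. v x \<noteq> u x) \<longrightarrow> I\<^sub>u < ?IL" by force
    then show ?thesis
      unfolding functional_u fvI using lb(2) D0 Iu0 by (auto intro: ennreal_leI simp: ennreal_less_iff)
  qed
  then show "functional L a b u \<le> functional L a b v"
    and "\<exists>x\<in>{a..b}. v x \<noteq> u x \<Longrightarrow> functional L a b u < functional L a b v" by auto
qed

text \<open>\<open>U k\<close> is \<open>u\<^sub>N k\<close> plus the affine function restoring the values of \<open>u\<close> at both ends.\<close>
definition "slope k = ((u b - u\<^sub>N k b) - (u a - u\<^sub>N k a)) / (b - a)"
definition "U k x = u\<^sub>N k x + (u a - u\<^sub>N k a) + slope k * (x - a)"

lemma slope_bounds: "0 \<le> slope k" "slope k * (b - a) \<le> e k / 2"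
proof -
  show "0 \<le> slope k" unfolding slope_def using remainder_mono[of a b k] ab by simp
  have "slope k * (b - a) = (u b - u\<^sub>N k b) - (u a - u\<^sub>N k a)" unfolding slope_def using ab by simp
  then show "slope k * (b - a) \<le> e k / 2" using u_diff[of b k] u_diff[of a k] by linarith
qed

lemma slope_tendsto_0: "slope \<longlonglongrightarrow> 0"
proof (rule tendsto_sandwich[of "\<lambda>_. 0" _ _ "\<lambda>k. e k * (1 / (2 * (b - a)))"])
  have "slope k \<le> e k * (1 / (2 * (b - a)))" for k
    using slope_bounds(2)[of k] ab by (simp add: field_simps)
  then show "\<forall>\<^sub>F k in sequentially. slope k \<le> e k * (1 / (2 * (b - a)))" by simp
  show "(\<lambda>k. e k * (1 / (2 * (b - a)))) \<longlonglongrightarrow> 0" by (rule tendsto_mult_left_zero[OF e_tendsto_0])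
qed (use slope_bounds(1) in auto)

lemma U_ends: "U k a = u a" "U k b = u b"
proof -
  show "U k a = u a" by (simp add: U_def)
  have "slope k * (b - a) = (u b - u\<^sub>N k b) - (u a - u\<^sub>N k a)" unfolding slope_def using ab by simp
  then show "U k b = u b" by (simp add: U_def)
qed

lemma smooth_U: "smooth (U k)"
  unfolding U_def[abs_def] by (intro smooth_add smooth_mult smooth_diff smooth_const smooth_u\<^sub>N smooth_ident)

lemma DU: "(U k has_real_derivative \<psi>\<^sub>N k x + slope k) (at x)"
proof -
  have "((\<lambda>x. u\<^sub>N k x + (u a - u\<^sub>N k a) + slope k * (x - a)) has_real_derivative (\<psi>\<^sub>N k x + 0 + slope k * (1 - 0))) (at x)"
    by (intro DERIV_add DERIV_cmult DERIV_diff DERIV_ident DERIV_const Du\<^sub>N)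
  then show ?thesis by (simp add: U_def[abs_def])
qed

lemma U_close: "x \<in> {a..b} \<Longrightarrow> \<bar>U k x - u x\<bar> \<le> 2 * e k"
proof -
  assume x: "x \<in> {a..b}"
  have "0 \<le> slope k * (x - a)" "slope k * (x - a) \<le> slope k * (b - a)"
    using x slope_bounds(1)[of k] by (auto intro: mult_left_mono)
  then show ?thesis using slope_bounds(2)[of k] u_diff[of x k] u_diff[of a k] e_pos[of k]
    unfolding U_def abs_le_iff by linarith
qed

lemma U_uniform: "uniform_limit {a..b} U u sequentially"
proof (rule uniform_limitI)
  fix \<epsilon>0 :: real assume "\<epsilon>0 > 0"
  then have "\<forall>\<^sub>F k in sequentially. e k < \<epsilon>0 / 2" using order_tendstoD(2)[OF e_tendsto_0, of "\<epsilon>0 / 2"] by simp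
  then show "\<forall>\<^sub>F k in sequentially. \<forall>x\<in>{a..b}. dist (U k x) (u x) < \<epsilon>0"
  proof eventually_elim
    case (elim k)
    then show ?case using U_close[of _ k] by (force simp: dist_real_def)
  qed
qed

lemma U_energy: "(\<lambda>k. functional L a b (U k)) \<longlonglongrightarrow> functional L a b u"
proof -
  have "\<forall>\<^sub>F k in sequentially. slope k < 1" using order_tendstoD(2)[OF slope_tendsto_0] by simp
  then obtain k0 where k0: "\<And>k. k0 \<le> k \<Longrightarrow> slope k < 1" by (auto simp: eventually_sequentially)
  \<comment> \<open>Shifted by \<open>k0\<close> so that the slope correction stays below 1, the
    range in which \<open>L_le_bb\<close> applies.\<close>
  let ?f = "\<lambda>k x. ennreal (L x (U (k + k0) x) (\<psi>\<^sub>N (k + k0) x + slope (k + k0)))"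
  have fU: "functional L a b (U k) = (\<integral>\<^sup>+x. ennreal (L x (U k x) (\<psi>\<^sub>N k x + slope k)) \<partial>\<mu>)" for k
    by (rule functional_eq[of "{}"]) (auto intro: DU)
  have fu: "functional L a b u = (\<integral>\<^sup>+x. ennreal (L x (u x) (\<psi> x)) \<partial>\<mu>)"
    using negligible_E by (rule functional_eq) (use u_deriv in blast)
  have "(\<lambda>k. \<integral>\<^sup>+x. ?f k x \<partial>\<mu>) \<longlonglongrightarrow> (\<integral>\<^sup>+x. ennreal (L x (u x) (\<psi> x)) \<partial>\<mu>)"
  proof (rule nn_integral_dominated_convergence[where w = "\<lambda>x. ennreal (J x)"])
    show "?f k \<in> borel_measurable \<mu>" for k
    proof -
      have "U (k + k0) \<in> borel_measurable borel" "(\<lambda>x. \<psi>\<^sub>N (k + k0) x + slope (k + k0)) \<in> borel_measurable borel"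
        by (intro borel_measurable_continuous_onI smooth_imp_continuous_on smooth_U smooth_add smooth_\<psi>\<^sub>N smooth_const)+
      then show ?thesis by (intro measurable_compose[OF _ measurable_ennreal] borel_measurable_lebesgue_on L_measurable)
    qed
    show "(\<lambda>x. ennreal (L x (u x) (\<psi> x))) \<in> borel_measurable \<mu>"
      by (intro measurable_compose[OF _ measurable_ennreal] borel_measurable_lebesgue_on L_measurable u_measurable \<psi>_measurable)
    show "(\<lambda>x. ennreal (J x)) \<in> borel_measurable \<mu>" using J_integrable by simp
    show "(\<integral>\<^sup>+x. ennreal (J x) \<partial>\<mu>) < \<infinity>"
    proof -
      have "(\<integral>\<^sup>+x. ennreal (J x) \<partial>\<mu>) \<le> (\<integral>\<^sup>+x. ennreal (norm (J x)) \<partial>\<mu>)"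
        by (intro nn_integral_mono ennreal_leI) simp
      also have "\<dots> < \<infinity>" using J_integrable by (simp add: integrable_iff_bounded)
      finally show ?thesis .
    qed
    show "AE x in \<mu>. ?f k x \<le> ennreal (J x)" for k
      using AE_not_E
    proof eventually_elim
      case (elim x)
      then obtain m where m: "level x m" using level_exists by blast
      have "L x (U (k + k0) x) (\<psi>\<^sub>N (k + k0) x + slope (k + k0)) \<le> bb m"
        using \<psi>\<^sub>N_nonneg[of "k + k0" x] \<psi>_nonneg_level(3)[OF m, of "k + k0"] slope_bounds(1)[of "k + k0"] k0[of "k + k0"]
        by (intro L_le_bb m) auto
      then show ?case using bb_le_J[OF m] by (intro ennreal_leI) linarith
    qed
    show "AE x in \<mu>. (\<lambda>k. ?f k x) \<longlonglongrightarrow> ennreal (L x (u x) (\<psi> x))"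
      using AE_not_E AE_space[of \<mu>]
    proof eventually_elim
      case (elim x)
      then obtain m where m: "level x m" using level_exists by blast
      have x: "x \<in> {a..b}" using elim(2) by simp
      have 1: "(\<lambda>k. U k x) \<longlonglongrightarrow> u x" by (rule tendsto_uniform_limitI[OF U_uniform x])
      have "\<psi>\<^sub>N k x = \<psi> x" if "m \<le> k" for k using \<psi>_eq[OF m that] .
      then have "(\<lambda>k. \<psi>\<^sub>N k x) \<longlonglongrightarrow> \<psi> x" by (intro tendsto_eventually eventually_sequentiallyI)
      from tendsto_add[OF this slope_tendsto_0] have 2: "(\<lambda>k. \<psi>\<^sub>N k x + slope k) \<longlonglongrightarrow> \<psi> x" by simp
      have "isCont (\<lambda>(x, y, p). L x y p) (x, u x, \<psi> x)"
        using smooth_imp_continuous_on[OF smooth_L, of UNIV] by (simp add: continuous_on_eq_continuous_at)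
      from isCont_tendsto_compose[OF this tendsto_Pair[OF tendsto_const tendsto_Pair[OF 1 2]]]
      have "(\<lambda>k. L x (U k x) (\<psi>\<^sub>N k x + slope k)) \<longlonglongrightarrow> L x (u x) (\<psi> x)" by simp
      from LIMSEQ_ignore_initial_segment[OF this, of k0]
      show ?case by (intro tendsto_ennrealI)
    qed
  qed
  then have "(\<lambda>k. functional L a b (U (k + k0))) \<longlonglongrightarrow> functional L a b u" unfolding fU fu .
  then show ?thesis by (rule LIMSEQ_offset)
qed

end

section \<open>Existence of the construction\<close>

context energy_density
begin

text \<open>The demands on a single stage, to serve as the invariant of a dependent choice; the
  links between consecutive stages are kept apart.\<close>

definition "cutoff E n \<beta> \<beta>' Q \<longleftrightarrow>
  smooth \<beta> \<and> smooth \<beta>' \<and> smooth Q \<and>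
  (\<forall>x. (\<beta> has_real_derivative \<beta>' x) (at x)) \<and> (\<forall>x. (Q has_real_derivative \<beta> x) (at x)) \<and>
  (\<forall>x. 0 \<le> \<beta> x \<and> \<beta> x \<le> 1) \<and> (\<exists>G. open G \<and> E \<subseteq> G \<and> (\<forall>x\<in>G. \<beta> x = 1)) \<and> (\<exists>D. \<forall>x. \<bar>\<beta>' x\<bar> \<le> D) \<and>
  (n = 0 \<longrightarrow> (\<forall>x. \<beta> x = 1 \<and> Q x = x)) \<and>
  (\<forall>k. n = Suc k \<longrightarrow> (\<forall>x. \<beta> x \<noteq> 0 \<longrightarrow> (\<exists>y\<in>E. \<bar>x - y\<bar> < 1 / (real k + 1))) \<and>
    emeasure lebesgue {x. \<beta> x \<noteq> 0} \<le> ennreal ((1/2) ^ k / bb n))"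

text \<open>Refers to the cutoff only through \<open>\<beta>'\<close>, so it can be found once the
  cutoff of the same stage is fixed. The radius \<open>\<epsilon>\<close> is prescribed in advance,
  \<open>e\<close> results.\<close>

definition "corrector n (\<beta>' :: real \<Rightarrow> real) \<Theta> \<Theta>' \<rho> e \<epsilon> \<delta> \<longleftrightarrow>
  smooth \<Theta> \<and> smooth \<Theta>' \<and> smooth \<rho> \<and> (\<forall>z. (\<Theta> has_real_derivative \<Theta>' z) (at z)) \<and>
  (\<forall>z. \<bar>z\<bar> \<le> e \<longrightarrow> \<Theta>' z = 1 \<and> \<rho> z = 1) \<and> (\<forall>z. \<epsilon> \<le> \<bar>z\<bar> \<longrightarrow> \<Theta> z = 0 \<and> \<Theta>' z = 0 \<and> \<rho> z = 0) \<and>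
  (\<forall>x z. B n * \<bar>\<beta>' x * \<Theta> z\<bar> \<le> \<kappa> n) \<and> (\<forall>z. \<bar>\<Theta> z\<bar> \<le> 1 \<and> - \<delta> \<le> \<Theta>' z \<and> \<Theta>' z \<le> 1 \<and> 0 \<le> \<rho> z \<and> \<rho> z \<le> 1) \<and>
  0 \<le> \<delta> \<and> \<delta> \<le> 1 \<and> B n * \<delta> * (real n + 1) \<le> \<kappa> n \<and> 0 < e \<and> e \<le> \<epsilon>"

lemma corrector_exists:
  fixes \<epsilon> D :: real
  assumes \<epsilon>: "0 < \<epsilon>" and D: "\<And>x. \<bar>\<beta>' x\<bar> \<le> D"
  shows "\<exists>\<Theta> \<Theta>' \<rho> e \<delta>. corrector n \<beta>' \<Theta> \<Theta>' \<rho> e \<epsilon> \<delta>"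
proof -
  have D0: "0 \<le> D" using D[of 0] by linarith
  have B3: "3 \<le> B n" by (rule B_ge)
  \<comment> \<open>All three factors of the denominator are at least 1, so a single
    \<open>\<delta>\<close> meets the bound 1, the budget for the descent of \<open>\<Theta>\<close>
    and, through \<open>D\<close>, the budget for \<open>\<beta>' x * \<Theta> z\<close>.\<close>
  define \<delta> where "\<delta> = \<kappa> n / (B n * (real n + 1) * (D + 1))"
  have den: "1 \<le> B n * (real n + 1) * (D + 1)"
  proof -
    have "1 * 1 * 1 \<le> B n * (real n + 1) * (D + 1)" using B3 D0 by (intro mult_mono) auto
    then show ?thesis by simp
  qed
  have \<delta>: "0 < \<delta>" using den by (simp add: \<delta>_def)
  have \<kappa>1: "\<kappa> n \<le> 1" unfolding \<kappa>_def by (rule power_le_one) simp_all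
  have \<delta>1: "\<delta> \<le> 1"
  proof -
    have "\<delta> \<le> \<kappa> n / 1" unfolding \<delta>_def using den by (intro divide_left_mono) auto
    then show ?thesis using \<kappa>1 by simp
  qed
  have eq: "B n * \<delta> * (real n + 1) * (D + 1) = \<kappa> n"
    using den B3 D0 by (simp add: \<delta>_def field_simps)
  have nn: "0 \<le> B n * \<delta> * (real n + 1)" using B3 \<delta> by simp
  have \<delta>2: "B n * \<delta> * (real n + 1) \<le> \<kappa> n"
    using mult_left_mono[of 1 "D + 1" "B n * \<delta> * (real n + 1)"] nn D0 eq by simp
  have \<delta>3: "B n * (D * \<delta>) \<le> \<kappa> n"
  proof -
    have "B n * (D * \<delta>) = B n * \<delta> * 1 * D" by simp
    also have "\<dots> \<le> B n * \<delta> * (real n + 1) * (D + 1)"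
      using B3 \<delta> D0 by (intro mult_mono) auto
    finally show ?thesis using eq by simp
  qed
  obtain e0 \<Theta> \<Theta>' where \<Theta>: "0 < e0" "e0 \<le> \<epsilon>" "e0 \<le> \<delta>" "smooth (\<Theta>::real \<Rightarrow> real)" "smooth \<Theta>'"
    "\<forall>z. (\<Theta> has_real_derivative \<Theta>' z) (at z)" "\<forall>z. \<bar>z\<bar> \<le> e0 \<longrightarrow> \<Theta>' z = 1"
    "\<forall>z. \<epsilon> \<le> \<bar>z\<bar> \<longrightarrow> \<Theta> z = 0 \<and> \<Theta>' z = 0" "\<forall>z. \<bar>\<Theta> z\<bar> \<le> \<delta> \<and> - \<delta> \<le> \<Theta>' z \<and> \<Theta>' z \<le> 1"
    using smooth_truncated_identity_exists[OF \<epsilon> \<delta>] by (elim exE conjE)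
  have \<Theta>\<delta>: "\<bar>\<Theta> z\<bar> \<le> \<delta>" for z using \<Theta>(9) by blast
  obtain \<rho> :: "real \<Rightarrow> real" where \<rho>: "smooth \<rho>" "\<And>x. 0 \<le> \<rho> x" "\<And>x. \<rho> x \<le> 1"
    "\<And>x. \<bar>x\<bar> \<le> 1/2 \<Longrightarrow> \<rho> x = 1" "\<And>x. \<bar>x\<bar> \<ge> 1 \<Longrightarrow> \<rho> x = 0"
    using smooth_plateau_exists by blast
  \<comment> \<open>\<open>\<Theta>'\<close> equals 1 up to \<open>e0\<close>, the scaled plateau up
    to \<open>\<epsilon> / 2\<close>.\<close>
  define e where "e = min e0 (\<epsilon> / 2)"
  have "corrector n \<beta>' \<Theta> \<Theta>' (\<lambda>z. \<rho> (inverse \<epsilon> * z + 0)) e \<epsilon> \<delta>"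
    unfolding corrector_def
  proof (intro conjI allI impI)
    show "smooth (\<lambda>z. \<rho> (inverse \<epsilon> * z + 0))" by (rule smooth_affine[OF \<rho>(1)])
    show "0 < e" "e \<le> \<epsilon>" using \<Theta>(1,2) \<epsilon> by (auto simp: e_def)
    show "\<Theta>' z = 1" if "\<bar>z\<bar> \<le> e" for z using that \<Theta>(7) by (simp add: e_def)
    show "\<rho> (inverse \<epsilon> * z + 0) = 1" if "\<bar>z\<bar> \<le> e" for z
      using that \<epsilon> by (intro \<rho>(4)) (simp add: e_def abs_mult divide_simps)
    show "\<rho> (inverse \<epsilon> * z + 0) = 0" if "\<epsilon> \<le> \<bar>z\<bar>" for z
      using that \<epsilon> by (intro \<rho>(5)) (simp add: abs_mult divide_simps)
    show "\<bar>\<Theta> z\<bar> \<le> 1" for z using \<Theta>\<delta>[of z] \<delta>1 by linarith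
    show "B n * \<bar>\<beta>' x * \<Theta> z\<bar> \<le> \<kappa> n" for x z
    proof -
      have "\<bar>\<beta>' x * \<Theta> z\<bar> \<le> D * \<delta>" unfolding abs_mult using D[of x] \<Theta>\<delta>[of z] D0 by (intro mult_mono) auto
      then have "B n * \<bar>\<beta>' x * \<Theta> z\<bar> \<le> B n * (D * \<delta>)" using B3 by (intro mult_left_mono) auto
      then show ?thesis using \<delta>3 by linarith
    qed
  qed (use \<Theta> \<rho> \<delta> \<delta>1 \<delta>2 in \<open>auto intro: less_imp_le\<close>)
  then show ?thesis by blast
qed

text \<open>All demands on the next cutoff go into its region \<open>V\<close>, inside a
  neighbourhood where \<open>\<beta>\<close> is 1 and close to \<open>E\<close>, and into
  \<open>\<eta>\<close>, which limits both the measure of the support and the height of the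
  primitive.\<close>

lemma cutoff_step:
  assumes E: "compact E" "E \<in> null_sets lebesgue" and c: "cutoff E n \<beta> \<beta>' Q" and e: "0 < e"
  shows "\<exists>\<gamma> \<gamma>' R. cutoff E (Suc n) \<gamma> \<gamma>' R \<and> (\<forall>x. \<gamma> x \<noteq> 0 \<longrightarrow> \<beta> x = 1) \<and> (\<forall>x. 0 \<le> R x \<and> R x \<le> e / 4)"
proof -
  obtain G where G: "open G" "E \<subseteq> G" "\<forall>x\<in>G. \<beta> x = 1" using c unfolding cutoff_def by (elim conjE exE)
  define V where "V = G \<inter> (\<Union>y\<in>E. ball y (1 / (real n + 1)))"
  have V: "open V" "E \<subseteq> V" using G(1,2) by (auto simp: V_def)
  define \<eta> where "\<eta> = min (e / 4) ((1/2) ^ n / bb (Suc n))"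
  have \<eta>: "\<eta> > 0" using e bb_ge[of "Suc n"] by (simp add: \<eta>_def)
  obtain \<gamma> \<gamma>' R :: "real \<Rightarrow> real" and G' D where g: "smooth \<gamma>" "smooth \<gamma>'" "smooth R"
    "\<forall>x. (\<gamma> has_real_derivative \<gamma>' x) (at x)" "\<forall>x. (R has_real_derivative \<gamma> x) (at x)"
    "\<forall>x. 0 \<le> \<gamma> x \<and> \<gamma> x \<le> 1" "open G'" "E \<subseteq> G'" "\<forall>x\<in>G'. \<gamma> x = 1"
    "\<forall>x. \<gamma> x \<noteq> 0 \<longrightarrow> x \<in> V" "emeasure lebesgue {x. \<gamma> x \<noteq> 0} \<le> ennreal \<eta>"
    "\<forall>x. 0 \<le> R x \<and> R x \<le> \<eta>" "\<forall>x. \<bar>\<gamma>' x\<bar> \<le> D"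
    using smooth_bump_near_null_set[OF E V \<eta>] by (elim exE conjE)
  have "cutoff E (Suc n) \<gamma> \<gamma>' R"
    unfolding cutoff_def
  proof (intro conjI allI impI)
    show "\<exists>G. open G \<and> E \<subseteq> G \<and> (\<forall>x\<in>G. \<gamma> x = 1)" using g(7-9) by blast
    show "\<exists>D. \<forall>x. \<bar>\<gamma>' x\<bar> \<le> D" using g(13) by blast
    show "\<exists>y\<in>E. \<bar>x - y\<bar> < 1 / (real k + 1)" if h: "Suc n = Suc k" "\<gamma> x \<noteq> 0" for k x
    proof -
      obtain y where "y \<in> E" "x \<in> ball y (1 / (real n + 1))" using g(10) h(2) unfolding V_def by blast
      then show ?thesis using h(1) by (intro bexI[of _ y]) (simp_all add: dist_real_def abs_minus_commute)
    qed
    show "emeasure lebesgue {x. \<gamma> x \<noteq> 0} \<le> ennreal ((1/2) ^ k / bb (Suc n))" if "Suc n = Suc k" for k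
    proof -
      have "ennreal \<eta> \<le> ennreal ((1/2) ^ n / bb (Suc n))" by (intro ennreal_leI) (simp add: \<eta>_def)
      then show ?thesis using g(11) that by simp
    qed
  qed (use g(1-6) in simp_all)
  moreover have "\<forall>x. \<gamma> x \<noteq> 0 \<longrightarrow> \<beta> x = 1" using g(10) G(3) by (auto simp: V_def)
  moreover have "\<forall>x. 0 \<le> R x \<and> R x \<le> e / 4"
  proof
    fix x
    have "\<eta> \<le> e / 4" unfolding \<eta>_def by (rule min.cobounded1)
    then show "0 \<le> R x \<and> R x \<le> e / 4" using spec[OF g(12), of x] by linarith
  qed
  ultimately show ?thesis by blast
qed

lemma cutoff_0: "cutoff E 0 (\<lambda>x. 1) (\<lambda>x. 0) (\<lambda>x. x)"
  unfolding cutoff_def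
proof (intro conjI allI impI)
  show "\<exists>G. open G \<and> E \<subseteq> G \<and> (\<forall>x\<in>G. (1::real) = 1)" by (rule exI[of _ UNIV]) simp
  show "\<exists>D. \<forall>x::real. \<bar>0::real\<bar> \<le> D" by (rule exI[of _ 0]) simp
qed auto

text \<open>Dependent choice on nine-tuples: stage \<open>n + 1\<close> must respect
  \<open>e n\<close>, which is known only after \<open>\<Theta> n\<close> has been chosen.\<close>

lemma construction_exists:
  assumes E: "compact E" "E \<in> null_sets lebesgue"
  shows "\<exists>(\<beta>::nat \<Rightarrow> real \<Rightarrow> real) \<beta>' Q \<Theta> \<Theta>' \<rho> e \<epsilon> \<delta>. \<forall>n.
    cutoff E n (\<beta> n) (\<beta>' n) (Q n) \<and> corrector n (\<beta>' n) (\<Theta> n) (\<Theta>' n) (\<rho> n) (e n) (\<epsilon> n) (\<delta> n) \<and>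
    (\<forall>x. \<beta> (Suc n) x \<noteq> 0 \<longrightarrow> \<beta> n x = 1) \<and> (\<forall>x. 0 \<le> Q (Suc n) x \<and> Q (Suc n) x \<le> e n / 4) \<and> \<epsilon> (Suc n) \<le> e n / 2"
proof -
  let ?P = "\<lambda>n (\<beta>, \<beta>', Q, \<Theta>, \<Theta>', \<rho>, e, \<epsilon>, \<delta>). cutoff E n \<beta> \<beta>' Q \<and> corrector n \<beta>' \<Theta> \<Theta>' \<rho> e \<epsilon> \<delta>"
  let ?R = "\<lambda>n (\<beta>, \<beta>', Q, \<Theta>, \<Theta>', \<rho>, e, \<epsilon>, \<delta>) (\<gamma>, \<gamma>', R, \<Xi>, \<Xi>', \<rho>', e', \<epsilon>', \<delta>').
    (\<forall>x. \<gamma> x \<noteq> 0 \<longrightarrow> \<beta> x = 1) \<and> (\<forall>x. 0 \<le> R x \<and> R x \<le> e / 4) \<and> \<epsilon>' \<le> e / (2::real)"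
  have "\<exists>f. \<forall>n. ?P n (f n) \<and> ?R n (f n) (f (Suc n))"
  proof (rule dependent_nat_choice)
    have "\<exists>\<Theta> \<Theta>' \<rho> e \<delta>. corrector 0 (\<lambda>x. 0) \<Theta> \<Theta>' \<rho> e 1 \<delta>"
      by (rule corrector_exists[of 1 "\<lambda>x. 0" 0]) auto
    then obtain \<Theta> \<Theta>' \<rho> e \<delta> where "corrector 0 (\<lambda>x. 0) \<Theta> \<Theta>' \<rho> e 1 \<delta>" by blast
    then show "\<exists>s. ?P 0 s"
      using cutoff_0 by (intro exI[of _ "(\<lambda>x. 1, \<lambda>x. 0, \<lambda>x. x, \<Theta>, \<Theta>', \<rho>, e, 1, \<delta>)"]) simp
  next
    fix s n assume "?P n s"
    then obtain \<beta> \<beta>' Q \<Theta> \<Theta>' \<rho> e \<epsilon> \<delta> where s: "s = (\<beta>, \<beta>', Q, \<Theta>, \<Theta>', \<rho>, e, \<epsilon>, \<delta>)"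
      and c: "cutoff E n \<beta> \<beta>' Q" and k: "corrector n \<beta>' \<Theta> \<Theta>' \<rho> e \<epsilon> \<delta>"
      by (cases s) auto
    have e: "0 < e" using k by (simp add: corrector_def)
    obtain \<gamma> \<gamma>' R where g: "cutoff E (Suc n) \<gamma> \<gamma>' R" "\<forall>x. \<gamma> x \<noteq> 0 \<longrightarrow> \<beta> x = 1" "\<forall>x. 0 \<le> R x \<and> R x \<le> e / 4"
      using cutoff_step[OF E c e] by blast
    obtain D where "\<forall>x. \<bar>\<gamma>' x\<bar> \<le> D" using g(1) unfolding cutoff_def by (elim conjE exE)
    then obtain \<Xi> \<Xi>' \<rho>' e' \<delta>' where "corrector (Suc n) \<gamma>' \<Xi> \<Xi>' \<rho>' e' (e / 2) \<delta>'"
      using corrector_exists[of "e / 2" \<gamma>' D "Suc n"] e by auto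
    then show "\<exists>s'. ?P (Suc n) s' \<and> ?R n s s'"
      using g by (intro exI[of _ "(\<gamma>, \<gamma>', R, \<Xi>, \<Xi>', \<rho>', e', e / 2, \<delta>')"]) (simp add: s)
  qed
  then obtain f where f: "\<forall>n. ?P n (f n) \<and> ?R n (f n) (f (Suc n))" ..
  show ?thesis
    by (rule exI[of _ "\<lambda>n. fst (f n)"], rule exI[of _ "\<lambda>n. fst (snd (f n))"],
        rule exI[of _ "\<lambda>n. fst (snd (snd (f n)))"], rule exI[of _ "\<lambda>n. fst (snd (snd (snd (f n))))"],
        rule exI[of _ "\<lambda>n. fst (snd (snd (snd (snd (f n)))))"], rule exI[of _ "\<lambda>n. fst (snd (snd (snd (snd (snd (f n))))))"],
        rule exI[of _ "\<lambda>n. fst (snd (snd (snd (snd (snd (snd (f n)))))))"],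
        rule exI[of _ "\<lambda>n. fst (snd (snd (snd (snd (snd (snd (snd (f n))))))))"],
        rule exI[of _ "\<lambda>n. snd (snd (snd (snd (snd (snd (snd (snd (f n))))))))"])
      (rule f[unfolded case_prod_unfold conj_assoc])
qed

end

lemma strict_convex_tangent:
  fixes \<omega> \<omega>' :: "real \<Rightarrow> real"
  assumes sc: "strict_convex_on UNIV \<omega>" and d: "\<And>x. (\<omega> has_real_derivative \<omega>' x) (at x)" and pr: "p \<noteq> r"
  shows "\<omega> r + \<omega>' r * (p - r) < \<omega> p"
proof -
  have lt: "\<omega> ((1 - t) * x + t * y) < (1 - t) * \<omega> x + t * \<omega> y" if "x \<noteq> y" "0 < t" "t < 1" for x y t
    using sc that unfolding strict_convex_on_def by auto
  have "convex_on UNIV \<omega>"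
  proof (rule convex_onI)
    show "\<omega> ((1 - t) *\<^sub>R x + t *\<^sub>R y) \<le> (1 - t) * \<omega> x + t * \<omega> y" if "0 < t" "t < 1" for t x y
    proof (cases "x = y")
      case True
      have "(1 - t) * y + t * y = y" by (simp add: algebra_simps)
      moreover have "(1 - t) * \<omega> y + t * \<omega> y = \<omega> y" by (simp add: algebra_simps)
      ultimately show ?thesis using True by simp
    qed (use lt[of x y t] that in simp)
  qed simp
  then have above: "\<omega>' r * (q - r) \<le> \<omega> q - \<omega> r" for q
    by (rule convex_on_imp_above_tangent) (use d in auto)
  \<comment> \<open>The weak tangent inequality is applied at the midpoint, where the value lies
    strictly below the chord.\<close>
  define c where "c = (1 - 1/2) * r + 1/2 * p"
  have "\<omega> c < (1 - 1/2) * \<omega> r + 1/2 * \<omega> p" unfolding c_def using pr by (intro lt) auto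
  moreover have "\<omega>' r * (p - r) / 2 \<le> \<omega> c - \<omega> r" using above[of c] by (simp add: c_def field_simps)
  ultimately show ?thesis by (simp add: field_simps)
qed

theorem theorem1p1:
  fixes a b :: real and E :: "real set" and \<omega> :: "real \<Rightarrow> real"
  assumes "a < b"
    and "E \<subseteq> {a..b}" and "closed E" and "E \<in> null_sets lebesgue"
    and "smooth \<omega>" and "strict_convex_on UNIV \<omega>"
    and "\<omega> 0 = 0" and "\<And>p. \<omega> p \<ge> \<omega> 0"
    and "filterlim (\<lambda>p. \<omega> p / \<bar>p\<bar>) at_top at_infinity"
  shows "\<exists>(L :: real \<Rightarrow> real \<Rightarrow> real \<Rightarrow> real) (u :: real \<Rightarrow> real).
     smooth (\<lambda>(x, y, p). L x y p) \<and>
     (\<forall>x y. strict_convex_on UNIV (L x y)) \<and>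
     (\<forall>x y p. L x y p \<ge> \<omega> p) \<and>
     absolutely_continuous_on a b u \<and>
     (\<forall>v. absolutely_continuous_on a b v \<and> v a = u a \<and> v b = u b \<longrightarrow>
          functional L a b u \<le> functional L a b v \<and>
          ((\<exists>x\<in>{a..b}. v x \<noteq> u x) \<longrightarrow> functional L a b u < functional L a b v)) \<and>
     singular_set u a b = E \<and>
     (\<exists>U :: nat \<Rightarrow> real \<Rightarrow> real.
        (\<forall>k. smooth (U k) \<and> U k a = u a \<and> U k b = u b) \<and>
        uniform_limit {a..b} U u sequentially \<and>
        (\<lambda>k. functional L a b (U k)) \<longlonglongrightarrow> functional L a b u)"
proof -
  obtain \<omega>' where \<omega>': "smooth \<omega>'" "\<And>x. (\<omega> has_real_derivative \<omega>' x) (at x)"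
    using smooth_real_derivE[OF assms(5)] by blast
  have "\<exists>M\<ge>0. \<forall>p. \<bar>p\<bar> \<le> \<omega> p + M"
  proof -
    have "\<forall>\<^sub>F p in at_infinity. 1 \<le> \<omega> p / \<bar>p\<bar>"
      using assms(9) by (simp add: filterlim_at_top)
    then obtain K where K: "\<And>p. K \<le> \<bar>p\<bar> \<Longrightarrow> 1 \<le> \<omega> p / \<bar>p\<bar>"
      by (auto simp: eventually_at_infinity)
    \<comment> \<open>Beyond \<open>K\<close> the quotient is at least 1; below it
      \<open>\<omega> p\<close> is nonnegative and \<open>K\<close> bounds
      \<open>\<bar>p\<bar>\<close>. The value \<open>p = 0\<close>, where the quotient is 0 by
      convention, falls under the second case.\<close>
    have "\<bar>p\<bar> \<le> \<omega> p + max K 0" for p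
    proof (cases "K \<le> \<bar>p\<bar> \<and> p \<noteq> 0")
      case True
      then show ?thesis using K[of p] by (simp add: le_divide_eq)
    next
      case False
      then show ?thesis using assms(8)[of p] assms(7) by auto
    qed
    then show ?thesis by (intro exI[of _ "max K 0"]) simp
  qed
  then obtain M where M: "0 \<le> M" "\<And>p. \<bar>p\<bar> \<le> \<omega> p + M" by blast
  interpret energy_density \<omega> \<omega>' M
    using assms(5,7,8) \<omega>' M strict_convex_tangent[OF assms(6) \<omega>'(2)] by unfold_locales auto
  have "compact E" using assms(2,3) by (meson bounded_closed_interval bounded_subset compact_eq_bounded_closed)
  from construction_exists[OF this assms(4)]
  obtain \<beta> \<beta>' Q \<Theta> \<Theta>' \<rho> e \<epsilon> \<delta> where c: "\<forall>n.
    cutoff E n (\<beta> n) (\<beta>' n) (Q n) \<and> corrector n (\<beta>' n) (\<Theta> n) (\<Theta>' n) (\<rho> n) (e n) (\<epsilon> n) (\<delta> n) \<and>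
    (\<forall>x. \<beta> (Suc n) x \<noteq> 0 \<longrightarrow> \<beta> n x = 1) \<and> (\<forall>x. 0 \<le> Q (Suc n) x \<and> Q (Suc n) x \<le> e n / 4) \<and> \<epsilon> (Suc n) \<le> e n / 2"
    by (elim exE)
  obtain T c\<^sub>T where T: "smooth T" "convex_on UNIV T" "\<And>s. 0 \<le> T s" "\<And>s. s \<le> T s"
    "\<And>s. s \<ge> 1 \<Longrightarrow> T s = s" "\<And>s. s \<le> 0 \<Longrightarrow> T s = c\<^sub>T" "\<And>s. T s \<le> max s 0 + 1"
    using smooth_convex_positive_part_exists by blast
  have cut: "cutoff E n (\<beta> n) (\<beta>' n) (Q n)" and cor: "corrector n (\<beta>' n) (\<Theta> n) (\<Theta>' n) (\<rho> n) (e n) (\<epsilon> n) (\<delta> n)" for n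
    using c by blast+
  interpret singular_construction \<omega> \<omega>' M a b E \<beta> \<beta>' Q \<Theta> \<Theta>' \<rho> e \<epsilon> \<delta> T c\<^sub>T
  proof
    show "\<beta> 0 x = 1" "Q 0 x = x" for x using cut[of 0] by (simp_all add: cutoff_def)
    show "smooth (\<beta> n)" "smooth (\<beta>' n)" "smooth (Q n)" for n using cut[of n] by (simp_all add: cutoff_def)
    show "(\<beta> n has_real_derivative \<beta>' n x) (at x)" "(Q n has_real_derivative \<beta> n x) (at x)"
      "0 \<le> \<beta> n x" "\<beta> n x \<le> 1" for n x using cut[of n] by (simp_all add: cutoff_def)
    show "\<exists>G. open G \<and> E \<subseteq> G \<and> (\<forall>x\<in>G. \<beta> n x = 1)" "\<exists>D. \<forall>x. \<bar>\<beta>' n x\<bar> \<le> D" for n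
      using cut[of n] by (simp_all add: cutoff_def)
    show "\<exists>y\<in>E. \<bar>x - y\<bar> < 1 / (real n + 1)" if "\<beta> (Suc n) x \<noteq> 0" for n x
      using cut[of "Suc n"] that unfolding cutoff_def by blast
    show "emeasure lebesgue {x. \<beta> (Suc n) x \<noteq> 0} \<le> ennreal ((1/2) ^ n / bb (Suc n))" for n
      using cut[of "Suc n"] unfolding cutoff_def by blast
    show "\<beta> n x = 1" if "\<beta> (Suc n) x \<noteq> 0" for n x using c that by blast
    show "0 \<le> Q (Suc n) x" "Q (Suc n) x \<le> e n / 4" "\<epsilon> (Suc n) \<le> e n / 2" for n x using c by blast+
    show "smooth (\<Theta> n)" "smooth (\<Theta>' n)" "smooth (\<rho> n)" for n using cor[of n] by (simp_all add: corrector_def)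
    show "(\<Theta> n has_real_derivative \<Theta>' n z) (at z)" "\<bar>\<Theta> n z\<bar> \<le> 1" "- \<delta> n \<le> \<Theta>' n z" "\<Theta>' n z \<le> 1"
      "0 \<le> \<rho> n z" "\<rho> n z \<le> 1" for n z
      using cor[of n] unfolding corrector_def by blast+
    show "\<Theta>' n z = 1" "\<rho> n z = 1" if "\<bar>z\<bar> \<le> e n" for n z
      using cor[of n] that unfolding corrector_def by blast+
    show "\<Theta> n z = 0" "\<Theta>' n z = 0" "\<rho> n z = 0" if "\<epsilon> n \<le> \<bar>z\<bar>" for n z
      using cor[of n] that unfolding corrector_def by blast+
    show "B n * \<bar>\<beta>' n x * \<Theta> n z\<bar> \<le> \<kappa> n" for n x z using cor[of n] unfolding corrector_def by blast
    show "0 \<le> \<delta> n" "\<delta> n \<le> 1" "B n * \<delta> n * (real n + 1) \<le> \<kappa> n" "0 < e n" "e n \<le> \<epsilon> n" for n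
      using cor[of n] unfolding corrector_def by blast+
  qed (fact assms T)+
  show ?thesis
  proof (rule exI[of _ L], rule exI[of _ u], intro conjI allI impI)
    show "smooth (\<lambda>(x, y, p). L x y p)" by (rule smooth_L)
    show "strict_convex_on UNIV (L x y)" for x y by (rule strict_convex_L)
    show "\<omega> p \<le> L x y p" for x y p by (rule L_ge_\<omega>)
    show "absolutely_continuous_on a b u" by (rule u_AC)
    show "functional L a b u \<le> functional L a b v" if "absolutely_continuous_on a b v \<and> v a = u a \<and> v b = u b" for v
      using that by (intro minimizer(1)) auto
    show "functional L a b u < functional L a b v"
      if "absolutely_continuous_on a b v \<and> v a = u a \<and> v b = u b" "\<exists>x\<in>{a..b}. v x \<noteq> u x" for v
      using that by (intro minimizer(2)) auto
    show "singular_set u a b = E" by (rule singular_set_u)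
    show "\<exists>U :: nat \<Rightarrow> real \<Rightarrow> real.
        (\<forall>k. smooth (U k) \<and> U k a = u a \<and> U k b = u b) \<and>
        uniform_limit {a..b} U u sequentially \<and>
        (\<lambda>k. functional L a b (U k)) \<longlonglongrightarrow> functional L a b u"
      using smooth_U U_ends U_uniform U_energy by blast
  qed
qed

end
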